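(* Let $k,c>0$, $\alpha=\frac{k}{4c}$. The solution to the problem $$u_{tt}+ku_t=c^2u_{xx},\qquad u(0)=\delta,\qquad u_t(0)=-c\,\delta'$$ is, for each $t\ge0$, a probability density function in $x\in\mathbb{R}$, and it is given by $$u(x,t)=e^{-\frac{k}{2}t}\delta(x-ct)+e^{-\frac{k}{2}t}\left(\alpha(x+ct)\frac{I_0'(2\alpha\sqrt{\lambda_0})}{\sqrt{\lambda_0}}+\frac{k}{4c}I_0(2\alpha\sqrt{\lambda_0})\right)\mathcal{X}_{(-ct,ct)}(x),$$ where $\lambda_0=c^2t^2-x^2$.
   Context: $I_0$ is the modified Bessel function of the first kind of order $0$, $\mathcal{X}_\Omega$ is the characteristic function of $\Omega$, $\delta$ is the Dirac delta at $0$ in $\mathbb{R}$, $\delta(x-ct)$ the Dirac delta at $x=ct$, and $\delta'$ the distributional derivative of $\delta$ (so $\langle -c\delta',\varphi\rangle=c\varphi'(0)$). "The solution" is the unique $u\in\mathcal{C}^1(\mathbb{R},\mathcal{D}'(\mathbb{R}))$ (maps $t\mapsto u(t)\in\mathcal{D}'(\mathbb{R})$ that are continuously differentiable when tested against each $\varphi\in\mathcal{C}_0^\infty(\mathbb{R})$, with derivative $u_t(t)\in\mathcal{D}'(\mathbb{R})$) that satisfies the equation in $\mathcal{D}'(\mathbb{R}\times\mathbb{R})$, i.e. $\int_{\mathbb{R}}\langle u(t),(\phi_{tt}-k\phi_t-c^2\phi_{xx})(\cdot,t)\rangle\,dt=0$ for all $\phi\in\mathcal{C}_0^\infty(\mathbb{R}^2)$,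 and the initial conditions in $\mathcal{D}'(\mathbb{R})$ at $t=0$. "Probability density function" is meant in the mixed sense: $u(\cdot,t)$ is a nonnegative measure on $\mathbb{R}$ of total mass $1$, with a discrete part (a multiple of a Dirac delta) and an absolutely continuous part. *)

theory Defs
  imports "HOL-Probability.Probability"
begin

primrec C_k :: "nat \<Rightarrow> ('a::real_normed_vector \<Rightarrow> real) \<Rightarrow> bool" where
  "C_k 0 f \<longleftrightarrow> continuous_on UNIV f"
| "C_k (Suc n) f \<longleftrightarrow>
     (\<forall>x. f differentiable (at x)) \<and> (\<forall>v. C_k n (\<lambda>x. frechet_derivative f (at x) v))"

definition smooth :: "('a::real_normed_vector \<Rightarrow> real) \<Rightarrow> bool" where
  "smooth f \<longleftrightarrow> (\<forall>n. C_k n f)"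

definition supp :: "('a::topological_space \<Rightarrow> real) \<Rightarrow> 'a set" where
  "supp f = closure {x. f x \<noteq> 0}"

definition test_functions :: "('a::real_normed_vector \<Rightarrow> real) set" where
  "test_functions = {\<phi>. smooth \<phi> \<and> compact (supp \<phi>)}"

text \<open>Distributions on the real line. A functional is total in HOL, so its values off the
  test functions are pinned down by extensionality; equality of distributions is then plain
  equality. Continuity is stated by the usual seminorm estimates on each compact set.\<close>

type_synonym functional = "(real \<Rightarrow> real) \<Rightarrow> real"

definition distributions :: "functional set" where
  "distributions = {\<Lambda> \<in> extensional test_functions.
     (\<forall>\<phi>\<in>test_functions. \<forall>\<psi>\<in>test_functions. \<forall>a b.
        \<Lambda> (\<lambda>x. a * \<phi> x + b * \<psi> x) = a * \<Lambda> \<phi> + b * \<Lambda> \<psi>) \<and>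
     (\<forall>K. compact K \<longrightarrow> (\<exists>C N. \<forall>\<phi>\<in>test_functions. supp \<phi> \<subseteq> K \<longrightarrow>
        \<bar>\<Lambda> \<phi>\<bar> \<le> C * (\<Sum>j\<le>N. SUP x. \<bar>(deriv ^^ j) \<phi> x\<bar>)))}"

definition dirac :: "real \<Rightarrow> functional" where
  "dirac a = (\<lambda>\<phi>\<in>test_functions. \<phi> a)"

definition distr_deriv :: "functional \<Rightarrow> functional" where
  "distr_deriv \<Lambda> = (\<lambda>\<phi>\<in>test_functions. - \<Lambda> (deriv \<phi>))"

definition distr_scale :: "real \<Rightarrow> functional \<Rightarrow> functional" where
  "distr_scale a \<Lambda> = (\<lambda>\<phi>\<in>test_functions. a * \<Lambda> \<phi>)"

definition distr_add :: "functional \<Rightarrow> functional \<Rightarrow> functional" where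
  "distr_add \<Lambda> \<Gamma> = (\<lambda>\<phi>\<in>test_functions. \<Lambda> \<phi> + \<Gamma> \<phi>)"

definition distr_of_fun :: "(real \<Rightarrow> real) \<Rightarrow> functional" where
  "distr_of_fun f = (\<lambda>\<phi>\<in>test_functions. \<integral>x. f x * \<phi> x \<partial>lborel)"

definition distr_of_measure :: "real measure \<Rightarrow> functional" where
  "distr_of_measure M = (\<lambda>\<phi>\<in>test_functions. \<integral>x. \<phi> x \<partial>M)"

definition time_deriv :: "(real \<Rightarrow> functional) \<Rightarrow> real \<Rightarrow> functional" where
  "time_deriv u t = (\<lambda>\<phi>\<in>test_functions. deriv (\<lambda>s. u s \<phi>) t)"

definition C1_distr :: "(real \<Rightarrow> functional) \<Rightarrow> bool" where
  "C1_distr u \<longleftrightarrow>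
     (\<forall>t. u t \<in> distributions \<and> time_deriv u t \<in> distributions) \<and>
     (\<forall>\<phi>\<in>test_functions.
        (\<forall>t. (\<lambda>s. u s \<phi>) differentiable (at t)) \<and>
        continuous_on UNIV (\<lambda>t. time_deriv u t \<phi>))"

text \<open>Points of the plane are pairs \<open>(x, t)\<close>. The weak form is the equation
  \<open>u\<^sub>t\<^sub>t + k u\<^sub>t = c\<^sup>2 u\<^sub>x\<^sub>x\<close> tested in the sense of distributions on the plane; using
  \<open>has_bochner_integral\<close> makes integrability in \<open>t\<close> part of the requirement, rather than
  relying on the default value of a divergent integral.\<close>

definition telegraph_weak :: "real \<Rightarrow> real \<Rightarrow> (real \<Rightarrow> functional) \<Rightarrow> bool" where
  "telegraph_weak k c u \<longleftrightarrow>
     (\<forall>\<phi> \<in> (test_functions :: (real \<times> real \<Rightarrow> real) set).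
        has_bochner_integral lborel
          (\<lambda>t. u t (\<lambda>x. (deriv ^^ 2) (\<lambda>s. \<phi> (x, s)) t
                      - k * deriv (\<lambda>s. \<phi> (x, s)) t
                      - c\<^sup>2 * (deriv ^^ 2) (\<lambda>y. \<phi> (y, t)) x))
          0)"

definition telegraph_solution :: "real \<Rightarrow> real \<Rightarrow> (real \<Rightarrow> functional) \<Rightarrow> bool" where
  "telegraph_solution k c u \<longleftrightarrow>
     C1_distr u \<and> telegraph_weak k c u \<and>
     u 0 = dirac 0 \<and> time_deriv u 0 = distr_scale (- c) (distr_deriv (dirac 0))"

definition mixed_pdf :: "functional \<Rightarrow> bool" where
  "mixed_pdf \<Lambda> \<longleftrightarrow>
     (\<exists>M. prob_space M \<and> sets M = sets borel \<and> \<Lambda> = distr_of_measure M \<and>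
        (\<exists>p a f. 0 \<le> p \<and> f \<in> borel_measurable borel \<and> (\<forall>x. 0 \<le> f x) \<and>
           (\<forall>A\<in>sets borel. emeasure M A =
              ennreal p * indicator A a + (\<integral>\<^sup>+x\<in>A. ennreal (f x) \<partial>lborel))))"



definition bessel_I0 :: "real \<Rightarrow> real" where
  "bessel_I0 z = (\<Sum>m. (z / 2) ^ (2 * m) / (fact m)\<^sup>2)"

end

theory Submission
  imports Defs
begin

text \<open>After the substitution \<open>u = exp (- k t / 2) v\<close> the equation becomes the Klein--Gordon equation
  \<open>v\<^sub>t\<^sub>t = c\<^sup>2 v\<^sub>x\<^sub>x + (k\<^sup>2 / 4) v\<close>, whose fundamental solution \<open>E(t)\<close> is explicit in terms of \<open>I\<^sub>0\<close>;
  the solution is \<open>u = exp (- k t / 2) (\<partial>\<^sub>t - c \<partial>\<^sub>x + k / 2) E\<close>.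
  Testing the weak equation against products \<open>\<psi>(x) \<eta>(t)\<close> shows that \<open>t \<mapsto> \<langle>u(t), \<psi>\<rangle>\<close> is twice
  differentiable and satisfies the equation pointwise. Uniqueness is then Holmgren duality: the pairing of
  \<open>u(s)\<close> with the classical backward solution from time \<open>T\<close> is constant in \<open>s\<close>, where differentiating
  \<open>\<langle>u(s), \<Phi>(s)\<rangle>\<close> is justified by the uniform boundedness principle on test functions.
  Positivity is read off the power series, and the total mass solves \<open>m' = (k / 2) m\<close> in the \<open>v\<close> picture.\<close>

section \<open>Smooth functions and test functions\<close>

text \<open>The operator applied to E is dictated by the data: E(0) = 0, E_t(0) = \<delta>, E_tt(0)
  = 0, whereas v must start from \<delta> with velocity -c \<delta>' + (k / 2) \<delta>. Of the half
  atoms that E_t has at x = ct and x = -ct, the term -c E_x doubles the first and cancels the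
  second. The mass 4 a = \<open>k\<^sup>2 / 4\<close> forces a = \<open>k\<^sup>2 / 16\<close>, and
  a / \<open>c\<^sup>2\<close> is the square of \<alpha>, whence the Bessel argument. The obstacle
  is the weakness of \<open>C1_distr\<close>: it gives differentiability only against each fixed
  test function, with orders and constants that may change with t. The backward solution has value 0
  and velocity \<psi> at time T, so that at s = T only u(T) tested against \<psi> remains, while at
  s = 0 the data reproduce the explicit formula. Times of both signs are treated alike; only
  positivity and the density formula require t nonnegative.\<close>

lemma frechet_derivative_real:
  fixes f :: "real \<Rightarrow> real"
  assumes "f differentiable (at x)"
  shows "frechet_derivative f (at x) v = deriv f x * v"
proof -
  have "(f has_real_derivative deriv f x) (at x)"
    using assms by (metis DERIV_imp_deriv real_differentiable_def)
  then have "(f has_derivative (\<lambda>v. deriv f x * v)) (at x)"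
    by (simp add: has_field_derivative_def)
  then show ?thesis
    by (metis frechet_derivative_at)
qed

lemma frechet_derivative_lincomb:
  fixes f g :: "'a::real_normed_vector \<Rightarrow> real"
  assumes "f differentiable (at x)" "g differentiable (at x)"
  shows "frechet_derivative (\<lambda>x. a * f x + b * g x) (at x) =
    (\<lambda>v. a * frechet_derivative f (at x) v + b * frechet_derivative g (at x) v)"
  using assms
  by (intro frechet_derivative_at[symmetric] has_derivative_add has_derivative_mult_right)
     (simp_all add: frechet_derivative_works)

lemma C_k_lincomb:
  assumes "C_k n f" "C_k n g"
  shows "C_k n (\<lambda>x. a * f x + b * g x)"
  using assms
proof (induction n arbitrary: f g)
  case 0
  then show ?case by (auto intro!: continuous_intros)
next
  case (Suc n)
  then show ?case
    by (auto simp: frechet_derivative_lincomb intro!: derivative_intros)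
qed

lemma smooth_lincomb: "smooth f \<Longrightarrow> smooth g \<Longrightarrow> smooth (\<lambda>x. a * f x + b * g x)"
  by (simp add: smooth_def C_k_lincomb)

lemma smooth_differentiable: "smooth f \<Longrightarrow> f differentiable (at x)"
  by (metis C_k.simps(2) smooth_def)

lemma smooth_frechet_derivative: "smooth f \<Longrightarrow> smooth (\<lambda>x. frechet_derivative f (at x) v)"
  by (metis C_k.simps(2) smooth_def)

lemma smooth_continuous_on: "smooth f \<Longrightarrow> continuous_on A f"
  by (metis C_k.simps(1) smooth_def continuous_on_subset subset_UNIV)

lemma smooth_deriv:
  fixes f :: "real \<Rightarrow> real"
  assumes "smooth f"
  shows "smooth (deriv f)"
  using smooth_frechet_derivative[OF assms, of 1]
  by (simp add: frechet_derivative_real smooth_differentiable assms)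

lemma smooth_has_deriv:
  fixes f :: "real \<Rightarrow> real"
  assumes "smooth f"
  shows "(f has_real_derivative deriv f x) (at x)"
  using smooth_differentiable[OF assms] by (metis DERIV_imp_deriv real_differentiable_def)

lemma smooth_deriv_iter:
  fixes f :: "real \<Rightarrow> real"
  shows "smooth f \<Longrightarrow> smooth ((deriv ^^ j) f)"
  by (induction j) (auto simp: smooth_deriv)

lemma smooth_has_deriv_iter:
  fixes f :: "real \<Rightarrow> real"
  assumes "smooth f"
  shows "((deriv ^^ j) f has_real_derivative (deriv ^^ Suc j) f x) (at x)"
  using smooth_has_deriv[OF smooth_deriv_iter[OF assms]] by simp

text \<open>On the line a ladder of functions, each the derivative of the one before, replaces the
  Frechet derivatives in all directions that \<open>smooth\<close> speaks of. Smoothness and the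
  iterated derivatives then come from one differentiation step.\<close>

lemma smooth_from_derivs:
  fixes D :: "nat \<Rightarrow> real \<Rightarrow> real"
  assumes D: "\<And>j x. (D j has_real_derivative D (Suc j) x) (at x)"
  shows "smooth (D i)" and "(deriv ^^ j) (D 0) = D j"
proof -
  have ck: "C_k n (D i)" for n i
  proof (induction n arbitrary: i)
    case 0
    then show ?case
      using D by (auto intro!: continuous_at_imp_continuous_on DERIV_isCont)
  next
    case (Suc n)
    have df: "D i differentiable (at x)" for x
      using D real_differentiable_def by blast
    \<comment> \<open>The zero summand only casts a scalar multiple into the shape handled by
      \<open>C_k_lincomb\<close>.\<close>
    have "frechet_derivative (D i) (at x) v = v * D (Suc i) x + 0 * D i x" for x v
      using D by (simp add: frechet_derivative_real[OF df] DERIV_imp_deriv)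
    moreover have "C_k n (\<lambda>x. v * D (Suc i) x + 0 * D (Suc i) x)" for v
      by (intro C_k_lincomb Suc)
    ultimately show ?case using df by simp
  qed
  then show "smooth (D i)" by (simp add: smooth_def)
  show "(deriv ^^ j) (D 0) = D j"
    using D by (induction j) (auto simp: DERIV_imp_deriv)
qed

lemma deriv_iter_eqI:
  fixes D :: "nat \<Rightarrow> real \<Rightarrow> real"
  assumes "f = D 0" "\<And>j x. (D j has_real_derivative D (Suc j) x) (at x)"
  shows "smooth f" "(deriv ^^ j) f = D j"
  using smooth_from_derivs[of D 0] smooth_from_derivs(2)[of D] assms by auto

lemma deriv_iter_lincomb:
  fixes f g :: "real \<Rightarrow> real"
  assumes "smooth f" "smooth g"
  shows "(deriv ^^ j) (\<lambda>x. a * f x + b * g x) = (\<lambda>x. a * (deriv ^^ j) f x + b * (deriv ^^ j) g x)"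
proof (rule deriv_iter_eqI(2))
  show "((\<lambda>x. a * (deriv ^^ j) f x + b * (deriv ^^ j) g x) has_real_derivative
      a * (deriv ^^ Suc j) f x + b * (deriv ^^ Suc j) g x) (at x)" for j x
    by (intro DERIV_add DERIV_cmult smooth_has_deriv_iter assms)
qed simp

lemma deriv_lincomb:
  fixes f g :: "real \<Rightarrow> real"
  assumes "smooth f" "smooth g"
  shows "deriv (\<lambda>x. a * f x + b * g x) = (\<lambda>x. a * deriv f x + b * deriv g x)"
  using deriv_iter_lincomb[OF assms, of 1] by simp

lemma
  fixes f :: "real \<Rightarrow> real"
  assumes "smooth f"
  shows smooth_shift: "smooth (\<lambda>x. f (x + y))"
    and deriv_iter_shift: "(deriv ^^ j) (\<lambda>x. f (x + y)) = (\<lambda>x. (deriv ^^ j) f (x + y))"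
proof -
  have D: "((\<lambda>x. (deriv ^^ j) f (x + y)) has_real_derivative (deriv ^^ Suc j) f (x + y)) (at x)" for j x
    using smooth_has_deriv_iter[OF assms, of j "x + y"] by (simp add: DERIV_shift)
  show "smooth (\<lambda>x. f (x + y))"
    by (rule deriv_iter_eqI(1)[where D = "\<lambda>j x. (deriv ^^ j) f (x + y)"]) (simp, rule D)
  show "(deriv ^^ j) (\<lambda>x. f (x + y)) = (\<lambda>x. (deriv ^^ j) f (x + y))"
    by (rule deriv_iter_eqI(2)[where D = "\<lambda>j x. (deriv ^^ j) f (x + y)"]) (simp, rule D)
qed

section \<open>The Frechet spaces of test functions supported in a fixed interval\<close>

definition test_on :: "real \<Rightarrow> (real \<Rightarrow> real) set" where
  "test_on R = {\<phi>. smooth \<phi> \<and> (\<forall>x. R < \<bar>x\<bar> \<longrightarrow> \<phi> x = 0)}"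

lemma supp_subset_iff:
  assumes "closed K"
  shows "supp f \<subseteq> K \<longleftrightarrow> (\<forall>x. x \<notin> K \<longrightarrow> f x = 0)"
proof
  show "\<forall>x. x \<notin> K \<longrightarrow> f x = 0" if "supp f \<subseteq> K"
    using that closure_subset[of "{x. f x \<noteq> 0}"] by (auto simp: supp_def)
  show "supp f \<subseteq> K" if "\<forall>x. x \<notin> K \<longrightarrow> f x = 0"
    unfolding supp_def using that by (intro closure_minimal assms) auto
qed

lemma compact_suppI:
  fixes f :: "'a::heine_borel \<Rightarrow> real"
  assumes "compact K" "\<And>x. x \<notin> K \<Longrightarrow> f x = 0"
  shows "compact (supp f)"
proof -
  have "supp f \<subseteq> K"
    using assms by (simp add: supp_subset_iff compact_imp_closed)
  then show ?thesis
    by (metis assms(1) closed_closure compact_Int_closed inf.absorb_iff2 supp_def)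
qed

lemma test_on_supp: "\<phi> \<in> test_on R \<Longrightarrow> supp \<phi> \<subseteq> {-R..R}"
  by (subst supp_subset_iff) (auto simp: test_on_def abs_le_iff not_le)

lemma test_on_test_functions: "\<phi> \<in> test_on R \<Longrightarrow> \<phi> \<in> test_functions"
  using compact_suppI[of "{-R..R}" \<phi>]
  by (force simp: test_on_def test_functions_def)

lemma test_functions_test_on:
  assumes "\<phi> \<in> test_functions"
  obtains R where "0 \<le> R" "\<phi> \<in> test_on R"
proof -
  obtain R where R: "\<And>x. x \<in> supp \<phi> \<Longrightarrow> \<bar>x\<bar> \<le> R"
    using assms compact_imp_bounded[of "supp \<phi>"] unfolding test_functions_def bounded_iff
    by auto
  have "\<phi> x = 0" if "R < \<bar>x\<bar>" for x
    using R[of x] that closure_subset[of "{x. \<phi> x \<noteq> 0}"] by (auto simp: supp_def)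
  then have "\<phi> \<in> test_on (max R 0)"
    using assms by (auto simp: test_on_def test_functions_def)
  then show ?thesis using that[of "max R 0"] by auto
qed

lemma test_functions_smooth: "\<phi> \<in> test_functions \<Longrightarrow> smooth \<phi>"
  by (simp add: test_functions_def)

lemma test_on_smooth: "\<phi> \<in> test_on R \<Longrightarrow> smooth \<phi>"
  by (simp add: test_on_def)

lemma test_on_mono: "\<phi> \<in> test_on R \<Longrightarrow> R \<le> R' \<Longrightarrow> \<phi> \<in> test_on R'"
  by (auto simp: test_on_def)

lemma test_on_lincomb:
  "\<phi> \<in> test_on R \<Longrightarrow> \<psi> \<in> test_on R \<Longrightarrow> (\<lambda>x. a * \<phi> x + b * \<psi> x) \<in> test_on R"
  by (auto simp: test_on_def smooth_lincomb)

text \<open>The complement of \<open>{-R..R}\<close> is open, so \<phi> vanishes in a neighbourhood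
  of each of its points.\<close>

lemma test_on_deriv:
  assumes "\<phi> \<in> test_on R"
  shows "deriv \<phi> \<in> test_on R"
proof -
  have "deriv \<phi> x = 0" if "R < \<bar>x\<bar>" for x
  proof -
    have "open {x::real. R < \<bar>x\<bar>}"
      by (intro open_Collect_less continuous_intros)
    then have "eventually (\<lambda>y. y \<in> {x. R < \<bar>x\<bar>}) (nhds x)"
      using that by (intro eventually_nhds_in_open) auto
    then have "eventually (\<lambda>y. \<phi> y = 0) (nhds x)"
      by eventually_elim (use assms in \<open>auto simp: test_on_def\<close>)
    then have "deriv \<phi> x = deriv (\<lambda>_. 0) x"
      by (intro deriv_cong_ev) auto
    then show ?thesis by simp
  qed
  then show ?thesis
    using assms by (auto simp: test_on_def smooth_deriv)
qed

lemma test_on_deriv_iter: "\<phi> \<in> test_on R \<Longrightarrow> (deriv ^^ j) \<phi> \<in> test_on R"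
  by (induction j) (auto simp: test_on_deriv)

lemma test_functions_lincomb:
  fixes \<phi> \<psi> :: "real \<Rightarrow> real"
  assumes "\<phi> \<in> test_functions" "\<psi> \<in> test_functions"
  shows "(\<lambda>x. a * \<phi> x + b * \<psi> x) \<in> test_functions"
proof -
  obtain R R' where "\<phi> \<in> test_on R" "\<psi> \<in> test_on R'"
    using assms test_functions_test_on by metis
  then show ?thesis
    using test_on_mono[of _ _ "max R R'"]
    by (intro test_on_test_functions[of _ "max R R'"] test_on_lincomb) auto
qed

lemma test_functions_deriv:
  "(\<phi> :: real \<Rightarrow> real) \<in> test_functions \<Longrightarrow> deriv \<phi> \<in> test_functions"
  by (metis test_functions_test_on test_on_deriv test_on_test_functions)

lemma test_on_bounded:
  assumes "\<phi> \<in> test_on R"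
  shows "\<exists>M. \<forall>x. \<bar>\<phi> x\<bar> \<le> M"
proof -
  have "compact (\<phi> ` {-R..R})"
    using assms by (intro compact_continuous_image smooth_continuous_on) (auto simp: test_on_def)
  then obtain M where M: "\<And>y. y \<in> \<phi> ` {-R..R} \<Longrightarrow> \<bar>y\<bar> \<le> M"
    by (metis bounded_iff compact_imp_bounded real_norm_def)
  have "\<bar>\<phi> x\<bar> \<le> max M 0" for x
    using M[of "\<phi> x"] assms by (cases "\<bar>x\<bar> \<le> R") (auto simp: test_on_def abs_le_iff)
  then show ?thesis by blast
qed

definition sup_deriv :: "nat \<Rightarrow> (real \<Rightarrow> real) \<Rightarrow> real" where
  "sup_deriv j \<phi> = (SUP x. \<bar>(deriv ^^ j) \<phi> x\<bar>)"

lemma deriv_iter_le_sup_deriv: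
  assumes "\<phi> \<in> test_functions"
  shows "\<bar>(deriv ^^ j) \<phi> x\<bar> \<le> sup_deriv j \<phi>"
proof -
  obtain M where "\<And>x. \<bar>(deriv ^^ j) \<phi> x\<bar> \<le> M"
    by (metis assms test_functions_test_on test_on_bounded test_on_deriv_iter)
  then show ?thesis
    unfolding sup_deriv_def by (intro cSUP_upper) (auto simp: bdd_above_def)
qed

lemma sup_deriv_le: "(\<And>x. \<bar>(deriv ^^ j) \<phi> x\<bar> \<le> M) \<Longrightarrow> sup_deriv j \<phi> \<le> M"
  unfolding sup_deriv_def by (intro cSUP_least) auto

lemma sup_deriv_nonneg: "\<phi> \<in> test_functions \<Longrightarrow> 0 \<le> sup_deriv j \<phi>"
  using deriv_iter_le_sup_deriv[of \<phi> j 0] by linarith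

definition seminorm :: "nat \<Rightarrow> (real \<Rightarrow> real) \<Rightarrow> real" where
  "seminorm N \<phi> = (\<Sum>j\<le>N. sup_deriv j \<phi>)"

lemma seminorm_nonneg: "\<phi> \<in> test_functions \<Longrightarrow> 0 \<le> seminorm N \<phi>"
  unfolding seminorm_def by (intro sum_nonneg sup_deriv_nonneg)

lemma seminorm_mono: "\<phi> \<in> test_functions \<Longrightarrow> N \<le> M \<Longrightarrow> seminorm N \<phi> \<le> seminorm M \<phi>"
  unfolding seminorm_def by (intro sum_mono2 sup_deriv_nonneg) auto

lemma sup_deriv_le_seminorm: "\<phi> \<in> test_functions \<Longrightarrow> j \<le> N \<Longrightarrow> sup_deriv j \<phi> \<le> seminorm N \<phi>"
  unfolding seminorm_def by (rule member_le_sum) (auto simp: sup_deriv_nonneg)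

lemma sup_deriv_lincomb:
  assumes "\<phi> \<in> test_functions" "\<psi> \<in> test_functions"
  shows "sup_deriv j (\<lambda>x. a * \<phi> x + b * \<psi> x) \<le> \<bar>a\<bar> * sup_deriv j \<phi> + \<bar>b\<bar> * sup_deriv j \<psi>"
proof (rule sup_deriv_le)
  fix x
  have "\<bar>a * (deriv ^^ j) \<phi> x + b * (deriv ^^ j) \<psi> x\<bar> \<le> \<bar>a\<bar> * \<bar>(deriv ^^ j) \<phi> x\<bar> + \<bar>b\<bar> * \<bar>(deriv ^^ j) \<psi> x\<bar>"
    by (metis abs_mult abs_triangle_ineq)
  also have "\<dots> \<le> \<bar>a\<bar> * sup_deriv j \<phi> + \<bar>b\<bar> * sup_deriv j \<psi>"
    by (intro add_mono mult_left_mono deriv_iter_le_sup_deriv assms) auto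
  finally show "\<bar>(deriv ^^ j) (\<lambda>x. a * \<phi> x + b * \<psi> x) x\<bar> \<le> \<bar>a\<bar> * sup_deriv j \<phi> + \<bar>b\<bar> * sup_deriv j \<psi>"
    using assms by (simp add: deriv_iter_lincomb test_functions_smooth)
qed

lemma seminorm_lincomb:
  assumes "\<phi> \<in> test_functions" "\<psi> \<in> test_functions"
  shows "seminorm N (\<lambda>x. a * \<phi> x + b * \<psi> x) \<le> \<bar>a\<bar> * seminorm N \<phi> + \<bar>b\<bar> * seminorm N \<psi>"
  using sum_mono[OF sup_deriv_lincomb[OF assms]]
  by (simp add: seminorm_def sum.distrib sum_distrib_left)

lemma distributions_bound:
  assumes "\<Lambda> \<in> distributions"
  obtains C N where "0 \<le> C" "\<And>\<phi>. \<phi> \<in> test_on R \<Longrightarrow> \<bar>\<Lambda> \<phi>\<bar> \<le> C * seminorm N \<phi>"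
proof -
  have "\<exists>C N. \<forall>\<phi>\<in>test_functions. supp \<phi> \<subseteq> {-R..R} \<longrightarrow> \<bar>\<Lambda> \<phi>\<bar> \<le> C * seminorm N \<phi>"
    using assms by (simp add: distributions_def seminorm_def sup_deriv_def)
  then obtain C N where C: "\<And>\<phi>. \<phi> \<in> test_functions \<Longrightarrow> supp \<phi> \<subseteq> {-R..R} \<Longrightarrow> \<bar>\<Lambda> \<phi>\<bar> \<le> C * seminorm N \<phi>"
    by blast
  have "\<bar>\<Lambda> \<phi>\<bar> \<le> \<bar>C\<bar> * seminorm N \<phi>" if "\<phi> \<in> test_on R" for \<phi>
  proof -
    have "\<bar>\<Lambda> \<phi>\<bar> \<le> C * seminorm N \<phi>"
      using C that test_on_test_functions test_on_supp by blast
    also have "\<dots> \<le> \<bar>C\<bar> * seminorm N \<phi>"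
      by (intro mult_right_mono seminorm_nonneg) (auto intro: that test_on_test_functions)
    finally show ?thesis .
  qed
  then show ?thesis using that[of "\<bar>C\<bar>"] by auto
qed

lemma distributions_lincomb:
  assumes "\<Lambda> \<in> distributions" "\<phi> \<in> test_functions" "\<psi> \<in> test_functions"
  shows "\<Lambda> (\<lambda>x. a * \<phi> x + b * \<psi> x) = a * \<Lambda> \<phi> + b * \<Lambda> \<psi>"
  using assms by (auto simp: distributions_def)

text \<open>One estimate valid for all test functions serves every compact set at once. The
  functionals built below have this stronger property, with N = 2.\<close>

lemma distributionsI:
  assumes "\<Lambda> \<in> extensional test_functions"
    and "\<And>\<phi> \<psi> a b. \<phi> \<in> test_functions \<Longrightarrow> \<psi> \<in> test_functions \<Longrightarrow>
      \<Lambda> (\<lambda>x. a * \<phi> x + b * \<psi> x) = a * \<Lambda> \<phi> + b * \<Lambda> \<psi>"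
    and "\<And>\<phi>. \<phi> \<in> test_functions \<Longrightarrow> \<bar>\<Lambda> \<phi>\<bar> \<le> C * seminorm N \<phi>"
  shows "\<Lambda> \<in> distributions"
  using assms unfolding distributions_def seminorm_def sup_deriv_def by blast

section \<open>Uniform boundedness and the product rule for pairings\<close>

lemma test_on_diff: "\<phi> \<in> test_on R \<Longrightarrow> \<psi> \<in> test_on R \<Longrightarrow> (\<lambda>x. \<phi> x - \<psi> x) \<in> test_on R"
  using test_on_lincomb[of \<phi> R \<psi> 1 "-1"] by simp

lemma seminorm_diff_triangle:
  assumes "f \<in> test_on R" "g \<in> test_on R" "h \<in> test_on R"
  shows "seminorm N (\<lambda>x. f x - h x) \<le> seminorm N (\<lambda>x. f x - g x) + seminorm N (\<lambda>x. g x - h x)"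
  using seminorm_lincomb[of "\<lambda>x. f x - g x" "\<lambda>x. g x - h x" N 1 1] assms
  by (simp add: test_on_test_functions[OF test_on_diff])

lemma deriv_iter_diff:
  assumes "f \<in> test_on R" "g \<in> test_on R"
  shows "(deriv ^^ j) (\<lambda>x. f x - g x) = (\<lambda>x. (deriv ^^ j) f x - (deriv ^^ j) g x)"
  using deriv_iter_lincomb[of f g j 1 "-1"] assms by (simp add: test_on_smooth)

text \<open>All derivatives converge uniformly, so their limits again form a ladder. The rate for
  the j-th derivative is only demanded from n = j on, because the n-th ball of the nested sequence
  used below controls just finitely many derivatives, at least n of them.\<close>

lemma test_on_complete:
  assumes g: "\<And>n. g n \<in> test_on R"
    and cauchy: "\<And>j m n. j \<le> n \<Longrightarrow> n \<le> m \<Longrightarrow> sup_deriv j (\<lambda>x. g m x - g n x) \<le> (1/2) ^ n"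
  obtains \<phi> where "\<phi> \<in> test_on R"
    "\<And>N m. N \<le> m \<Longrightarrow> seminorm N (\<lambda>x. \<phi> x - g m x) \<le> real (Suc N) * (1/2) ^ m"
proof -
  have close: "\<bar>(deriv ^^ j) (g m) x - (deriv ^^ j) (g n) x\<bar> \<le> (1/2) ^ n" if "j \<le> n" "n \<le> m" for j m n x
  proof -
    have "\<bar>(deriv ^^ j) (\<lambda>x. g m x - g n x) x\<bar> \<le> sup_deriv j (\<lambda>x. g m x - g n x)"
      by (intro deriv_iter_le_sup_deriv test_on_test_functions[OF test_on_diff[OF g g]])
    then show ?thesis
      using cauchy[OF that] by (simp add: deriv_iter_diff[OF g g])
  qed
  have half: "(\<lambda>n. (1/2::real) ^ n) \<longlonglongrightarrow> 0"
    by (rule LIMSEQ_realpow_zero) auto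
  have "Cauchy (\<lambda>n. (deriv ^^ j) (g n) x)" for j x
  proof (rule CauchyI')
    fix e :: real assume "0 < e"
    then obtain N where N: "(1/2::real) ^ N < e"
      using real_arch_pow_inv by fastforce
    show "\<exists>M. \<forall>m\<ge>M. \<forall>n>m. dist ((deriv ^^ j) (g m) x) ((deriv ^^ j) (g n) x) < e"
    proof (intro exI allI impI)
      fix m n assume "max N j \<le> m" "m < n"
      moreover have "(1/2::real) ^ m \<le> (1/2) ^ N"
        using \<open>max N j \<le> m\<close> by (intro power_decreasing) auto
      then have "(1/2::real) ^ m < e" using N by linarith
      ultimately show "dist ((deriv ^^ j) (g m) x) ((deriv ^^ j) (g n) x) < e"
        using close[of j m n x] by (force simp: dist_real_def abs_minus_commute)
    qed
  qed
  then obtain G where G: "\<And>j x. (\<lambda>n. (deriv ^^ j) (g n) x) \<longlonglongrightarrow> G j x"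
    unfolding Cauchy_convergent_iff convergent_def by metis
  have rate: "\<bar>(deriv ^^ j) (g n) x - G j x\<bar> \<le> (1/2) ^ n" if "j \<le> n" for j n x
  proof -
    have "(\<lambda>m. \<bar>(deriv ^^ j) (g m) x - (deriv ^^ j) (g n) x\<bar>) \<longlonglongrightarrow> \<bar>G j x - (deriv ^^ j) (g n) x\<bar>"
      by (intro tendsto_intros G)
    moreover have "eventually (\<lambda>m. \<bar>(deriv ^^ j) (g m) x - (deriv ^^ j) (g n) x\<bar> \<le> (1/2) ^ n) sequentially"
      using close[OF that] unfolding eventually_sequentially by blast
    ultimately have "\<bar>G j x - (deriv ^^ j) (g n) x\<bar> \<le> (1/2) ^ n"
      by (intro tendsto_upperbound) auto
    then show ?thesis by (simp add: abs_minus_commute)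
  qed
  have DG: "(G j has_real_derivative G (Suc j) x) (at x)" for j x
  proof -
    \<comment> \<open>Derivatives that converge uniformly may be exchanged with the limit; the
      function obtained is \<open>G j\<close> by uniqueness of pointwise limits.\<close>
    have "\<exists>h. \<forall>x\<in>UNIV. (\<lambda>n. (deriv ^^ j) (g n) x) \<longlonglongrightarrow> h x \<and>
        (h has_derivative (\<lambda>y. G (Suc j) x * y)) (at x within UNIV)"
    proof (rule has_derivative_sequence)
      show "((deriv ^^ j) (g n) has_derivative (\<lambda>y. (deriv ^^ Suc j) (g n) x * y)) (at x within UNIV)" for n x
        using smooth_has_deriv_iter[OF test_on_smooth[OF g], of j n x] by (simp add: has_field_derivative_def)
      fix e :: real assume "e > 0"
      then obtain N where N: "(1/2::real) ^ N < e"
        using real_arch_pow_inv by fastforce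
      have "norm ((deriv ^^ Suc j) (g n) x * h - G (Suc j) x * h) \<le> e * norm h"
        if "max N (Suc j) \<le> n" for n x h
      proof -
        have "(1/2::real) ^ n \<le> (1/2) ^ N"
          using that by (intro power_decreasing) auto
        moreover have "\<bar>(deriv ^^ Suc j) (g n) x - G (Suc j) x\<bar> \<le> (1/2) ^ n"
          using that by (intro rate) simp
        ultimately have "\<bar>(deriv ^^ Suc j) (g n) x - G (Suc j) x\<bar> \<le> e"
          using N by linarith
        then have "\<bar>(deriv ^^ Suc j) (g n) x - G (Suc j) x\<bar> * \<bar>h\<bar> \<le> e * \<bar>h\<bar>"
          by (intro mult_right_mono) auto
        then show ?thesis
          by (simp add: left_diff_distrib[symmetric] abs_mult del: funpow.simps)
      qed
      then show "\<forall>\<^sub>F n in sequentially. \<forall>x\<in>UNIV. \<forall>h.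
          norm ((deriv ^^ Suc j) (g n) x * h - G (Suc j) x * h) \<le> e * norm h"
        unfolding eventually_sequentially by blast
    qed (use G in auto)
    then obtain h where h: "\<And>x. (\<lambda>n. (deriv ^^ j) (g n) x) \<longlonglongrightarrow> h x"
        "\<And>x. (h has_derivative (\<lambda>y. G (Suc j) x * y)) (at x)"
      by auto
    have "h = G j"
      using LIMSEQ_unique[OF h(1) G] by auto
    then show ?thesis
      using h(2)[of x] by (simp add: has_field_derivative_def)
  qed
  have "G 0 x = 0" if "R < \<bar>x\<bar>" for x
  proof -
    have "(\<lambda>n. (deriv ^^ 0) (g n) x) = (\<lambda>n. 0)"
      using g that by (auto simp: test_on_def)
    then show ?thesis
      using G[of 0 x] by (simp add: LIMSEQ_const_iff)
  qed
  then have G0: "G 0 \<in> test_on R"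
    using smooth_from_derivs(1)[of G 0] DG by (auto simp: test_on_def)
  have "seminorm N (\<lambda>x. G 0 x - g m x) \<le> real (Suc N) * (1/2) ^ m" if "N \<le> m" for N m
  proof -
    have "sup_deriv j (\<lambda>x. G 0 x - g m x) \<le> (1/2) ^ m" if "j \<le> N" for j
      using rate[of j m] that \<open>N \<le> m\<close> smooth_from_derivs(2)[of G j] DG
      by (intro sup_deriv_le) (auto simp: deriv_iter_diff[OF G0 g] abs_minus_commute)
    then have "seminorm N (\<lambda>x. G 0 x - g m x) \<le> (\<Sum>j\<le>N. (1/2) ^ m)"
      unfolding seminorm_def by (intro sum_mono) auto
    then show ?thesis by simp
  qed
  with G0 show ?thesis using that by blast
qed

lemma distributions_diff:
  assumes "\<Lambda> \<in> distributions" "\<phi> \<in> test_on R" "\<psi> \<in> test_on R"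
  shows "\<Lambda> (\<lambda>x. \<phi> x - \<psi> x) = \<Lambda> \<phi> - \<Lambda> \<psi>"
  using distributions_lincomb[of \<Lambda> \<phi> \<psi> 1 "-1"] assms by (simp add: test_on_test_functions)

text \<open>A Banach--Steinhaus theorem for the Frechet space of test functions supported in
  \<open>{-R..R}\<close>. If it failed, nested seminorm balls could be chosen so that the family
  exceeds \<open>n\<close> throughout the \<open>n\<close>-th one, against boundedness at their common point.\<close>

lemma distributions_uniform_bound:
  assumes dist: "\<And>t. t \<in> I \<Longrightarrow> v t \<in> distributions"
    and bdd: "\<And>\<phi>. \<phi> \<in> test_on R \<Longrightarrow> \<exists>B. \<forall>t\<in>I. \<bar>v t \<phi>\<bar> \<le> B"
  obtains C N where "0 \<le> C" "\<And>t \<phi>. t \<in> I \<Longrightarrow> \<phi> \<in> test_on R \<Longrightarrow> \<bar>v t \<phi>\<bar> \<le> C * seminorm N \<phi>"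
proof -
  \<comment> \<open>Closed balls, given by centre, number of derivatives and radius: the limit of
    the centres must still belong to each of them.\<close>
  define ball where "ball = (\<lambda>(g, M, r). {\<phi> \<in> test_on R. seminorm M (\<lambda>x. \<phi> x - g x) \<le> r})"
  have "\<exists>g\<in>test_on R. \<exists>M r B. 0 < r \<and> (\<forall>\<phi>\<in>ball (g, M, r). \<forall>t\<in>I. \<bar>v t \<phi>\<bar> \<le> B)"
  proof (rule ccontr)
    assume neg: "\<not> ?thesis"
    \<comment> \<open>The two inequalities with n make the centres a Cauchy sequence in every
      seminorm, at the rate asked for by \<open>test_on_complete\<close>.\<close>
    define P :: "nat \<Rightarrow> (real \<Rightarrow> real) \<times> nat \<times> real \<Rightarrow> bool" where "P n = (\<lambda>(g, M, r). g \<in> test_on R \<and> 0 < r \<and> r \<le> (1/2) ^ n \<and> n \<le> M)" for n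
    define Q where "Q n b b' \<longleftrightarrow> ball b' \<subseteq> ball b \<and> (\<exists>t\<in>I. \<forall>\<phi>\<in>ball b'. real n < \<bar>v t \<phi>\<bar>)" for n :: nat and b b'
    have "\<exists>b. \<forall>n. P n (b n) \<and> Q n (b n) (b (Suc n))"
    proof (rule dependent_nat_choice)
      have "(\<lambda>_. 0) \<in> test_on R"
        using smooth_from_derivs(1)[of "\<lambda>_ _. 0"] by (auto simp: test_on_def)
      then show "\<exists>b. P 0 b"
        by (intro exI[of _ "(\<lambda>_. 0, 0, 1)"]) (auto simp: P_def)
    next
      fix b n assume "P n b"
      then obtain g M r where b: "b = (g, M, r)" and g: "g \<in> test_on R" "0 < r"
        by (cases b) (auto simp: P_def)
      then have "\<exists>\<phi>\<in>ball (g, M, r / 2). \<exists>t\<in>I. \<not> \<bar>v t \<phi>\<bar> \<le> real n + 1"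
        using neg by (metis half_gt_zero)
      then obtain \<phi>0 t where \<phi>0: "\<phi>0 \<in> test_on R" "seminorm M (\<lambda>x. \<phi>0 x - g x) \<le> r / 2"
        and t: "t \<in> I" "real n + 1 < \<bar>v t \<phi>0\<bar>"
        by (auto simp: ball_def)
      obtain C N where C: "0 \<le> C" "\<And>\<phi>. \<phi> \<in> test_on R \<Longrightarrow> \<bar>v t \<phi>\<bar> \<le> C * seminorm N \<phi>"
        using distributions_bound[OF dist[OF t(1)]] by metis
      \<comment> \<open>Dominating \<open>M\<close> keeps the new ball inside the old one,
        dominating \<open>N\<close> controls the functional \<open>v t\<close>, and
        \<open>Suc n\<close> makes the number of controlled derivatives grow.\<close>
      define M' where "M' = max M (max N (Suc n))"
      \<comment> \<open>Radius \<open>r / 2\<close> suffices for nesting since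
        \<open>\<phi>0\<close> is within \<open>r / 2\<close> of \<open>g\<close>. Radius
        \<open>1 / (C + 1)\<close> keeps the oscillation of \<open>v t\<close> below 1, so a value
        above n + 1 at the centre stays above n on the ball.\<close>
      define r' where "r' = min (r / 2) (min ((1/2) ^ Suc n) (1 / (C + 1)))"
      have r': "0 < r'" "r' \<le> r / 2" "r' \<le> (1/2) ^ Suc n" "r' \<le> 1 / (C + 1)"
        using \<open>0 < r\<close> C by (auto simp: r'_def simp del: power_Suc)
      have "\<phi> \<in> ball b \<and> real n < \<bar>v t \<phi>\<bar>" if "\<phi> \<in> ball (\<phi>0, M', r')" for \<phi>
      proof -
        have \<phi>: "\<phi> \<in> test_on R" "seminorm M' (\<lambda>x. \<phi> x - \<phi>0 x) \<le> r'"
          using that by (auto simp: ball_def)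
        have d: "(\<lambda>x. \<phi> x - \<phi>0 x) \<in> test_on R"
          by (intro test_on_diff \<phi> \<phi>0)
        have le: "seminorm L (\<lambda>x. \<phi> x - \<phi>0 x) \<le> r'" if "L \<le> M'" for L
          using seminorm_mono[OF test_on_test_functions[OF d] that] \<phi> by linarith
        have "seminorm M (\<lambda>x. \<phi> x - g x) \<le> r"
          using seminorm_diff_triangle[OF \<phi>(1) \<phi>0(1) g(1), of M] le[of M] \<phi>0(2) r'(2)
          by (simp add: M'_def)
        moreover have "\<bar>v t \<phi> - v t \<phi>0\<bar> \<le> 1"
        proof -
          have "\<bar>v t \<phi> - v t \<phi>0\<bar> \<le> C * seminorm N (\<lambda>x. \<phi> x - \<phi>0 x)"
            using C(2)[OF d] distributions_diff[OF dist[OF t(1)] \<phi>(1) \<phi>0(1)] by simp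
          also have "\<dots> \<le> C * (1 / (C + 1))"
            using order_trans[OF le[of N] r'(4)] C(1) by (intro mult_left_mono) (auto simp: M'_def)
          also have "\<dots> \<le> 1"
            using C(1) by simp
          finally show ?thesis .
        qed
        ultimately show ?thesis
          using \<phi>(1) t(2) by (auto simp: ball_def b)
      qed
      then show "\<exists>b'. P (Suc n) b' \<and> Q n b b'"
        using r' t(1) \<phi>0(1) by (intro exI[of _ "(\<phi>0, M', r')"]) (auto simp: P_def Q_def M'_def)
    qed
    then obtain b where b: "\<And>n. P n (b n)" "\<And>n. Q n (b n) (b (Suc n))" by blast
    define g M r where "g n = fst (b n)" and "M n = fst (snd (b n))" and "r n = snd (snd (b n))" for n
    have bn: "b n = (g n, M n, r n)" for n
      by (simp add: g_def M_def r_def)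
    have P: "g n \<in> test_on R" "0 < r n" "r n \<le> (1/2) ^ n" "n \<le> M n" for n
      using b(1)[of n] by (auto simp: P_def bn)
    have mono: "ball (b m) \<subseteq> ball (b n)" if "n \<le> m" for m n
      using that by (induction rule: dec_induct) (use b(2) in \<open>auto simp: Q_def\<close>)
    have center: "g n \<in> ball (b n)" for n
      \<comment> \<open>Both coefficients are 0: the seminorm of the zero function is at most
        0.\<close>
      using P[of n] seminorm_lincomb[of "g n" "g n" "M n" 0 0] test_on_test_functions[OF P(1)[of n]]
      by (auto simp: ball_def bn)
    have gm: "seminorm (M n) (\<lambda>x. g m x - g n x) \<le> r n" if "n \<le> m" for m n
      using mono[OF that] center[of m] by (auto simp: ball_def bn)
    obtain \<phi> where \<phi>: "\<phi> \<in> test_on R"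
      "\<And>N m. N \<le> m \<Longrightarrow> seminorm N (\<lambda>x. \<phi> x - g m x) \<le> real (Suc N) * (1/2) ^ m"
    proof (rule test_on_complete[of g R])
      fix j m n :: nat assume "j \<le> n" "n \<le> m"
      then have "sup_deriv j (\<lambda>x. g m x - g n x) \<le> seminorm (M n) (\<lambda>x. g m x - g n x)"
        using P(4)[of n] by (intro sup_deriv_le_seminorm test_on_test_functions[OF test_on_diff[OF P(1) P(1)]]) auto
      also have "\<dots> \<le> (1/2) ^ n"
        using gm[OF \<open>n \<le> m\<close>] P(3)[of n] by linarith
      finally show "sup_deriv j (\<lambda>x. g m x - g n x) \<le> (1/2) ^ n" .
    qed (use P in auto)
    \<comment> \<open>The centres \<open>g m\<close> with m at least n lie in the closed n-th ball;
      let m tend to infinity.\<close>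
    have in_ball: "\<phi> \<in> ball (b n)" for n
    proof -
      have "seminorm (M n) (\<lambda>x. \<phi> x - g n x) \<le> real (Suc (M n)) * (1/2) ^ m + r n"
        if "max (M n) n \<le> m" for m
        using seminorm_diff_triangle[OF \<phi>(1) P(1)[of m] P(1)[of n], of "M n"] \<phi>(2)[of "M n" m] gm[of n m] that
        by auto
      then have "eventually (\<lambda>m. seminorm (M n) (\<lambda>x. \<phi> x - g n x) \<le> real (Suc (M n)) * (1/2) ^ m + r n) sequentially"
        unfolding eventually_sequentially by blast
      moreover have "(\<lambda>m. real (Suc (M n)) * (1/2) ^ m + r n) \<longlonglongrightarrow> real (Suc (M n)) * 0 + r n"
        by (intro tendsto_intros LIMSEQ_realpow_zero) auto
      ultimately have "seminorm (M n) (\<lambda>x. \<phi> x - g n x) \<le> r n"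
        using tendsto_lowerbound by fastforce
      then show ?thesis
        using \<phi>(1) by (auto simp: ball_def bn)
    qed
    obtain B where B: "\<And>t. t \<in> I \<Longrightarrow> \<bar>v t \<phi>\<bar> \<le> B"
      using bdd[OF \<phi>(1)] by blast
    obtain n where n: "B < real n"
      using reals_Archimedean2 by blast
    show False
      using b(2)[of n] in_ball[of "Suc n"] B n unfolding Q_def by fastforce
  qed
  then obtain g M r B where g: "g \<in> test_on R" "0 < r"
    and B: "\<And>\<phi> t. \<phi> \<in> ball (g, M, r) \<Longrightarrow> t \<in> I \<Longrightarrow> \<bar>v t \<phi>\<bar> \<le> B"
    by blast
  have "\<bar>v t \<phi>\<bar> \<le> (2 * \<bar>B\<bar> / r) * seminorm M \<phi>" if t: "t \<in> I" and \<phi>: "\<phi> \<in> test_on R" for t \<phi>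
  proof -
    have test: "g \<in> test_functions" "\<phi> \<in> test_functions"
      using g \<phi> test_on_test_functions by auto
    have "g \<in> ball (g, M, r)"
      using g seminorm_lincomb[of g g M 0 0] test by (auto simp: ball_def)
    then have vg: "\<bar>v t g\<bar> \<le> B" using B t by blast
    \<comment> \<open>Scaling \<phi> into the ball around \<open>g\<close> and subtracting the value
      at \<open>g\<close> costs the factor 2. A number s strictly above the seminorm is used because
      the seminorm may be 0; afterwards s descends to it.\<close>
    have le: "\<bar>v t \<phi>\<bar> \<le> (2 * \<bar>B\<bar> / r) * s" if s: "seminorm M \<phi> < s" for s
    proof -
      have "0 < s" using seminorm_nonneg[OF test(2), of M] s by linarith
      have "seminorm M (\<lambda>x. r / s * \<phi> x) \<le> r / s * seminorm M \<phi>"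
        using seminorm_lincomb[OF test(2) test(2), of M "r / s" 0] g \<open>0 < s\<close> by simp
      also have "\<dots> \<le> r / s * s"
        using s g \<open>0 < s\<close> by (intro mult_left_mono) auto
      finally have "(\<lambda>x. 1 * g x + r / s * \<phi> x) \<in> ball (g, M, r)"
        using test_on_lincomb[OF g(1) \<phi>, of 1 "r / s"] \<open>0 < s\<close> by (simp add: ball_def)
      then have "\<bar>v t (\<lambda>x. 1 * g x + r / s * \<phi> x)\<bar> \<le> B" using B t by blast
      then have "\<bar>v t g + r / s * v t \<phi>\<bar> \<le> B"
        using distributions_lincomb[OF dist[OF t] test, of 1 "r / s"] by simp
      then have "\<bar>r / s * v t \<phi>\<bar> \<le> 2 * \<bar>B\<bar>" using vg by linarith
      then show ?thesis
        using g \<open>0 < s\<close> by (simp add: abs_mult field_simps)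
    qed
    show ?thesis
    proof (cases "B = 0")
      case True
      then show ?thesis using le[of "seminorm M \<phi> + 1"] by simp
    next
      case False
      then have "0 < 2 * \<bar>B\<bar> / r" using g by simp
      then have "\<bar>v t \<phi>\<bar> / (2 * \<bar>B\<bar> / r) \<le> s" if "seminorm M \<phi> < s" for s
        using le[OF that] by (subst pos_divide_le_eq) (auto simp: mult.commute)
      then have "\<bar>v t \<phi>\<bar> / (2 * \<bar>B\<bar> / r) \<le> seminorm M \<phi>"
        by (rule dense_ge)
      then show ?thesis
        using \<open>0 < 2 * \<bar>B\<bar> / r\<close> by (subst (asm) pos_divide_le_eq) (auto simp: mult.commute)
    qed
  qed
  then show ?thesis
    using that[of "2 * \<bar>B\<bar> / r" M] g by simp
qed

text \<open>Differentiability at s of a curve in the Frechet space \<open>test_on R\<close>, in a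
  quantitative form: the remainder is quadratic in each derivative, uniformly in x. This is what a
  second-order Taylor estimate in time delivers.\<close>

definition test_derivative :: "real \<Rightarrow> (real \<Rightarrow> real \<Rightarrow> real) \<Rightarrow> (real \<Rightarrow> real) \<Rightarrow> real \<Rightarrow> bool" where
  "test_derivative R \<Phi> \<Phi>' s \<longleftrightarrow> \<Phi>' \<in> test_on R \<and> (\<forall>h. \<bar>h\<bar> \<le> 1 \<longrightarrow> \<Phi> (s + h) \<in> test_on R) \<and>
    (\<forall>j. \<exists>C. \<forall>h x. \<bar>h\<bar> \<le> 1 \<longrightarrow>
      \<bar>(deriv ^^ j) (\<Phi> (s + h)) x - (deriv ^^ j) (\<Phi> s) x - h * (deriv ^^ j) \<Phi>' x\<bar> \<le> C * h\<^sup>2)"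

text \<open>Write \<open>\<Phi> (s + h)\<close> as \<open>\<Phi> s\<close> plus h times
  \<open>\<Phi>'\<close> plus a remainder of size \<open>h\<^sup>2\<close> in every seminorm. The
  remainder is tested against \<open>v (s + h)\<close>, which moves with h, so a bound uniform in
  the time is indispensable; the other two terms involve fixed test functions only.\<close>

lemma distribution_product_rule:
  assumes dist: "\<And>s. v s \<in> distributions"
    and deriv: "\<And>\<phi> s. \<phi> \<in> test_functions \<Longrightarrow> ((\<lambda>s. v s \<phi>) has_real_derivative v' s \<phi>) (at s)"
    and \<Phi>: "test_derivative R \<Phi> \<Phi>' s"
  shows "((\<lambda>s. v s (\<Phi> s)) has_real_derivative v' s (\<Phi> s) + v s \<Phi>') (at s)"
proof -
  have cont: "continuous_on A (\<lambda>s. v s \<phi>)" if "\<phi> \<in> test_functions" for \<phi> A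
    using deriv[OF that] by (meson DERIV_isCont continuous_at_imp_continuous_on)
  \<comment> \<open>The interval matches the range of h in \<open>test_derivative\<close>. For a
    fixed test function the values are bounded there by continuity, which is all that uniform
    boundedness asks.\<close>
  obtain K N where K: "0 \<le> K" "\<And>r \<phi>. r \<in> {s-1..s+1} \<Longrightarrow> \<phi> \<in> test_on R \<Longrightarrow> \<bar>v r \<phi>\<bar> \<le> K * seminorm N \<phi>"
  proof (rule distributions_uniform_bound[of "{s-1..s+1}" v R])
    fix \<phi> assume "\<phi> \<in> test_on R"
    then have "compact ((\<lambda>r. v r \<phi>) ` {s-1..s+1})"
      by (intro compact_continuous_image cont test_on_test_functions) auto
    then show "\<exists>B. \<forall>t\<in>{s-1..s+1}. \<bar>v t \<phi>\<bar> \<le> B"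
      by (auto dest!: compact_imp_bounded simp: bounded_iff)
  qed (use dist in auto)
  have \<Phi>': "\<Phi>' \<in> test_on R" and \<Phi>h: "\<And>h. \<bar>h\<bar> \<le> 1 \<Longrightarrow> \<Phi> (s + h) \<in> test_on R"
    using \<Phi> by (auto simp: test_derivative_def)
  have \<Phi>s: "\<Phi> s \<in> test_on R" using \<Phi>h[of 0] by simp
  obtain C where C: "\<And>j h x. \<bar>h\<bar> \<le> 1 \<Longrightarrow>
      \<bar>(deriv ^^ j) (\<Phi> (s + h)) x - (deriv ^^ j) (\<Phi> s) x - h * (deriv ^^ j) \<Phi>' x\<bar> \<le> C j * h\<^sup>2"
    using \<Phi> unfolding test_derivative_def by metis
  define rem where "rem h = (\<lambda>x. (\<Phi> (s + h) x - \<Phi> s x) - h * \<Phi>' x)" for h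
  have rem: "rem h \<in> test_on R" if "\<bar>h\<bar> \<le> 1" for h
    using test_on_lincomb[OF test_on_diff[OF \<Phi>h[OF that] \<Phi>s] \<Phi>', of 1 "-h"] by (simp add: rem_def)
  have "seminorm N (rem h) \<le> (\<Sum>j\<le>N. C j) * h\<^sup>2" if "\<bar>h\<bar> \<le> 1" for h
    unfolding seminorm_def sum_distrib_right
  proof (intro sum_mono sup_deriv_le)
    fix j x
    have "(deriv ^^ j) (rem h) x = (deriv ^^ j) (\<Phi> (s + h)) x - (deriv ^^ j) (\<Phi> s) x - h * (deriv ^^ j) \<Phi>' x"
      using deriv_iter_lincomb[of "\<lambda>x. \<Phi> (s + h) x - \<Phi> s x" \<Phi>' j 1 "-h"]
        test_on_diff[OF \<Phi>h[OF that] \<Phi>s] \<Phi>'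
      by (simp add: rem_def test_on_smooth deriv_iter_diff[OF \<Phi>h[OF that] \<Phi>s])
    then show "\<bar>(deriv ^^ j) (rem h) x\<bar> \<le> C j * h\<^sup>2" using C[OF that] by simp
  qed
  then have vrem: "\<bar>v (s + h) (rem h)\<bar> \<le> K * ((\<Sum>j\<le>N. C j) * h\<^sup>2)" if "\<bar>h\<bar> \<le> 1" for h
    using K(2)[of "s + h", OF _ rem[OF that]] that mult_left_mono[OF _ K(1)] by fastforce
  have split: "(v (s + h) (\<Phi> (s + h)) - v s (\<Phi> s)) / h =
      v (s + h) (rem h) / h + v (s + h) \<Phi>' + (v (s + h) (\<Phi> s) - v s (\<Phi> s)) / h"
    if "\<bar>h\<bar> \<le> 1" "h \<noteq> 0" for h
  proof -
    have "v (s + h) (\<Phi> (s + h)) = v (s + h) (rem h) + h * v (s + h) \<Phi>' + v (s + h) (\<Phi> s)"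
      using distributions_lincomb[OF dist, of "\<lambda>x. \<Phi> (s + h) x - \<Phi> s x" \<Phi>' "s + h" 1 "-h"]
        test_on_diff[OF \<Phi>h[OF that(1)] \<Phi>s] \<Phi>'
      by (simp add: rem_def test_on_test_functions distributions_diff[OF dist \<Phi>h[OF that(1)] \<Phi>s])
    then show ?thesis using that by (simp add: add_divide_distrib diff_divide_distrib)
  qed
  have "((\<lambda>h. v (s + h) (rem h) / h) \<longlongrightarrow> 0) (at 0)"
  proof (rule Lim_null_comparison)
    show "eventually (\<lambda>h. norm (v (s + h) (rem h) / h) \<le> K * (\<Sum>j\<le>N. C j) * \<bar>h\<bar>) (at 0)"
      unfolding eventually_at
    proof (intro exI conjI ballI impI)
      fix h :: real assume "h \<noteq> 0 \<and> dist h 0 < 1"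
      then show "norm (v (s + h) (rem h) / h) \<le> K * (\<Sum>j\<le>N. C j) * \<bar>h\<bar>"
        using vrem[of h] by (simp add: pos_divide_le_eq power2_eq_square mult.assoc)
    qed auto
    show "((\<lambda>h. K * (\<Sum>j\<le>N. C j) * \<bar>h\<bar>) \<longlongrightarrow> 0) (at (0::real))"
      by (rule tendsto_eq_intros refl | simp)+
  qed
  moreover have "((\<lambda>h. v (s + h) \<Phi>') \<longlongrightarrow> v s \<Phi>') (at 0)"
    using DERIV_isCont[OF deriv[OF test_on_test_functions[OF \<Phi>'], of s]]
    by (simp add: isCont_iff)
  moreover have "((\<lambda>h. (v (s + h) (\<Phi> s) - v s (\<Phi> s)) / h) \<longlongrightarrow> v' s (\<Phi> s)) (at 0)"
    using deriv[OF test_on_test_functions[OF \<Phi>s], of s] by (simp add: DERIV_def)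
  ultimately have "((\<lambda>h. v (s + h) (rem h) / h + v (s + h) \<Phi>' + (v (s + h) (\<Phi> s) - v s (\<Phi> s)) / h)
      \<longlongrightarrow> 0 + v s \<Phi>' + v' s (\<Phi> s)) (at 0)"
    by (intro tendsto_add)
  moreover have "eventually (\<lambda>h. v (s + h) (rem h) / h + v (s + h) \<Phi>' + (v (s + h) (\<Phi> s) - v s (\<Phi> s)) / h
      = (v (s + h) (\<Phi> (s + h)) - v s (\<Phi> s)) / h) (at 0)"
    unfolding eventually_at by (intro exI[of _ 1]) (auto simp: split)
  ultimately show ?thesis
    unfolding DERIV_def by (simp add: Lim_transform_eventually add.commute)
qed

section \<open>Test functions on the plane\<close>

text \<open>The induction is on the order n while both factors stay fully smooth, so each summand of
  the product rule is again a product of smooth functions.\<close>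

lemma smooth_mult:
  fixes f g :: "'a::real_normed_vector \<Rightarrow> real"
  assumes "smooth f" "smooth g"
  shows "smooth (\<lambda>x. f x * g x)"
proof -
  have "C_k n (\<lambda>x. f x * g x)" for n
    using assms
  proof (induction n arbitrary: f g)
    case 0
    then show ?case by (simp add: continuous_on_mult smooth_continuous_on)
  next
    case (Suc n)
    have d: "((\<lambda>x. f x * g x) has_derivative
        (\<lambda>v. f x * frechet_derivative g (at x) v + frechet_derivative f (at x) v * g x)) (at x)" for x
      using Suc.prems by (intro has_derivative_mult) (auto simp: smooth_differentiable simp flip: frechet_derivative_works)
    have "C_k n (\<lambda>x. 1 * (f x * frechet_derivative g (at x) v) + 1 * (frechet_derivative f (at x) v * g x))" for v
      by (intro C_k_lincomb Suc smooth_frechet_derivative)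
    then show ?case
      using d by (auto simp: frechet_derivative_at[OF d, symmetric] differentiable_def)
  qed
  then show ?thesis by (simp add: smooth_def)
qed

lemma smooth_compose_affine:
  fixes f :: "real \<Rightarrow> real" and l :: "'a::real_normed_vector \<Rightarrow> real"
  assumes "smooth f" and l: "bounded_linear l"
  shows "smooth (\<lambda>x. f (b + l x))"
proof -
  have "C_k n (\<lambda>x. f (b + l x))" for n
    using assms(1)
  proof (induction n arbitrary: f)
    case 0
    have "continuous_on UNIV (\<lambda>x. b + l x)"
      by (intro continuous_intros linear_continuous_on l)
    then show ?case
      using continuous_on_compose2[OF smooth_continuous_on[OF 0, of UNIV]] by auto
  next
    case (Suc n)
    have d: "((\<lambda>x. f (b + l x)) has_derivative (\<lambda>v. deriv f (b + l x) * l v)) (at x)" for x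
    proof -
      have "((\<lambda>x. b + l x) has_derivative l) (at x)"
        using has_derivative_add[OF has_derivative_const bounded_linear_imp_has_derivative[OF l], of b "at x"] by simp
      from has_derivative_compose[OF this, of f "\<lambda>v. deriv f (b + l x) * v"]
      show ?thesis
        using smooth_has_deriv[OF Suc.prems, of "b + l x"] by (simp add: has_field_derivative_def)
    qed
    have "C_k n (\<lambda>x. l v * deriv f (b + l x) + 0 * deriv f (b + l x))" for v
      by (intro C_k_lincomb Suc smooth_deriv)
    then show ?case
      using d by (auto simp: frechet_derivative_at[OF d, symmetric] differentiable_def mult.commute)
  qed
  then show ?thesis by (simp add: smooth_def)
qed

text \<open>These products reduce the weak equation on the plane to an equation in time alone, for
  each fixed \<psi>.\<close>

lemma test_functions_tensor:
  assumes "\<psi> \<in> test_on R" "\<eta> \<in> test_on T"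
  shows "(\<lambda>(x, t). \<psi> x * \<eta> t) \<in> test_functions"
proof -
  have "smooth (\<lambda>p::real \<times> real. \<psi> (0 + fst p) * \<eta> (0 + snd p))"
    using assms by (intro smooth_mult smooth_compose_affine test_on_smooth bounded_linear_fst bounded_linear_snd)
  moreover have "compact (supp (\<lambda>(x, t). \<psi> x * \<eta> t))"
    using assms by (intro compact_suppI[of "{-R..R} \<times> {-T..T}"] compact_Times) (force simp: test_on_def)+
  ultimately show ?thesis
    by (simp add: test_functions_def case_prod_beta')
qed

definition partial_x :: "(real \<times> real \<Rightarrow> real) \<Rightarrow> real \<times> real \<Rightarrow> real" where
  "partial_x f p = frechet_derivative f (at p) (1, 0)"

definition partial_t :: "(real \<times> real \<Rightarrow> real) \<Rightarrow> real \<times> real \<Rightarrow> real" where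
  "partial_t f p = frechet_derivative f (at p) (0, 1)"

lemma smooth_partial: "smooth f \<Longrightarrow> smooth (partial_x f)" "smooth f \<Longrightarrow> smooth (partial_t f)"
  unfolding partial_x_def[abs_def] partial_t_def[abs_def] by (intro smooth_frechet_derivative; assumption)+

lemma DERIV_partial:
  assumes "smooth f"
  shows "((\<lambda>x. f (x, t)) has_real_derivative partial_x f (x, t)) (at x)"
    and "((\<lambda>t. f (x, t)) has_real_derivative partial_t f (x, t)) (at t)"
proof -
  have d: "(f has_derivative frechet_derivative f (at p)) (at p)" for p
    using smooth_differentiable[OF assms] by (simp add: frechet_derivative_works)
  have lin: "linear (frechet_derivative f (at p))" for p
    using d has_derivative_linear by blast
  have scale: "frechet_derivative f (at p) (h, 0) = partial_x f p * h"
      "frechet_derivative f (at p) (0, h) = partial_t f p * h" for p h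
    using linear_scale[OF lin[of p], of h "(1, 0)"] linear_scale[OF lin[of p], of h "(0, 1)"]
    by (simp_all add: partial_x_def partial_t_def mult.commute)
  have "((\<lambda>x. (x, t)) has_derivative (\<lambda>h. (h, 0))) (at x)"
    by (intro derivative_intros)
  from has_derivative_compose[OF this d]
  show "((\<lambda>x. f (x, t)) has_real_derivative partial_x f (x, t)) (at x)"
    by (simp add: has_field_derivative_def scale)
  have "((\<lambda>t. (x, t)) has_derivative (\<lambda>h. (0, h))) (at t)"
    by (intro derivative_intros)
  from has_derivative_compose[OF this d]
  show "((\<lambda>t. f (x, t)) has_real_derivative partial_t f (x, t)) (at t)"
    by (simp add: has_field_derivative_def scale)
qed

lemma continuous_on_slice:
  assumes "smooth (f :: real \<times> real \<Rightarrow> real)"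
  shows "continuous_on A (\<lambda>t. f (x, t))"
  by (rule continuous_on_compose2[OF smooth_continuous_on[OF assms, of UNIV]]) (auto intro!: continuous_intros)

text \<open>Integrate both mixed derivatives in time from b0 to b. Differentiation under the
  integral and the fundamental theorem both give the increment of \<open>partial_x f\<close>;
  differentiating in b then compares the integrands.\<close>

lemma partial_commute:
  assumes f: "smooth f"
  shows "partial_t (partial_x f) p = partial_x (partial_t f) p"
proof -
  obtain x t where p: "p = (x, t)" by fastforce
  \<comment> \<open>Starting one unit earlier puts t in the interior of \<open>{b0..t+1}\<close>, so
    that one-sided derivatives become two-sided.\<close>
  define b0 where "b0 = t - 1"
  let ?g1 = "\<lambda>r. partial_x (partial_t f) (x, r)" and ?g2 = "\<lambda>r. partial_t (partial_x f) (x, r)"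
  have int_eq: "integral {b0..b} ?g1 = integral {b0..b} ?g2" if "b0 \<le> b" for b
  proof -
    have FTC: "integral {b0..b} (\<lambda>r. partial_t g (y, r)) = g (y, b) - g (y, b0)" if "smooth g" for g y
    proof (intro integral_unique fundamental_theorem_of_calculus \<open>b0 \<le> b\<close>)
      show "((\<lambda>r. g (y, r)) has_vector_derivative partial_t g (y, r)) (at r within {b0..b})" for r
        using has_field_derivative_at_within[OF DERIV_partial(2)[OF that]]
        by (simp add: has_real_derivative_iff_has_vector_derivative)
    qed
    have "((\<lambda>y. integral (cbox b0 b) (\<lambda>r. partial_t f (y, r))) has_real_derivative
        integral (cbox b0 b) ?g1) (at x within UNIV)"
    proof (rule leibniz_rule_field_derivative)
      show "continuous_on (UNIV \<times> cbox b0 b) (\<lambda>(y, r). partial_x (partial_t f) (y, r))"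
        using smooth_continuous_on[OF smooth_partial(1)[OF smooth_partial(2)[OF f]]] by simp
      show "(\<lambda>r. partial_t f (y, r)) integrable_on cbox b0 b" for y
        by (intro integrable_continuous continuous_on_slice smooth_partial f)
    qed (auto intro!: DERIV_partial smooth_partial f)
    moreover have "((\<lambda>y. integral (cbox b0 b) (\<lambda>r. partial_t f (y, r))) has_real_derivative
        partial_x f (x, b) - partial_x f (x, b0)) (at x)"
      using DERIV_diff[OF DERIV_partial(1)[OF f] DERIV_partial(1)[OF f]] by (simp add: FTC[OF f])
    ultimately have "integral {b0..b} ?g1 = partial_x f (x, b) - partial_x f (x, b0)"
      using DERIV_unique by fastforce
    then show ?thesis
      using FTC[OF smooth_partial(1)[OF f]] by simp
  qed
  have "((\<lambda>b. integral {b0..b} (\<lambda>r. g (x, r))) has_real_derivative g (x, t)) (at t within {b0..t+1})"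
    if "smooth g" for g :: "real \<times> real \<Rightarrow> real"
    using that by (intro integral_has_real_derivative continuous_on_slice) (auto simp: b0_def)
  note D = this[OF smooth_partial(1)[OF smooth_partial(2)[OF f]]] this[OF smooth_partial(2)[OF smooth_partial(1)[OF f]]]
  have "((\<lambda>b. integral {b0..b} ?g1) has_real_derivative ?g2 t) (at t within {b0..t+1})"
    by (rule has_field_derivative_transform_within[OF D(2) zero_less_one])
       (use int_eq in \<open>auto simp: b0_def\<close>)
  moreover have "at t within {b0..t+1} = at t"
    by (rule at_within_Icc_at) (auto simp: b0_def)
  ultimately have "?g1 t = ?g2 t"
    using D(1) DERIV_unique by metis
  then show ?thesis by (simp add: p)
qed

text \<open>The mean value estimate is applied first to f' and then to r \<mapsto> f r - r f' s. The
  constant M instead of M / 2 is the price of this shortcut.\<close>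

lemma taylor2_bound:
  fixes f :: "real \<Rightarrow> real"
  assumes "\<And>r. (f has_real_derivative f' r) (at r)" "\<And>r. (f' has_real_derivative f'' r) (at r)"
    and M: "\<And>r. \<bar>r - s\<bar> \<le> 1 \<Longrightarrow> \<bar>f'' r\<bar> \<le> M" and h: "\<bar>h\<bar> \<le> 1"
  shows "\<bar>f (s + h) - f s - h * f' s\<bar> \<le> M * h\<^sup>2"
proof -
  let ?S = "cball s \<bar>h\<bar>"
  have M0: "0 \<le> M" using M[of s] by linarith
  have 1: "\<bar>f' r - f' s\<bar> \<le> M * \<bar>h\<bar>" if "r \<in> ?S" for r
  proof -
    have "norm (f' r - f' s) \<le> M * norm (r - s)"
      by (rule field_differentiable_bound[of ?S f' f''])
         (use assms(2) that h in \<open>auto intro!: M simp: dist_real_def has_field_derivative_at_within\<close>)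
    also have "\<dots> \<le> M * \<bar>h\<bar>"
      using that M0 by (intro mult_left_mono) (auto simp: dist_real_def)
    finally show ?thesis by simp
  qed
  have "norm ((f (s + h) - (s + h) * f' s) - (f s - s * f' s)) \<le> M * \<bar>h\<bar> * norm (s + h - s)"
  proof (rule field_differentiable_bound[of ?S])
    show "((\<lambda>r. f r - r * f' s) has_real_derivative f' r - f' s) (at r within ?S)" for r
      by (auto intro!: derivative_eq_intros has_field_derivative_at_within[OF assms(1)])
  qed (use 1 in \<open>auto simp: dist_real_def\<close>)
  then show ?thesis
    by (simp add: algebra_simps power2_eq_square)
qed

definition vanishes_outside :: "real \<Rightarrow> (real \<times> real \<Rightarrow> real) \<Rightarrow> bool" where
  "vanishes_outside R f \<longleftrightarrow> (\<forall>x t. R < \<bar>x\<bar> \<or> R < \<bar>t\<bar> \<longrightarrow> f (x, t) = 0)"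

lemma test_functions_vanishes_outside:
  assumes "\<phi> \<in> test_functions"
  obtains R where "0 \<le> R" "vanishes_outside R \<phi>"
proof -
  obtain R where R: "\<And>p. p \<in> supp \<phi> \<Longrightarrow> norm p \<le> R"
    using assms compact_imp_bounded[of "supp \<phi>"] unfolding test_functions_def bounded_iff by auto
  have "\<phi> (x, t) = 0" if "R < \<bar>x\<bar> \<or> R < \<bar>t\<bar>" for x t
  proof (rule ccontr)
    assume "\<phi> (x, t) \<noteq> 0"
    then have "(x, t) \<in> supp \<phi>"
      using closure_subset[of "{p. \<phi> p \<noteq> 0}"] by (auto simp: supp_def)
    then show False
      using R[of "(x, t)"] norm_fst_le[of x t] norm_snd_le[of t x] that by auto
  qed
  then show ?thesis
    using that[of "max R 0"] by (auto simp: vanishes_outside_def)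
qed

lemma vanishes_outside_partial:
  assumes "smooth f" "vanishes_outside R f"
  shows "vanishes_outside R (partial_x f)" "vanishes_outside R (partial_t f)"
proof -
  have "frechet_derivative f (at (x, t)) = (\<lambda>_. 0)" if "R < \<bar>x\<bar> \<or> R < \<bar>t\<bar>" for x t
  proof -
    have "open {p::real \<times> real. R < \<bar>fst p\<bar> \<or> R < \<bar>snd p\<bar>}"
      by (intro open_Collect_disj open_Collect_less continuous_intros)
    then have "frechet_derivative f (at (x, t)) = frechet_derivative (\<lambda>_. 0) (at (x, t))"
      by (rule frechet_derivative_transform_within_open[OF smooth_differentiable[OF assms(1)]])
         (use assms(2) that in \<open>auto simp: vanishes_outside_def\<close>)
    then show ?thesis by simp
  qed
  then show "vanishes_outside R (partial_x f)" "vanishes_outside R (partial_t f)"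
    by (auto simp: vanishes_outside_def partial_x_def partial_t_def)
qed

lemma vanishes_outside_bounded:
  assumes "smooth f" "vanishes_outside R f"
  shows "\<exists>M. \<forall>p. \<bar>f p\<bar> \<le> M"
proof -
  have "compact (f ` ({-R..R} \<times> {-R..R}))"
    by (intro compact_continuous_image smooth_continuous_on compact_Times assms) auto
  then obtain M where M: "\<And>y. y \<in> f ` ({-R..R} \<times> {-R..R}) \<Longrightarrow> \<bar>y\<bar> \<le> M"
    by (metis bounded_iff compact_imp_bounded real_norm_def)
  have "\<bar>f p\<bar> \<le> max M 0" for p
  proof (cases "p \<in> {-R..R} \<times> {-R..R}")
    case True
    then show ?thesis using M[of "f p"] by force
  next
    case False
    then have "f p = 0"
      using assms(2) by (cases p) (force simp: vanishes_outside_def)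
    then show ?thesis by simp
  qed
  then show ?thesis by blast
qed

lemma slice_deriv_iter:
  assumes "smooth f"
  shows "smooth (\<lambda>x. f (x, t))" "(deriv ^^ j) (\<lambda>x. f (x, t)) = (\<lambda>x. (partial_x ^^ j) f (x, t))"
proof -
  have s: "smooth ((partial_x ^^ j) f)" for j
    by (induction j) (auto simp: assms smooth_partial)
  have D: "((\<lambda>x. (partial_x ^^ j) f (x, t)) has_real_derivative (partial_x ^^ Suc j) f (x, t)) (at x)" for j x
    using DERIV_partial(1)[OF s[of j]] by simp
  show "smooth (\<lambda>x. f (x, t))"
    by (rule deriv_iter_eqI(1)[where D = "\<lambda>j x. (partial_x ^^ j) f (x, t)"]) (simp, rule D)
  show "(deriv ^^ j) (\<lambda>x. f (x, t)) = (\<lambda>x. (partial_x ^^ j) f (x, t))"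
    by (rule deriv_iter_eqI(2)[where D = "\<lambda>j x. (partial_x ^^ j) f (x, t)"]) (simp, rule D)
qed

lemma slice_test_on:
  assumes "smooth f" "vanishes_outside R f"
  shows "(\<lambda>x. f (x, t)) \<in> test_on R"
  using assms slice_deriv_iter(1) by (auto simp: test_on_def vanishes_outside_def)

text \<open>Iterated x-derivatives of a slice are slices of iterated partials, and these commute
  with the t-partials. Compact support bounds the second time derivative, so Taylor's estimate
  applies for every j.\<close>

lemma test_derivative_slice:
  assumes "smooth f" "vanishes_outside R f"
  shows "test_derivative R (\<lambda>t x. f (x, t)) (\<lambda>x. partial_t f (x, t)) t"
  unfolding test_derivative_def
proof (intro conjI allI impI)
  show "(\<lambda>x. partial_t f (x, t)) \<in> test_on R" "(\<lambda>x. f (x, t + h)) \<in> test_on R" for h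
    using assms by (simp_all add: slice_test_on smooth_partial vanishes_outside_partial)
  fix j
  let ?g = "(partial_x ^^ j) f"
  have g: "smooth ?g \<and> vanishes_outside R ?g"
    by (induction j) (auto simp: assms smooth_partial vanishes_outside_partial)
  then obtain M where M: "\<And>p. \<bar>partial_t (partial_t ?g) p\<bar> \<le> M"
    using vanishes_outside_bounded[of "partial_t (partial_t ?g)" R] by (auto simp: smooth_partial vanishes_outside_partial)
  \<comment> \<open>Needed because \<open>\<Phi>'\<close> is differentiated in x after t, whereas
    Taylor's estimate concerns the t-derivative of the x-derivatives.\<close>
  have comm: "(partial_x ^^ j) (partial_t f) = partial_t ?g"
  proof (induction j)
    case (Suc j)
    have "smooth ((partial_x ^^ j) f)"
      by (induction j) (auto simp: assms smooth_partial)
    then show ?case using Suc partial_commute by auto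
  qed simp
  have "\<bar>?g (x, t + h) - ?g (x, t) - h * partial_t ?g (x, t)\<bar> \<le> M * h\<^sup>2" if "\<bar>h\<bar> \<le> 1" for h x
    using g that M
    by (intro taylor2_bound[where f = "\<lambda>t. ?g (x, t)" and f' = "\<lambda>t. partial_t ?g (x, t)" and
          f'' = "\<lambda>t. partial_t (partial_t ?g) (x, t)"] DERIV_partial) (auto simp: smooth_partial)
  then show "\<exists>C. \<forall>h x. \<bar>h\<bar> \<le> 1 \<longrightarrow> \<bar>(deriv ^^ j) (\<lambda>x. f (x, t + h)) x - (deriv ^^ j) (\<lambda>x. f (x, t)) x
      - h * (deriv ^^ j) (\<lambda>x. partial_t f (x, t)) x\<bar> \<le> C * h\<^sup>2"
    by (auto simp: slice_deriv_iter assms smooth_partial comm)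
qed

section \<open>From the weak to the pointwise equation\<close>

definition flat_exp :: "nat \<Rightarrow> real \<Rightarrow> real" where
  "flat_exp m x = (if 0 < x then (1 / x) ^ m * exp (- (1 / x)) else 0)"

text \<open>The whole family indexed by m is closed under differentiation up to linear combinations,
  which makes smoothness a single induction. At 0 the right difference quotient is a power of 1 / h
  divided by exp (1 / h), and the exponential wins.\<close>

lemma DERIV_flat_exp: "(flat_exp m has_real_derivative flat_exp (m + 2) x - real m * flat_exp (m + 1) x) (at x)"
proof -
  consider "0 < x" | "x < 0" | "x = 0" by linarith
  then show ?thesis
  proof cases
    case 1
    have "((\<lambda>x. (1 / x) ^ m * exp (- (1 / x))) has_real_derivative
        flat_exp (m + 2) x - real m * flat_exp (m + 1) x) (at x)"
    proof -
      have inv: "((\<lambda>x. 1 / x) has_real_derivative - ((1 / x)\<^sup>2)) (at x)"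
        using 1 by (auto intro!: derivative_eq_intros simp: power2_eq_square)
      have "((\<lambda>x. exp (- (1 / x))) has_real_derivative exp (- (1 / x)) * - (- ((1 / x)\<^sup>2))) (at x)"
        by (intro DERIV_fun_exp DERIV_minus inv)
      from DERIV_mult'[OF DERIV_power[OF inv, of m] this] show ?thesis
      proof (rule DERIV_cong)
        define y where "y = 1 / x"
        define e where "e = exp (- y)"
        have "y ^ m * (e * - (- (y\<^sup>2))) + of_nat m * (- (y\<^sup>2) * y ^ (m - Suc 0)) * e = y ^ (m + 2) * e - real m * (y ^ (m + 1) * e)"
          \<comment> \<open>For m = 0 the exponent \<open>m - Suc 0\<close> is a truncated
            subtraction, but its term carries the factor m.\<close>
          by (cases m) (simp_all add: power2_eq_square algebra_simps)
        then show "(1 / x) ^ m * (exp (- (1 / x)) * - (- ((1 / x)\<^sup>2))) +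
            of_nat m * (- ((1 / x)\<^sup>2) * (1 / x) ^ (m - Suc 0)) * exp (- (1 / x)) =
            flat_exp (m + 2) x - real m * flat_exp (m + 1) x"
          using 1 by (simp only: flat_exp_def if_True flip: y_def e_def)
      qed
    qed
    then show ?thesis
      by (rule has_field_derivative_transform_within_open[where S = "{0<..}"]) (use 1 in \<open>auto simp: flat_exp_def\<close>)
  next
    case 2
    have "((\<lambda>x. 0) has_real_derivative flat_exp (m + 2) x - real m * flat_exp (m + 1) x) (at x)"
      using 2 by (simp add: flat_exp_def)
    then show ?thesis
      by (rule has_field_derivative_transform_within_open[where S = "{..<0}"]) (use 2 in \<open>auto simp: flat_exp_def\<close>)
  next
    case 3
    have "((\<lambda>h. (1 / h) ^ Suc m / exp (1 / h)) \<longlongrightarrow> 0) (at_right (0::real))"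
      using filterlim_compose[OF tendsto_power_div_exp_0 filterlim_inverse_at_top_right, of "Suc m"]
      by (simp add: inverse_eq_divide)
    then have "((\<lambda>h. (flat_exp m (0 + h) - flat_exp m 0) / h) \<longlongrightarrow> 0) (at_right 0)"
      by (rule Lim_transform_eventually)
         (auto simp: eventually_at_filter flat_exp_def exp_minus field_simps intro!: always_eventually)
    moreover have "((\<lambda>h. (flat_exp m (0 + h) - flat_exp m 0) / h) \<longlongrightarrow> 0) (at_left 0)"
      by (rule tendsto_eventually) (auto simp: eventually_at_filter flat_exp_def intro!: always_eventually)
    ultimately have "((\<lambda>h. (flat_exp m (0 + h) - flat_exp m 0) / h) \<longlongrightarrow> 0) (at 0)"
      by (simp add: filterlim_split_at)
    then show ?thesis
      using 3 by (simp add: DERIV_def flat_exp_def)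
  qed
qed

lemma smooth_flat_exp: "smooth (flat_exp m)"
proof -
  have "C_k n (flat_exp m)" for n
  proof (induction n arbitrary: m)
    case 0
    then show ?case
      using DERIV_flat_exp by (auto intro!: continuous_at_imp_continuous_on DERIV_isCont)
  next
    case (Suc n)
    have df: "flat_exp m differentiable (at x)" for x
      using DERIV_flat_exp real_differentiable_def by blast
    have "frechet_derivative (flat_exp m) (at x) v = v * flat_exp (m + 2) x + (- v * real m) * flat_exp (m + 1) x" for x v
      unfolding frechet_derivative_real[OF df] DERIV_imp_deriv[OF DERIV_flat_exp]
      by (simp add: algebra_simps)
    moreover have "C_k n (\<lambda>x. v * flat_exp (m + 2) x + (- v * real m) * flat_exp (m + 1) x)" for v
      by (intro C_k_lincomb Suc)
    ultimately show ?case
      unfolding C_k.simps using df by presburger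
  qed
  then show ?thesis by (simp add: smooth_def)
qed

lemma bump_exists:
  obtains \<rho> :: "real \<Rightarrow> real" where "smooth \<rho>" "\<And>x. 0 \<le> \<rho> x" "\<And>x. x \<le> 0 \<or> 1 \<le> x \<Longrightarrow> \<rho> x = 0" "0 < \<rho> (1/2)"
proof (rule that[of "\<lambda>x. flat_exp 0 x * flat_exp 0 (1 + - x)"])
  have "bounded_linear (uminus :: real \<Rightarrow> real)"
    by (intro bounded_linear_minus bounded_linear_ident)
  then show "smooth (\<lambda>x. flat_exp 0 x * flat_exp 0 (1 + - x))"
    by (intro smooth_mult smooth_flat_exp smooth_compose_affine)
qed (auto simp: flat_exp_def)

section \<open>Antiderivatives and the du Bois-Reymond lemma\<close>

lemma antiderivative_exists:
  assumes "continuous_on UNIV (f :: real \<Rightarrow> real)"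
  obtains F where "\<And>x. (F has_real_derivative f x) (at x)"
proof -
  have "\<exists>F. \<forall>x::real. -\<infinity> < ereal x \<longrightarrow> ereal x < \<infinity> \<longrightarrow> (F has_vector_derivative f x) (at x)"
    using assms by (intro einterval_antiderivative) (auto simp: continuous_on_eq_continuous_at)
  then show ?thesis
    using that by (auto simp: has_real_derivative_iff_has_vector_derivative)
qed

lemma smooth_antiderivative:
  assumes F: "\<And>x. (F has_real_derivative f x) (at x)" and f: "smooth f"
  shows "smooth F"
proof (rule deriv_iter_eqI(1)[where D = "\<lambda>j. case j of 0 \<Rightarrow> F | Suc i \<Rightarrow> (deriv ^^ i) f"])
  show "((case j of 0 \<Rightarrow> F | Suc i \<Rightarrow> (deriv ^^ i) f) has_real_derivative
      (case Suc j of 0 \<Rightarrow> F | Suc i \<Rightarrow> (deriv ^^ i) f) x) (at x)" for j x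
    using F smooth_has_deriv_iter[OF f] by (cases j) auto
qed simp

lemma FTC_DERIV:
  assumes "\<And>x. (F has_real_derivative f x) (at x)" "a \<le> b"
  shows "(f has_integral F b - F a) {a..b}"
proof (rule fundamental_theorem_of_calculus[OF assms(2)])
  show "(F has_vector_derivative f x) (at x within {a..b})" for x
    using has_field_derivative_at_within[OF assms(1)]
    by (simp add: has_real_derivative_iff_has_vector_derivative)
qed

lemma DERIV_zero_eq:
  assumes "\<And>x. (F has_real_derivative f x) (at x)" "\<And>x. x \<in> {a..b} \<Longrightarrow> f x = 0" "a \<le> b"
  shows "F a = (F b :: real)"
proof (cases "a = b")
  case False
  then have "\<exists>z>a. z < b \<and> F b - F a = (b - a) * f z"
    using assms(3) by (intro MVT2 assms(1)) simp
  then show ?thesis using assms(2) by auto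
qed simp

text \<open>If \<open>r y < r z\<close>, let \<open>\<eta>'\<close> be a narrow bump at \<open>y\<close> minus the same bump at \<open>z\<close>:
  then \<open>(r - m) * \<eta>' \<le> 0\<close> for \<open>m\<close> between the two values, and its integral cannot vanish.\<close>

lemma du_Bois_Reymond:
  fixes r :: "real \<Rightarrow> real"
  assumes r: "continuous_on UNIV r"
    and int: "\<And>T R \<eta>. 0 \<le> T \<Longrightarrow> T < R \<Longrightarrow> \<eta> \<in> test_on T \<Longrightarrow>
      ((\<lambda>t. r t * deriv \<eta> t) has_integral 0) {-R..R}"
  shows "r y = r z"
proof -
  have "\<not> r y < r z" for y z
  proof
    assume less: "r y < r z"
    define m where "m = (r y + r z) / 2"
    obtain \<rho> :: "real \<Rightarrow> real" where \<rho>: "smooth \<rho>" "\<And>x. 0 \<le> \<rho> x" "\<And>x. x \<le> 0 \<or> 1 \<le> x \<Longrightarrow> \<rho> x = 0" "0 < \<rho> (1/2)"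
      using bump_exists by blast
    obtain P where P: "\<And>x. (P has_real_derivative \<rho> x) (at x)"
      using antiderivative_exists smooth_continuous_on[OF \<rho>(1)] by blast
    have "isCont r y" "isCont r z"
      using r by (auto simp: continuous_on_eq_continuous_at)
    then have "(r \<longlongrightarrow> r y) (nhds y)" "(r \<longlongrightarrow> r z) (nhds z)"
      by (simp_all add: isCont_def tendsto_at_iff_tendsto_nhds)
    then have "eventually (\<lambda>t. r t < m) (nhds y)" "eventually (\<lambda>t. m < r t) (nhds z)"
      using less order_tendstoD[of r "r y" "nhds y" m] order_tendstoD[of r "r z" "nhds z" m]
      by (simp_all add: m_def)
    then obtain d e where d: "0 < d" "\<And>t. dist t y < d \<Longrightarrow> r t < m" and e: "0 < e" "\<And>t. dist t z < e \<Longrightarrow> m < r t"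
      unfolding eventually_nhds_metric by blast
    define \<epsilon> where "\<epsilon> = min d e"
    have \<epsilon>: "0 < \<epsilon>" "\<And>t. dist t y < \<epsilon> \<Longrightarrow> r t < m" "\<And>t. dist t z < \<epsilon> \<Longrightarrow> m < r t"
      using d e by (auto simp: \<epsilon>_def)
    \<comment> \<open>P is constant to the left of 0 and to the right of 1, so the difference
      vanishes wherever both arguments lie on the same side; this gives \<eta> compact
      support.\<close>
    define \<eta> where "\<eta> t = P ((t - y) / \<epsilon>) - P ((t - z) / \<epsilon>)" for t
    define \<eta>' where "\<eta>' t = (\<rho> ((t - y) / \<epsilon>) - \<rho> ((t - z) / \<epsilon>)) / \<epsilon>" for t
    have D: "(\<eta> has_real_derivative \<eta>' t) (at t)" for t
    proof -
      have "((\<lambda>t. P ((t - w) / \<epsilon>)) has_real_derivative \<rho> ((t - w) / \<epsilon>) * (1 / \<epsilon>)) (at t)" for w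
        by (rule DERIV_chain2[OF P]) (use \<epsilon>(1) in \<open>auto intro!: derivative_eq_intros\<close>)
      from DERIV_diff[OF this[of y] this[of z]] show ?thesis
        by (simp add: \<eta>_def[abs_def] \<eta>'_def diff_divide_distrib)
    qed
    \<comment> \<open>The bump at w lives on \<open>{w..w + \<epsilon>}\<close>; this T exceeds the
      modulus of every such point for w = y and w = z.\<close>
    define T where "T = \<bar>y\<bar> + \<bar>z\<bar> + \<epsilon>"
    define R where "R = T + 1"
    have P1: "P x = P 1" if "1 \<le> x" for x
      using DERIV_zero_eq[OF P, of 1 x] \<rho>(3) that by auto
    have P0: "P x = P 0" if "x \<le> 0" for x
      using DERIV_zero_eq[OF P, of x 0] \<rho>(3) that by auto
    have \<eta>0: "\<eta> t = 0" if "T < \<bar>t\<bar>" for t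
    proof (cases "0 \<le> t")
      case True
      then have "1 \<le> (t - y) / \<epsilon>" "1 \<le> (t - z) / \<epsilon>"
        using that \<epsilon>(1) by (auto simp: T_def)
      then show ?thesis using P1 by (metis \<eta>_def cancel_comm_monoid_add_class.diff_cancel)
    next
      case False
      then have "(t - y) / \<epsilon> \<le> 0" "(t - z) / \<epsilon> \<le> 0"
        using that \<epsilon>(1) by (auto simp: T_def divide_le_0_iff)
      then show ?thesis using P0 by (metis \<eta>_def cancel_comm_monoid_add_class.diff_cancel)
    qed
    moreover have "smooth \<eta>"
    proof -
      have "smooth P" by (rule smooth_antiderivative[OF P \<rho>(1)])
      moreover have "bounded_linear (\<lambda>t. t / \<epsilon>)" by (rule bounded_linear_divide)
      ultimately have "smooth (\<lambda>t. 1 * P (- (y / \<epsilon>) + t / \<epsilon>) + (-1) * P (- (z / \<epsilon>) + t / \<epsilon>))"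
        by (intro smooth_lincomb smooth_compose_affine)
      then show ?thesis
        by (simp add: \<eta>_def[abs_def] diff_divide_distrib algebra_simps)
    qed
    ultimately have \<eta>: "\<eta> \<in> test_on T" by (simp add: test_on_def)
    have R0: "0 \<le> T" "0 < R" "T < R" using \<epsilon>(1) by (simp_all add: R_def T_def)
    have der: "deriv \<eta> = \<eta>'" using D by (auto simp: DERIV_imp_deriv)
    have "((\<lambda>t. r t * \<eta>' t) has_integral 0) {-R..R}"
      using int[OF _ _ \<eta>] R0 der by simp
    moreover have "(\<eta>' has_integral 0) {-R..R}"
    proof -
      have "(\<eta>' has_integral \<eta> R - \<eta> (-R)) {-R..R}"
        using R0 D by (intro FTC_DERIV) auto
      moreover have "\<eta> R = 0" "\<eta> (-R) = 0"
        using R0 \<eta>0 by auto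
      ultimately show ?thesis by simp
    qed
    ultimately have "((\<lambda>t. m * \<eta>' t - r t * \<eta>' t) has_integral 0) {-R..R}"
      using has_integral_diff[OF has_integral_mult_right[of \<eta>' 0 _ m], of "{-R..R}" "\<lambda>t. r t * \<eta>' t" 0] by simp
    then have I: "((\<lambda>t. (m - r t) * \<eta>' t) has_integral 0) (cbox (-R) R)"
      by (simp add: left_diff_distrib)
    have sign: "0 \<le> (m - r t) * \<rho> ((t - y) / \<epsilon>)" "(m - r t) * \<rho> ((t - z) / \<epsilon>) \<le> 0" for t
    proof -
      have near: "dist t w < \<epsilon>" if "\<rho> ((t - w) / \<epsilon>) \<noteq> 0" for w
        using \<rho>(3)[of "(t - w) / \<epsilon>"] that \<epsilon>(1) by (force simp: dist_real_def not_le field_simps)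
      show "0 \<le> (m - r t) * \<rho> ((t - y) / \<epsilon>)"
        using near[of y] \<epsilon>(2)[of t] \<rho>(2) by (cases "\<rho> ((t - y) / \<epsilon>) = 0") (auto intro!: mult_nonneg_nonneg)
      show "(m - r t) * \<rho> ((t - z) / \<epsilon>) \<le> 0"
        using near[of z] \<epsilon>(3)[of t] \<rho>(2) by (cases "\<rho> ((t - z) / \<epsilon>) = 0") (auto intro!: mult_nonpos_nonneg)
    qed
    have split: "(m - r t) * \<eta>' t = ((m - r t) * \<rho> ((t - y) / \<epsilon>) - (m - r t) * \<rho> ((t - z) / \<epsilon>)) / \<epsilon>" for t
      by (simp add: \<eta>'_def right_diff_distrib)
    \<comment> \<open>Here the argument of the first bump is 1/2, the point at which \<rho> is known
      to be positive.\<close>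
    define t0 where "t0 = y + \<epsilon> / 2"
    have "(m - r t0) * \<eta>' t0 = 0"
    \<comment> \<open>A continuous nonnegative function with integral 0 vanishes at every point of
      the interval.\<close>
    proof (rule has_integral_0_cbox_imp_0[OF _ _ I])
      have c': "continuous_on UNIV \<eta>'"
        unfolding \<eta>'_def[abs_def] by (intro continuous_intros continuous_on_compose2[OF smooth_continuous_on[OF \<rho>(1), of UNIV]]) (use \<epsilon>(1) in auto)
      show "continuous_on (cbox (-R) R) (\<lambda>t. (m - r t) * \<eta>' t)"
        by (intro continuous_intros continuous_on_subset[OF r subset_UNIV] continuous_on_subset[OF c' subset_UNIV])
      show "0 \<le> (m - r t) * \<eta>' t" for t
        unfolding split using sign[of t] \<epsilon>(1) by (intro divide_nonneg_pos) linarith+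
      show "t0 \<in> cbox (-R) R" "box (-R) R \<noteq> {}"
        using \<epsilon>(1) R0 by (auto simp: t0_def R_def T_def)
    qed
    moreover have "0 < (m - r t0) * \<rho> ((t0 - y) / \<epsilon>)"
      using \<epsilon>(1) \<epsilon>(2)[of t0] \<rho>(4) by (intro mult_pos_pos) (auto simp: t0_def dist_real_def)
    ultimately show False
      unfolding split using sign(2)[of t0] \<epsilon>(1) by (auto simp: divide_eq_0_iff)
  qed
  then show ?thesis by (meson linorder_neq_iff)
qed

section \<open>Gain of one time derivative from the weak equation\<close>

lemma test_functions_eqI_lincomb:
  assumes "\<psi> \<in> test_functions" "\<omega> \<in> test_functions" "\<Lambda> \<in> distributions" "\<And>x. f x = p * \<psi> x + q * \<omega> x"
  shows "\<Lambda> f = p * \<Lambda> \<psi> + q * \<Lambda> \<omega>"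
  using distributions_lincomb[OF assms(3,1,2), of p q] assms(4) by presburger

lemma C1_distr_DERIV:
  assumes "C1_distr u" "\<phi> \<in> test_functions"
  shows "((\<lambda>s. u s \<phi>) has_real_derivative time_deriv u s \<phi>) (at s)"
proof -
  have "(\<lambda>s. u s \<phi>) differentiable (at s)"
    using assms by (simp add: C1_distr_def)
  then show ?thesis
    using assms(2) DERIV_imp_deriv by (auto simp: real_differentiable_def time_deriv_def)
qed

text \<open>With g = u tested against \<psi> and Q a primitive of the spatial term, the weak
  equation says that Q - g' - k g has integral 0 against every \<eta>', hence is constant. Then g'
  equals Q - k g up to a constant, and the right-hand side is differentiable.\<close>

lemma telegraph_strong:
  assumes C1: "C1_distr u" and weak: "telegraph_weak k c u" and \<psi>: "\<psi> \<in> test_functions"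
  shows "((\<lambda>s. time_deriv u s \<psi>) has_real_derivative
    c\<^sup>2 * u t (deriv (deriv \<psi>)) - k * time_deriv u t \<psi>) (at t)"
proof -
  let ?g = "\<lambda>s. u s \<psi>" and ?g' = "\<lambda>s. time_deriv u s \<psi>" and ?q = "\<lambda>s. c\<^sup>2 * u s (deriv (deriv \<psi>))"
  have \<psi>'': "deriv (deriv \<psi>) \<in> test_functions"
    by (intro test_functions_deriv \<psi>)
  have dist: "u s \<in> distributions" for s
    using C1 by (simp add: C1_distr_def)
  have g: "(?g has_real_derivative ?g' s) (at s)" for s
    by (rule C1_distr_DERIV[OF C1 \<psi>])
  have cg: "continuous_on UNIV ?g" using g by (meson DERIV_isCont continuous_at_imp_continuous_on)
  have cg': "continuous_on UNIV ?g'" using C1 \<psi> by (simp add: C1_distr_def)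
  have cq: "continuous_on UNIV ?q"
    using C1_distr_DERIV[OF C1 \<psi>''] by (intro continuous_intros) (meson DERIV_isCont continuous_at_imp_continuous_on)
  obtain Q where Q: "\<And>s. (Q has_real_derivative ?q s) (at s)"
    using antiderivative_exists[OF cq] by blast
  have cQ: "continuous_on UNIV Q" using Q by (meson DERIV_isCont continuous_at_imp_continuous_on)
  define r where "r s = Q s - ?g' s - k * ?g s" for s
  have r: "r y = r z" for y z
  proof (rule du_Bois_Reymond[of r])
    show "continuous_on UNIV r"
      unfolding r_def[abs_def] by (intro continuous_intros cQ cg cg')
    fix T S \<eta> assume T: "0 \<le> T" "T < S" and \<eta>: "\<eta> \<in> test_on T"
    obtain R where R: "\<psi> \<in> test_on R"
      using \<psi> test_functions_test_on by blast
    let ?\<eta>' = "deriv \<eta>" and ?\<eta>'' = "deriv (deriv \<eta>)"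
    have s\<eta>: "smooth \<eta>" "smooth ?\<eta>'" using \<eta> by (simp_all add: test_on_smooth smooth_deriv)
    have s\<psi>: "smooth \<psi>" "smooth (deriv \<psi>)" using R by (simp_all add: test_on_smooth smooth_deriv)
    define h where "h s = (?\<eta>'' s - k * ?\<eta>' s) * ?g s - \<eta> s * ?q s" for s
    have slice: "u s (\<lambda>x. (deriv ^^ 2) (\<lambda>s. (\<lambda>(x, t). \<psi> x * \<eta> t) (x, s)) s
        - k * deriv (\<lambda>s. (\<lambda>(x, t). \<psi> x * \<eta> t) (x, s)) s
        - c\<^sup>2 * (deriv ^^ 2) (\<lambda>y. (\<lambda>(x, t). \<psi> x * \<eta> t) (y, s)) x) = h s" for s
    proof -
      have 1: "deriv (\<lambda>s. \<psi> x * \<eta> s) = (\<lambda>s. \<psi> x * ?\<eta>' s)" "deriv (\<lambda>s. \<psi> x * ?\<eta>' s) = (\<lambda>s. \<psi> x * ?\<eta>'' s)" for x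
        using deriv_lincomb[OF s\<eta>(1) s\<eta>(1), of "\<psi> x" 0] deriv_lincomb[OF s\<eta>(2) s\<eta>(2), of "\<psi> x" 0] by simp_all
      have 2: "deriv (\<lambda>y. \<psi> y * \<eta> s) = (\<lambda>y. deriv \<psi> y * \<eta> s)" "deriv (\<lambda>y. deriv \<psi> y * \<eta> s) = (\<lambda>y. deriv (deriv \<psi>) y * \<eta> s)"
        using deriv_lincomb[OF s\<psi>(1) s\<psi>(1), of "\<eta> s" 0] deriv_lincomb[OF s\<psi>(2) s\<psi>(2), of "\<eta> s" 0]
        by (simp_all add: mult.commute)
      have deriv2: "(deriv ^^ 2) f = deriv (deriv f)" for f :: "real \<Rightarrow> real"
        by (simp add: numeral_2_eq_2)
      have "u s (\<lambda>x. (deriv ^^ 2) (\<lambda>s. (\<lambda>(x, t). \<psi> x * \<eta> t) (x, s)) s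
        - k * deriv (\<lambda>s. (\<lambda>(x, t). \<psi> x * \<eta> t) (x, s)) s
        - c\<^sup>2 * (deriv ^^ 2) (\<lambda>y. (\<lambda>(x, t). \<psi> x * \<eta> t) (y, s)) x)
        = (?\<eta>'' s - k * ?\<eta>' s) * ?g s + (- c\<^sup>2 * \<eta> s) * u s (deriv (deriv \<psi>))"
        by (rule test_functions_eqI_lincomb[OF \<psi> \<psi>'' dist])
           (simp only: prod.case deriv2 1 2, simp add: algebra_simps)
      then show ?thesis by (simp add: h_def)
    qed
    have "has_bochner_integral lborel h 0"
      using weak[unfolded telegraph_weak_def, rule_format, OF test_functions_tensor[OF R \<eta>]]
      unfolding slice .
    then have "(h has_integral 0) UNIV"
      by (metis has_bochner_integral_iff has_integral_integral_lborel)
    moreover have "h = (\<lambda>s. if s \<in> {-S..S} then h s else 0)"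
      using \<eta> test_on_deriv[OF \<eta>] test_on_deriv[OF test_on_deriv[OF \<eta>]] T
      by (auto simp: fun_eq_iff h_def test_on_def)
    ultimately have hI: "(h has_integral 0) {-S..S}"
      using has_integral_restrict_UNIV[of "{-S..S}" h 0] by simp
    \<comment> \<open>The derivative of g \<eta>' - Q \<eta>, which vanishes at both ends of the
      interval. Subtracting it from h leaves exactly \<open>r\<close> times \<eta>'.\<close>
    define D where "D s = ?g s * ?\<eta>'' s + ?g' s * ?\<eta>' s - (Q s * ?\<eta>' s + ?q s * \<eta> s)" for s
    have "(D has_integral (?g S * ?\<eta>' S - Q S * \<eta> S) - (?g (-S) * ?\<eta>' (-S) - Q (-S) * \<eta> (-S))) {-S..S}"
      unfolding D_def
    proof (rule FTC_DERIV)
      show "((\<lambda>s. ?g s * ?\<eta>' s - Q s * \<eta> s) has_real_derivative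
          ?g s * ?\<eta>'' s + ?g' s * ?\<eta>' s - (Q s * ?\<eta>' s + ?q s * \<eta> s)) (at s)" for s
        by (intro DERIV_diff DERIV_mult' g Q smooth_has_deriv s\<eta>)
    qed (use T in simp)
    moreover have "\<eta> S = 0" "\<eta> (-S) = 0" "?\<eta>' S = 0" "?\<eta>' (-S) = 0"
      using \<eta> test_on_deriv[OF \<eta>] T by (auto simp: test_on_def)
    ultimately have "(D has_integral 0) {-S..S}" by simp
    from has_integral_diff[OF hI this]
    show "((\<lambda>t. r t * deriv \<eta> t) has_integral 0) {-S..S}"
      by (simp add: h_def D_def r_def algebra_simps)
  qed
  have "((\<lambda>s. Q s - k * ?g s - r t) has_real_derivative ?q t - k * ?g' t) (at t)"
    by (auto intro!: derivative_eq_intros Q g)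
  moreover have "Q s - k * ?g s - r t = ?g' s" for s
    using r[of t s] by (simp add: r_def)
  ultimately show ?thesis by simp
qed

section \<open>The Klein--Gordon fundamental solution\<close>

definition bessel_coeff :: "nat \<Rightarrow> real" where
  "bessel_coeff m = 1 / (fact m)\<^sup>2"

text \<open>\<open>bessel_J j\<close> is the \<open>j\<close>-th derivative of the entire function
  \<open>J z = (\<Sum>m. z ^ m / (m!)\<^sup>2)\<close>, for which \<open>I\<^sub>0 w = J (w\<^sup>2 / 4)\<close>. Unlike \<open>I\<^sub>0 (2 * sqrt z)\<close> it is
  visibly smooth across \<open>z = 0\<close>, i.e. across the light cone.\<close>

definition bessel_J :: "nat \<Rightarrow> real \<Rightarrow> real" where
  "bessel_J j z = (\<Sum>m. (diffs ^^ j) bessel_coeff m * z ^ m)"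

lemma summable_bessel_coeff: "summable (\<lambda>m. bessel_coeff m * z ^ m)"
proof (rule summable_comparison_test'[where N = 0])
  show "summable (\<lambda>m. \<bar>z\<bar> ^ m / fact m)"
    using summable_exp[of "\<bar>z\<bar>"] by (simp add: field_simps)
  show "norm (bessel_coeff m * z ^ m) \<le> \<bar>z\<bar> ^ m / fact m" for m
  proof -
    have "(1::real) \<le> fact m" by (rule fact_ge_1)
    then have "fact m * 1 \<le> fact m * (fact m :: real)" by (intro mult_left_mono) auto
    then have "1 / (fact m)\<^sup>2 \<le> 1 / (fact m :: real)"
      by (intro divide_left_mono) (auto simp: power2_eq_square)
    then show ?thesis
      using mult_right_mono[of "1 / (fact m)\<^sup>2" "1 / fact m" "\<bar>z\<bar> ^ m"]
      by (simp add: bessel_coeff_def abs_mult power_abs)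
  qed
qed

lemma summable_bessel_J: "summable (\<lambda>m. (diffs ^^ j) bessel_coeff m * z ^ m)"
  by (induction j arbitrary: z) (simp_all add: summable_bessel_coeff termdiff_converges_all)

lemma DERIV_bessel_J: "(bessel_J j has_real_derivative bessel_J (Suc j) z) (at z)"
  unfolding bessel_J_def using termdiffs_strong_converges_everywhere[OF summable_bessel_J, of j z] by simp

lemma DERIV_bessel_J_chain [derivative_intros]:
  "(f has_real_derivative f') (at x) \<Longrightarrow>
    ((\<lambda>x. bessel_J j (f x)) has_real_derivative bessel_J (Suc j) (f x) * f') (at x)"
  by (rule DERIV_chain2[OF DERIV_bessel_J])

lemma continuous_on_bessel_J [continuous_intros]:
  assumes "continuous_on A f"
  shows "continuous_on A (\<lambda>x. bessel_J j (f x))"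
proof -
  have "continuous_on UNIV (bessel_J j)"
    by (meson DERIV_bessel_J DERIV_isCont continuous_at_imp_continuous_on)
  then show ?thesis
    by (rule continuous_on_compose2) (use assms in auto)
qed

lemma bessel_J_nonneg: "0 \<le> z \<Longrightarrow> 0 \<le> bessel_J j z"
proof -
  assume "0 \<le> z"
  have "0 \<le> (diffs ^^ j) bessel_coeff m" for m
    by (induction j arbitrary: m) (simp_all add: bessel_coeff_def diffs_def)
  then show ?thesis
    unfolding bessel_J_def using \<open>0 \<le> z\<close> by (intro suminf_nonneg summable_bessel_J) auto
qed

text \<open>This is the modified Bessel equation of order 0 in the variable z =
  \<open>w\<^sup>2 / 4\<close>; on coefficients it says that (m + 1) squared times the next
  coefficient is the current one.\<close>

lemma bessel_J_ode: "z * bessel_J 2 z + bessel_J 1 z = bessel_J 0 z"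
proof -
  let ?d = "\<lambda>m. diffs bessel_coeff m"
  have "(\<lambda>m. diffs ?d m * z ^ m) sums bessel_J 2 z"
    using summable_sums[OF summable_bessel_J[of 2 z]] by (simp add: bessel_J_def numeral_2_eq_2)
  then have "(\<lambda>m. z * (diffs ?d m * z ^ m)) sums (z * bessel_J 2 z)"
    by (rule sums_mult)
  moreover have "z * (diffs ?d m * z ^ m) = real (Suc m) * ?d (Suc m) * z ^ Suc m" for m
    by (simp add: diffs_def[of ?d])
  ultimately have "(\<lambda>m. real m * ?d m * z ^ m) sums (z * bessel_J 2 z)"
    using sums_Suc_iff[of "\<lambda>m. real m * ?d m * z ^ m" "z * bessel_J 2 z"] by simp
  moreover have "(\<lambda>m. ?d m * z ^ m) sums bessel_J 1 z"
    using summable_sums[OF summable_bessel_J[of 1 z]] by (simp add: bessel_J_def)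
  ultimately have "(\<lambda>m. real m * ?d m * z ^ m + ?d m * z ^ m) sums (z * bessel_J 2 z + bessel_J 1 z)"
    by (rule sums_add)
  moreover have "real m * ?d m * z ^ m + ?d m * z ^ m = bessel_coeff m * z ^ m" for m
  proof -
    have "?d m * (real m + 1) = bessel_coeff m"
      by (simp add: diffs_def bessel_coeff_def power_mult_distrib power2_eq_square divide_simps)
    then show ?thesis by (simp add: algebra_simps flip: \<open>?d m * (real m + 1) = bessel_coeff m\<close>)
  qed
  ultimately have "(\<lambda>m. bessel_coeff m * z ^ m) sums (z * bessel_J 2 z + bessel_J 1 z)" by simp
  then show ?thesis
    by (simp add: bessel_J_def sums_unique)
qed

lemma bessel_I0_eq: "bessel_I0 w = bessel_J 0 (w\<^sup>2 / 4)"
proof -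
  have "(w / 2) ^ (2 * m) = (w\<^sup>2 / 4) ^ m" for m
    by (simp add: power_mult power_divide[of w 2 2])
  then show ?thesis
    by (simp add: bessel_I0_def bessel_J_def bessel_coeff_def)
qed

lemma deriv_bessel_I0: "deriv bessel_I0 w = bessel_J 1 (w\<^sup>2 / 4) * (w / 2)"
proof -
  have "((\<lambda>w. bessel_J 0 (w\<^sup>2 / 4)) has_real_derivative bessel_J (Suc 0) (w\<^sup>2 / 4) * (w / 2)) (at w)"
    by (auto intro!: derivative_eq_intros)
  then show ?thesis
    by (simp add: bessel_I0_eq[abs_def] DERIV_imp_deriv)
qed

section \<open>Time derivatives and bounds for the Klein-Gordon propagator\<close>

context
  fixes a c :: real
begin

text \<open>\<open>wave_E t \<phi>\<close> pairs \<open>\<phi>\<close> with the fundamental solution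
  \<open>sgn t / (2 * c) * J (a / c\<^sup>2 * (c\<^sup>2 * t\<^sup>2 - x\<^sup>2))\<close> on \<open>\<bar>x\<bar> < c * \<bar>t\<bar>\<close> of the Klein--Gordon equation
  \<open>v\<^sub>t\<^sub>t = c\<^sup>2 v\<^sub>x\<^sub>x + 4 a v\<close>, rescaled by \<open>x = c * t * s\<close>;
  \<open>wave_Et\<close> is its time derivative, with the derivative of \<open>\<phi>\<close> integrated by parts.\<close>

definition wave_arg :: "real \<Rightarrow> real \<Rightarrow> real" where
  "wave_arg t s = a * t\<^sup>2 * (1 - s\<^sup>2)"

definition wave_E :: "real \<Rightarrow> (real \<Rightarrow> real) \<Rightarrow> real" where
  "wave_E t \<phi> = t / 2 * integral {-1..1} (\<lambda>s. bessel_J 0 (wave_arg t s) * \<phi> (c * t * s))"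

definition wave_Et :: "real \<Rightarrow> (real \<Rightarrow> real) \<Rightarrow> real" where
  "wave_Et t \<phi> = (\<phi> (c * t) + \<phi> (- (c * t))) / 2 +
     a * t\<^sup>2 * integral {-1..1} (\<lambda>s. bessel_J 1 (wave_arg t s) * \<phi> (c * t * s))"

lemma continuous_on_wave_arg [continuous_intros]:
  "continuous_on A f \<Longrightarrow> continuous_on A g \<Longrightarrow> continuous_on A (\<lambda>x. wave_arg (f x) (g x))"
  unfolding wave_arg_def by (intro continuous_intros)

lemma continuous_on_UNIV_compose:
  "continuous_on UNIV \<phi> \<Longrightarrow> continuous_on A f \<Longrightarrow> continuous_on A (\<lambda>x. \<phi> (f x))"
  by (rule continuous_on_compose2) auto

lemma integral_parts:
  fixes f g f' g' :: "real \<Rightarrow> real"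
  assumes "\<And>s. (f has_real_derivative f' s) (at s)" "\<And>s. (g has_real_derivative g' s) (at s)"
    and "continuous_on UNIV f'" "continuous_on UNIV g'"
  shows "integral {-1..1} (\<lambda>s. f s * g' s) = f 1 * g 1 - f (-1) * g (-1) - integral {-1..1} (\<lambda>s. f' s * g s)"
proof -
  have c: "continuous_on UNIV f" "continuous_on UNIV g"
    using assms(1,2) by (meson DERIV_isCont continuous_at_imp_continuous_on)+
  have i: "(\<lambda>s. f s * g' s) integrable_on {-1..1}" "(\<lambda>s. f' s * g s) integrable_on {-1..1}"
    by (auto intro!: integrable_continuous_real continuous_intros assms c intro: continuous_on_subset)
  have "((\<lambda>s. f s * g' s + f' s * g s) has_integral f 1 * g 1 - f (-1) * g (-1)) {-1..1}"
  proof (rule fundamental_theorem_of_calculus)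
    show "((\<lambda>s. f s * g s) has_vector_derivative f s * g' s + f' s * g s) (at s within {-1..1})" for s
      using has_field_derivative_at_within[OF DERIV_mult'[OF assms(1) assms(2)]]
      by (simp add: has_real_derivative_iff_has_vector_derivative)
  qed simp
  then have "integral {-1..1} (\<lambda>s. f s * g' s + f' s * g s) = f 1 * g 1 - f (-1) * g (-1)"
    by (rule integral_unique)
  then show ?thesis
    using integral_add[OF i] by linarith
qed

text \<open>Rescaling the light cone to \<open>{-1..1}\<close> fixes the domain of integration, so
  no boundary terms arise here; they return through integration by parts in s.\<close>

lemma DERIV_wave_integral:
  assumes \<phi>: "\<And>x. (\<phi> has_real_derivative \<phi>' x) (at x)" and \<phi>': "continuous_on UNIV \<phi>'"
  shows "((\<lambda>t. integral {-1..1} (\<lambda>s. bessel_J j (wave_arg t s) * \<phi> (c * t * s))) has_real_derivative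
    integral {-1..1} (\<lambda>s. bessel_J (Suc j) (wave_arg t s) * (2 * a * t * (1 - s\<^sup>2)) * \<phi> (c * t * s)
      + bessel_J j (wave_arg t s) * (c * s * \<phi>' (c * t * s)))) (at t)"
proof -
  have c: "continuous_on UNIV \<phi>"
    using \<phi> by (meson DERIV_isCont continuous_at_imp_continuous_on)
  have "((\<lambda>t. integral (cbox (-1) 1) (\<lambda>s. bessel_J j (wave_arg t s) * \<phi> (c * t * s))) has_real_derivative
    integral (cbox (-1) 1) (\<lambda>s. bessel_J (Suc j) (wave_arg t s) * (2 * a * t * (1 - s\<^sup>2)) * \<phi> (c * t * s)
      + bessel_J j (wave_arg t s) * (c * s * \<phi>' (c * t * s)))) (at t within UNIV)"
  proof (rule leibniz_rule_field_derivative)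
    show "((\<lambda>t. bessel_J j (wave_arg t s) * \<phi> (c * t * s)) has_real_derivative
        bessel_J (Suc j) (wave_arg t s) * (2 * a * t * (1 - s\<^sup>2)) * \<phi> (c * t * s)
        + bessel_J j (wave_arg t s) * (c * s * \<phi>' (c * t * s))) (at t within UNIV)" for t s
    proof -
      have "((\<lambda>t. wave_arg t s) has_real_derivative 2 * a * t * (1 - s\<^sup>2)) (at t)"
        unfolding wave_arg_def by (auto intro!: derivative_eq_intros)
      moreover have "((\<lambda>t. \<phi> (c * t * s)) has_real_derivative \<phi>' (c * t * s) * (c * s)) (at t)"
        by (rule DERIV_chain2[OF \<phi>]) (auto intro!: derivative_eq_intros)
      ultimately show ?thesis
        by (auto intro!: derivative_eq_intros)
    qed
    show "(\<lambda>s. bessel_J j (wave_arg t s) * \<phi> (c * t * s)) integrable_on cbox (-1) 1" for t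
      by (intro integrable_continuous continuous_intros continuous_on_UNIV_compose[OF c])
    show "continuous_on (UNIV \<times> cbox (-1) 1) (\<lambda>(t, s). bessel_J (Suc j) (wave_arg t s) *
        (2 * a * t * (1 - s\<^sup>2)) * \<phi> (c * t * s) + bessel_J j (wave_arg t s) * (c * s * \<phi>' (c * t * s)))"
      unfolding case_prod_beta
      by (intro continuous_intros continuous_on_UNIV_compose[OF c] continuous_on_UNIV_compose[OF \<phi>'])
  qed auto
  then show ?thesis by simp
qed

lemma DERIV_wave_arg: "((\<lambda>s. wave_arg t s) has_real_derivative - (2 * a * t\<^sup>2 * s)) (at s)"
  unfolding wave_arg_def by (auto intro!: derivative_eq_intros)

lemma wave_arg_ends [simp]: "wave_arg t 1 = 0" "wave_arg t (-1) = 0"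
  by (simp_all add: wave_arg_def)

lemma bessel_J_zero [simp]: "bessel_J 0 0 = 1"
  unfolding bessel_J_def by (subst powser_zero) (simp add: bessel_coeff_def)

lemma DERIV_scaled:
  fixes s :: real
  assumes "\<And>x. (\<phi> has_real_derivative \<phi>' x) (at x)"
  shows "((\<lambda>s. \<phi> (b * s)) has_real_derivative b * \<phi>' (b * s)) (at s)"
  by (rule DERIV_chain2[OF assms DERIV_cmult_Id, THEN DERIV_cong]) simp

lemma integral_cmult: "integral A (\<lambda>s. (r::real) * f s) = r * integral A f"
  by simp

text \<open>c t \<phi>'(c t s) is the s-derivative of \<phi>(c t s). Integrating by parts leaves the
  values of \<phi> on the light cone, where the Bessel factor is 1.\<close>

lemma wave_E_deriv:
  assumes \<phi>: "\<And>x. (\<phi> has_real_derivative \<phi>' x) (at x)" and \<phi>': "continuous_on UNIV \<phi>'"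
  shows "c * wave_E t \<phi>' = (\<phi> (c * t) - \<phi> (- (c * t))) / 2 +
    a * t\<^sup>2 * integral {-1..1} (\<lambda>s. bessel_J 1 (wave_arg t s) * s * \<phi> (c * t * s))"
proof -
  have "c * wave_E t \<phi>' = 1 / 2 * integral {-1..1} (\<lambda>s. bessel_J 0 (wave_arg t s) * (c * t * \<phi>' (c * t * s)))"
    by (simp add: wave_E_def mult.left_commute[of _ "c * t"] integral_cmult)
  also have "integral {-1..1} (\<lambda>s. bessel_J 0 (wave_arg t s) * (c * t * \<phi>' (c * t * s))) =
    bessel_J 0 (wave_arg t 1) * \<phi> (c * t * 1) - bessel_J 0 (wave_arg t (-1)) * \<phi> (c * t * (-1))
    - integral {-1..1} (\<lambda>s. bessel_J (Suc 0) (wave_arg t s) * (- (2 * a * t\<^sup>2 * s)) * \<phi> (c * t * s))"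
    by (intro integral_parts DERIV_bessel_J_chain DERIV_wave_arg DERIV_scaled \<phi>
        continuous_intros continuous_on_UNIV_compose[OF \<phi>'])
  also have "(\<lambda>s. bessel_J (Suc 0) (wave_arg t s) * (- (2 * a * t\<^sup>2 * s)) * \<phi> (c * t * s)) =
      (\<lambda>s. (- 2 * a * t\<^sup>2) * (bessel_J 1 (wave_arg t s) * s * \<phi> (c * t * s)))"
    by (auto simp: algebra_simps)
  finally show ?thesis
    unfolding integral_cmult by (simp add: algebra_simps diff_divide_distrib)
qed

text \<open>The term with \<phi>' is integrated by parts against s times the Bessel factor. This
  cancels both the integral from differentiating the prefactor t / 2 and the part with
  \<open>s\<^sup>2\<close>, leaving \<open>wave_Et\<close>.\<close>

lemma DERIV_wave_E:
  assumes \<phi>: "\<And>x. (\<phi> has_real_derivative \<phi>' x) (at x)" and \<phi>': "continuous_on UNIV \<phi>'"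
  shows "((\<lambda>t. wave_E t \<phi>) has_real_derivative wave_Et t \<phi>) (at t)"
proof -
  have c: "continuous_on UNIV \<phi>"
    using \<phi> by (meson DERIV_isCont continuous_at_imp_continuous_on)
  note cc = continuous_on_UNIV_compose[OF c] continuous_on_UNIV_compose[OF \<phi>']
  let ?J = "\<lambda>s. bessel_J 0 (wave_arg t s)" and ?J' = "\<lambda>s. bessel_J (Suc 0) (wave_arg t s)"
    and ?\<phi> = "\<lambda>s. \<phi> (c * t * s)"
  define I where "I = integral {-1..1} (\<lambda>s. ?J s * ?\<phi> s)"
  define I1 where "I1 = integral {-1..1} (\<lambda>s. ?J' s * ?\<phi> s)"
  define I2 where "I2 = integral {-1..1} (\<lambda>s. ?J' s * s\<^sup>2 * ?\<phi> s)"
  define I3 where "I3 = integral {-1..1} (\<lambda>s. ?J s * s * (c * t * \<phi>' (c * t * s)))"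
  define K where "K = integral {-1..1} (\<lambda>s. ?J' s * (2 * a * t * (1 - s\<^sup>2)) * ?\<phi> s + ?J s * (c * s * \<phi>' (c * t * s)))"
  have "((\<lambda>t. wave_E t \<phi>) has_real_derivative 1 / 2 * I + t / 2 * K) (at t)"
    unfolding wave_E_def I_def K_def
    by (rule DERIV_mult'[OF _ DERIV_wave_integral[OF \<phi> \<phi>'], THEN DERIV_cong])
       (auto intro!: derivative_eq_intros)
  \<comment> \<open>The factor t turns c s \<phi>'(c t s) into s times an exact s-derivative, and no
    division by t is needed at t = 0.\<close>
  moreover have "t * K = 2 * a * t\<^sup>2 * (I1 - I2) + I3"
  proof -
    have "t * K =
      integral {-1..1} (\<lambda>s. 2 * a * t\<^sup>2 * (?J' s * ?\<phi> s - ?J' s * s\<^sup>2 * ?\<phi> s)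
        + ?J s * s * (c * t * \<phi>' (c * t * s)))"
      unfolding K_def integral_cmult[symmetric] by (rule integral_cong) (simp add: algebra_simps power2_eq_square)
    also have "\<dots> = 2 * a * t\<^sup>2 * (I1 - I2) + I3"
      unfolding I1_def I2_def I3_def
      by (subst integral_add, (intro integrable_continuous_real continuous_intros cc)+,
          subst integral_cmult, subst integral_diff, (intro integrable_continuous_real continuous_intros cc)+, rule refl)
    finally show ?thesis .
  qed
  moreover have "I3 = \<phi> (c * t) + \<phi> (- (c * t)) - (I - 2 * a * t\<^sup>2 * I2)"
  proof -
    have "I3 = ?J 1 * 1 * \<phi> (c * t * 1) - ?J (-1) * (-1) * \<phi> (c * t * (-1))
        - integral {-1..1} (\<lambda>s. (?J' s * (- (2 * a * t\<^sup>2 * s)) * s + ?J s * 1) * ?\<phi> s)"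
      unfolding I3_def
    proof (intro integral_parts DERIV_scaled \<phi> continuous_intros cc)
      show "((\<lambda>s. ?J s * s) has_real_derivative ?J' s * (- (2 * a * t\<^sup>2 * s)) * s + ?J s * 1) (at s)" for s
        by (rule DERIV_mult'[OF DERIV_bessel_J_chain[OF DERIV_wave_arg] DERIV_ident, THEN DERIV_cong]) simp
    qed
    also have "(\<lambda>s. (?J' s * (- (2 * a * t\<^sup>2 * s)) * s + ?J s * 1) * ?\<phi> s) =
        (\<lambda>s. ?J s * ?\<phi> s - 2 * a * t\<^sup>2 * (?J' s * s\<^sup>2 * ?\<phi> s))"
      by (auto simp: algebra_simps power2_eq_square)
    also have "integral {-1..1} \<dots> = I - 2 * a * t\<^sup>2 * I2"
      unfolding I_def I2_def
      by (subst integral_diff, (intro integrable_continuous_real continuous_intros cc)+, subst integral_cmult, rule refl)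
    finally show ?thesis by simp
  qed
  moreover have "wave_Et t \<phi> = (\<phi> (c * t) + \<phi> (- (c * t))) / 2 + a * t\<^sup>2 * I1"
    by (simp add: wave_Et_def I1_def)
  ultimately show ?thesis
    by (elim DERIV_cong) (simp add: algebra_simps add_divide_distrib)
qed

text \<open>Bessel's equation trades the second derivative for the function minus its first
  derivative. The first-derivative part cancels against the derivative of the prefactor
  \<open>t\<^sup>2\<close>, the function itself gives the mass term, and \<open>wave_E_deriv\<close>
  applied to \<phi>' identifies the rest.\<close>

lemma DERIV_wave_Et:
  assumes \<phi>: "\<And>x. (\<phi> has_real_derivative \<phi>' x) (at x)" and \<phi>': "\<And>x. (\<phi>' has_real_derivative \<phi>'' x) (at x)"
    and \<phi>'': "continuous_on UNIV \<phi>''"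
  shows "((\<lambda>t. wave_Et t \<phi>) has_real_derivative c\<^sup>2 * wave_E t \<phi>'' + 4 * a * wave_E t \<phi>) (at t)"
proof -
  have c: "continuous_on UNIV \<phi>" "continuous_on UNIV \<phi>'"
    using \<phi> \<phi>' by (meson DERIV_isCont continuous_at_imp_continuous_on)+
  note cc = continuous_on_UNIV_compose[OF c(1)] continuous_on_UNIV_compose[OF c(2)]
  let ?J = "\<lambda>j s. bessel_J j (wave_arg t s)" and ?\<phi> = "\<lambda>s. \<phi> (c * t * s)"
  define I0 where "I0 = integral {-1..1} (\<lambda>s. ?J 0 s * ?\<phi> s)"
  define I1 where "I1 = integral {-1..1} (\<lambda>s. ?J 1 s * ?\<phi> s)"
  define I2 where "I2 = integral {-1..1} (\<lambda>s. ?J 1 s * s * \<phi>' (c * t * s))"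
  define K where "K = integral {-1..1} (\<lambda>s. ?J 2 s * (2 * a * t * (1 - s\<^sup>2)) * ?\<phi> s + ?J 1 s * (c * s * \<phi>' (c * t * s)))"
  have ode: "wave_arg t s * ?J 2 s = ?J 0 s - ?J 1 s" for s
    using bessel_J_ode[of "wave_arg t s"] by linarith
  have "((\<lambda>t. \<phi> (c * t)) has_real_derivative c * \<phi>' (c * t)) (at t)"
    by (rule DERIV_scaled[OF \<phi>])
  moreover have "((\<lambda>t. \<phi> (- (c * t))) has_real_derivative - c * \<phi>' (- (c * t))) (at t)"
    using DERIV_scaled[OF \<phi>, of "-c" t] by simp
  moreover note DERIV_wave_integral[OF \<phi> c(2), of 1 t]
  ultimately have "((\<lambda>t. wave_Et t \<phi>) has_real_derivative
      (c * \<phi>' (c * t) - c * \<phi>' (- (c * t))) / 2 + (2 * a * t * I1 + a * t\<^sup>2 *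
      K)) (at t)"
    unfolding wave_Et_def I1_def K_def Suc_1[symmetric]
    by (intro DERIV_add DERIV_cdivide DERIV_mult'[THEN DERIV_cong]) (auto intro!: derivative_eq_intros)
  moreover have "t * K = 2 * (I0 - I1) + c * t * I2"
  proof -
    have "t * K = integral {-1..1} (\<lambda>s. 2 * (wave_arg t s * ?J 2 s) * ?\<phi> s + c * t * (?J 1 s * s * \<phi>' (c * t * s)))"
      unfolding K_def integral_cmult[symmetric]
      by (rule integral_cong) (simp add: wave_arg_def algebra_simps power2_eq_square)
    also have "(\<lambda>s. 2 * (wave_arg t s * ?J 2 s) * ?\<phi> s + c * t * (?J 1 s * s * \<phi>' (c * t * s))) =
        (\<lambda>s. 2 * (?J 0 s * ?\<phi> s - ?J 1 s * ?\<phi> s) + c * t * (?J 1 s * s * \<phi>' (c * t * s)))"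
      unfolding ode by (auto simp: algebra_simps)
    also have "integral {-1..1} \<dots> = 2 * (I0 - I1) + c * t * I2"
      unfolding I0_def I1_def I2_def
      by (subst integral_add, (intro integrable_continuous_real continuous_intros cc)+, unfold integral_cmult,
          subst integral_diff, (intro integrable_continuous_real continuous_intros cc)+, rule refl)
    finally show ?thesis .
  qed
  then have "a * t\<^sup>2 * K = a * t * (2 * (I0 - I1) + c * t * I2)"
    by (metis (no_types, lifting) mult.assoc power2_eq_square)
  moreover have "c\<^sup>2 * wave_E t \<phi>'' = (c * \<phi>' (c * t) - c * \<phi>' (- (c * t))) / 2 + a * t\<^sup>2 * c * I2"
  proof -
    have "c\<^sup>2 * wave_E t \<phi>'' = c * (c * wave_E t \<phi>'')"
      by (simp add: power2_eq_square)
    also have "\<dots> = c * ((\<phi>' (c * t) - \<phi>' (- (c * t))) / 2 + a * t\<^sup>2 * I2)"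
      using wave_E_deriv[OF \<phi>' \<phi>''] by (simp add: I2_def)
    finally show ?thesis by (simp add: algebra_simps)
  qed
  moreover have "4 * a * wave_E t \<phi> = 2 * a * t * I0"
    by (simp add: wave_E_def I0_def)
  moreover have "(c * \<phi>' (c * t) - c * \<phi>' (- (c * t))) / 2 + (2 * a * t * I1 + a * t * (2 * (I0 - I1) + c * t * I2)) =
      (c * \<phi>' (c * t) - c * \<phi>' (- (c * t))) / 2 + a * t\<^sup>2 * c * I2 + 2 * a * t * I0"
    by (simp add: algebra_simps power2_eq_square)
  ultimately show ?thesis
    by (elim DERIV_cong) linarith
qed

lemma wave_E_lincomb:
  assumes "continuous_on UNIV \<phi>" "continuous_on UNIV \<psi>"
  shows "wave_E t (\<lambda>x. p * \<phi> x + q * \<psi> x) = p * wave_E t \<phi> + q * wave_E t \<psi>"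
    and "wave_Et t (\<lambda>x. p * \<phi> x + q * \<psi> x) = p * wave_Et t \<phi> + q * wave_Et t \<psi>"
proof -
  have *: "integral {-1..1} (\<lambda>s. bessel_J j (wave_arg t s) * (p * \<phi> (c * t * s) + q * \<psi> (c * t * s))) =
      p * integral {-1..1} (\<lambda>s. bessel_J j (wave_arg t s) * \<phi> (c * t * s)) +
      q * integral {-1..1} (\<lambda>s. bessel_J j (wave_arg t s) * \<psi> (c * t * s))" for j
    unfolding integral_cmult[symmetric]
    by (subst integral_add[symmetric], (intro integrable_continuous_real continuous_intros
        continuous_on_UNIV_compose[OF assms(1)] continuous_on_UNIV_compose[OF assms(2)])+,
        rule integral_cong) (simp add: algebra_simps)
  show "wave_E t (\<lambda>x. p * \<phi> x + q * \<psi> x) = p * wave_E t \<phi> + q * wave_E t \<psi>"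
    unfolding wave_E_def * by (simp add: algebra_simps)
  show "wave_Et t (\<lambda>x. p * \<phi> x + q * \<psi> x) = p * wave_Et t \<phi> + q * wave_Et t \<psi>"
    unfolding wave_Et_def * by (simp add: algebra_simps add_divide_distrib)
qed

text \<open>Both functionals are controlled by the supremum of \<phi> alone, uniformly on bounded
  time intervals. This gives continuity in \<phi> and also the uniform bounds on the backward
  solutions.\<close>

lemma wave_bound:
  obtains B where "0 \<le> B"
    "\<And>t \<phi> M. \<bar>t\<bar> \<le> T \<Longrightarrow> continuous_on UNIV \<phi> \<Longrightarrow> (\<And>x. \<bar>\<phi> x\<bar> \<le> M) \<Longrightarrow>
      \<bar>wave_E t \<phi>\<bar> \<le> B * M \<and> \<bar>wave_Et t \<phi>\<bar> \<le> B * M"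
proof -
  have "\<exists>L. \<forall>t s. \<bar>t\<bar> \<le> T \<longrightarrow> s \<in> {-1..1} \<longrightarrow> \<bar>bessel_J j (wave_arg t s)\<bar> \<le> L" for j
  proof -
    have "compact ((\<lambda>(t, s). bessel_J j (wave_arg t s)) ` ({-T..T} \<times> {-1..1}))"
      unfolding case_prod_beta
      by (intro compact_continuous_image continuous_intros compact_Times) auto
    then obtain L where "\<And>y. y \<in> (\<lambda>(t, s). bessel_J j (wave_arg t s)) ` ({-T..T} \<times> {-1..1}) \<Longrightarrow> \<bar>y\<bar> \<le> L"
      by (metis bounded_iff compact_imp_bounded real_norm_def)
    moreover have "bessel_J j (wave_arg t s) \<in> (\<lambda>(t, s). bessel_J j (wave_arg t s)) ` ({-T..T} \<times> {-1..1})"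
      if "\<bar>t\<bar> \<le> T" "s \<in> {-1..1}" for t s
      using that by (intro image_eqI[of _ _ "(t, s)"]) auto
    ultimately show ?thesis by blast
  qed
  then obtain L where L: "\<And>j t s. \<bar>t\<bar> \<le> T \<Longrightarrow> s \<in> {-1..1} \<Longrightarrow> \<bar>bessel_J j (wave_arg t s)\<bar> \<le> L j"
    by metis
  \<comment> \<open>The 1 accounts for the mean of the two values on the light cone, the other terms
    for the prefactors times the interval length 2.\<close>
  define B where "B = 1 + \<bar>T\<bar> * \<bar>L 0\<bar> + 2 * \<bar>a\<bar> * T\<^sup>2 * \<bar>L 1\<bar>"
  have "0 \<le> B" by (simp add: B_def)
  moreover have "\<bar>wave_E t \<phi>\<bar> \<le> B * M \<and> \<bar>wave_Et t \<phi>\<bar> \<le> B * M"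
    if t: "\<bar>t\<bar> \<le> T" and c: "continuous_on UNIV \<phi>" and M: "\<And>x. \<bar>\<phi> x\<bar> \<le> M" for t \<phi> M
  proof -
    have M0: "0 \<le> M" using M[of 0] by linarith
    have I: "\<bar>integral {-1..1} (\<lambda>s. bessel_J j (wave_arg t s) * \<phi> (c * t * s))\<bar> \<le> 2 * (\<bar>L j\<bar> * M)" for j
    proof -
      have "norm (integral {-1..1} (\<lambda>s. bessel_J j (wave_arg t s) * \<phi> (c * t * s))) \<le> \<bar>L j\<bar> * M * (1 - (-1))"
      proof (rule integral_bound)
        show "continuous_on {-1..1} (\<lambda>s. bessel_J j (wave_arg t s) * \<phi> (c * t * s))"
          by (intro continuous_intros continuous_on_UNIV_compose[OF c])
        show "norm (bessel_J j (wave_arg t s) * \<phi> (c * t * s)) \<le> \<bar>L j\<bar> * M" if "s \<in> {-1..1}" for s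
          unfolding real_norm_def abs_mult using L[OF t that, of j] M[of "c * t * s"]
          by (intro mult_mono) auto
      qed auto
      then show ?thesis by simp
    qed
    have tT: "t\<^sup>2 \<le> T\<^sup>2" "\<bar>t\<bar> \<le> \<bar>T\<bar>" using t by (auto simp: abs_le_square_iff[symmetric])
    have "\<bar>wave_E t \<phi>\<bar> \<le> \<bar>T\<bar> / 2 * (2 * (\<bar>L 0\<bar> * M))"
      unfolding wave_E_def abs_mult using tT by (intro mult_mono I) auto
    also have "\<dots> \<le> B * M"
      using M0 by (simp add: B_def algebra_simps)
    finally have 1: "\<bar>wave_E t \<phi>\<bar> \<le> B * M" .
    have "\<bar>a * t\<^sup>2 * integral {-1..1} (\<lambda>s. bessel_J 1 (wave_arg t s) * \<phi> (c * t * s))\<bar> \<le> \<bar>a\<bar> * T\<^sup>2 * (2 * (\<bar>L 1\<bar> * M))"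
      unfolding abs_mult using tT M0 by (intro mult_mono I) auto
    moreover have "\<bar>(\<phi> (c * t) + \<phi> (- (c * t))) / 2\<bar> \<le> M"
    proof -
      have "\<bar>\<phi> (c * t) + \<phi> (- (c * t))\<bar> \<le> 2 * M"
        using M[of "c * t"] M[of "- (c * t)"] by linarith
      then show ?thesis by simp
    qed
    ultimately have "\<bar>wave_Et t \<phi>\<bar> \<le> M + \<bar>a\<bar> * T\<^sup>2 * (2 * (\<bar>L 1\<bar> * M))"
      unfolding wave_Et_def by linarith
    also have "\<dots> \<le> B * M"
      using M0 by (simp add: B_def algebra_simps)
    finally show ?thesis using 1 by simp
  qed
  ultimately show ?thesis using that by blast
qed

end

section \<open>Atom plus density as a probability measure\<close>

lemma mixed_pdf_atom_plus_density:
  assumes p: "0 \<le> p" and f: "f \<in> borel_measurable borel" "\<And>x. 0 \<le> f x" "\<And>x. a < x \<Longrightarrow> f x = 0"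
    and int: "integrable lborel f" and total: "p + (\<integral>x. f x \<partial>lborel) = 1"
  shows "mixed_pdf (distr_add (distr_scale p (dirac a)) (distr_of_fun f))"
proof -
  txt \<open>The atom is the image of a uniform distribution on an interval to the right of \<open>a\<close>.\<close>
  define I where "I = {a + 1..a + 2}"
  define G where "G x = f x + p * indicator I x" for x
  \<comment> \<open>The identity on all points that carry density, since f vanishes beyond a; the
    added mass on I collapses to a.\<close>
  define h where "h x = (if x < a + 1 then x else a)" for x
  define M where "M = distr (density lborel G) borel h"
  have [measurable]: "f \<in> borel_measurable borel" "I \<in> sets borel" by (auto simp: f I_def)
  have [measurable]: "h \<in> borel_measurable borel" unfolding h_def[abs_def] by measurable
  have [measurable]: "G \<in> borel_measurable borel" unfolding G_def[abs_def] by measurable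
  have G0: "0 \<le> G x" for x using p f(2) by (simp add: G_def)
  have eI: "emeasure lborel I = 1" by (simp add: I_def)
  have split: "G x * \<phi> (h x) = f x * \<phi> x + p * \<phi> a * indicator I x" for x and \<phi> :: "real \<Rightarrow> real"
    using f(3)[of x] by (auto simp: G_def h_def I_def indicator_def)
  have em: "emeasure M A = ennreal p * indicator A a + (\<integral>\<^sup>+x\<in>A. ennreal (f x) \<partial>lborel)"
    if [measurable]: "A \<in> sets borel" for A
  proof -
    have "emeasure M A = (\<integral>\<^sup>+x. ennreal (G x) * indicator (h -` A) x \<partial>lborel)"
    proof -
      have [measurable]: "h -` A \<in> sets borel"
        using measurable_sets_borel[of h borel A] by simp
      show ?thesis
        unfolding M_def by (subst emeasure_distr) (auto simp: emeasure_density)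
    qed
    also have "\<dots> = (\<integral>\<^sup>+x. ennreal (f x) * indicator A x + ennreal p * indicator A a * indicator I x \<partial>lborel)"
    proof (intro nn_integral_cong)
      fix x
      have "ennreal (G x) * indicator (h -` A) x = ennreal (G x * indicator A (h x))"
        by (auto simp: indicator_def)
      also have "\<dots> = ennreal (f x * indicator A x + p * indicator A a * indicator I x)"
        using split[of x "indicator A"] by simp
      also have "\<dots> = ennreal (f x) * indicator A x + ennreal p * indicator A a * indicator I x"
        using p f(2) by (auto simp: indicator_def)
      finally show "ennreal (G x) * indicator (h -` A) x = ennreal (f x) * indicator A x + ennreal p * indicator A a * indicator I x" .
    qed
    also have "\<dots> = (\<integral>\<^sup>+x\<in>A. ennreal (f x) \<partial>lborel) + ennreal p * indicator A a"
      by (subst nn_integral_add) (auto simp: nn_integral_cmult_indicator eI)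
    finally show ?thesis by (simp add: add.commute)
  qed
  have "prob_space M"
  proof
    have "emeasure M (space M) = ennreal p + ennreal (\<integral>x. f x \<partial>lborel)"
      using em[of UNIV] f(2) by (simp add: M_def nn_integral_eq_integral[OF int])
    also have "\<dots> = 1"
      using p f(2) total by (simp flip: ennreal_plus)
    finally show "emeasure M (space M) = 1" .
  qed
  moreover have "distr_add (distr_scale p (dirac a)) (distr_of_fun f) = distr_of_measure M"
  proof
    fix \<phi> :: "real \<Rightarrow> real"
    show "distr_add (distr_scale p (dirac a)) (distr_of_fun f) \<phi> = distr_of_measure M \<phi>"
    proof (cases "\<phi> \<in> test_functions")
      case True
      obtain K where K: "\<And>x. \<bar>\<phi> x\<bar> \<le> K"
        using True test_functions_test_on test_on_bounded by metis
      have [measurable]: "\<phi> \<in> borel_measurable borel"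
        by (intro borel_measurable_continuous_onI smooth_continuous_on test_functions_smooth True)
      have "(\<integral>x. \<phi> x \<partial>M) = (\<integral>x. G x * \<phi> (h x) \<partial>lborel)"
        unfolding M_def using G0 by (subst integral_distr) (auto simp: integral_density)
      also have "\<dots> = (\<integral>x. f x * \<phi> x + p * \<phi> a * indicator I x \<partial>lborel)"
        by (simp only: split)
      also have "\<dots> = (\<integral>x. f x * \<phi> x \<partial>lborel) + (\<integral>x. p * \<phi> a * indicator I x \<partial>lborel)"
      proof (rule Bochner_Integration.integral_add)
        show "integrable lborel (\<lambda>x. f x * \<phi> x)"
          by (rule Bochner_Integration.integrable_bound[OF integrable_mult_right[OF int, of K]])
             (use K f(2) in \<open>auto simp: abs_mult mult.commute[of K] intro!: mult_left_mono order_trans[OF K] always_eventually\<close>)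
        show "integrable lborel (\<lambda>x. p * \<phi> a * indicator I x)"
          by (intro integrable_mult_right integrable_real_indicator) (auto simp: eI)
      qed
      also have "(\<integral>x. p * \<phi> a * indicator I x \<partial>lborel) = p * \<phi> a"
        by (simp add: I_def)
      finally show ?thesis
        using True by (simp add: distr_add_def distr_scale_def dirac_def distr_of_fun_def distr_of_measure_def)
    qed (simp add: distr_add_def distr_of_measure_def)
  qed
  moreover have "sets M = sets borel" by (simp add: M_def)
  ultimately show ?thesis
    unfolding mixed_pdf_def using em p f by blast
qed

section \<open>Classical solutions as differentiable curves of test functions\<close>

lemma test_derivative_reflected:
  assumes y: "\<And>j \<tau> y. (G j \<tau> has_real_derivative G (Suc j) \<tau> y) (at y)"
      "\<And>j \<tau> y. (G' j \<tau> has_real_derivative G' (Suc j) \<tau> y) (at y)"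
    and t: "\<And>j \<tau> y. ((\<lambda>\<tau>. G j \<tau> y) has_real_derivative G' j \<tau> y) (at \<tau>)"
      "\<And>j \<tau> y. ((\<lambda>\<tau>. G' j \<tau> y) has_real_derivative G'' j \<tau> y) (at \<tau>)"
    and M: "\<And>j. \<exists>M. \<forall>\<tau> y. \<bar>\<tau> - (T - s)\<bar> \<le> 1 \<longrightarrow> \<bar>G'' j \<tau> y\<bar> \<le> M"
    and vanish: "\<And>\<tau> y. \<bar>\<tau> - (T - s)\<bar> \<le> 1 \<Longrightarrow> R < \<bar>y\<bar> \<Longrightarrow> G 0 \<tau> y = 0 \<and> G' 0 \<tau> y = 0"
  shows "test_derivative R (\<lambda>s. G 0 (T - s)) (\<lambda>y. - G' 0 (T - s) y) s"
proof -
  have iter: "(deriv ^^ j) (G 0 \<tau>) = G j \<tau>" and iter': "(deriv ^^ j) (\<lambda>y. - G' 0 \<tau> y) = (\<lambda>y. - G' j \<tau> y)" for j \<tau>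
  proof -
    show "(deriv ^^ j) (G 0 \<tau>) = G j \<tau>"
      using smooth_from_derivs(2)[of "\<lambda>j. G j \<tau>"] y(1) by blast
    show "(deriv ^^ j) (\<lambda>y. - G' 0 \<tau> y) = (\<lambda>y. - G' j \<tau> y)"
      using smooth_from_derivs(2)[of "\<lambda>j y. - G' j \<tau> y"] DERIV_minus[OF y(2)] by blast
  qed
  have sm: "smooth (G 0 \<tau>)" "smooth (\<lambda>y. - G' 0 \<tau> y)" for \<tau>
    using smooth_from_derivs(1)[of "\<lambda>j. G j \<tau>"] y(1)
      smooth_from_derivs(1)[of "\<lambda>j y. - G' j \<tau> y"] DERIV_minus[OF y(2)] by blast+
  show ?thesis
    unfolding test_derivative_def iter iter'
  proof (intro conjI allI impI)
    show "(\<lambda>y. - G' 0 (T - s) y) \<in> test_on R"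
      using sm vanish[of "T - s"] by (auto simp: test_on_def)
    show "G 0 (T - (s + h)) \<in> test_on R" if "\<bar>h\<bar> \<le> 1" for h
      using sm vanish[of "T - (s + h)"] that by (auto simp: test_on_def)
    fix j
    obtain M where M: "\<And>\<tau> y. \<bar>\<tau> - (T - s)\<bar> \<le> 1 \<Longrightarrow> \<bar>G'' j \<tau> y\<bar> \<le> M"
      using M by blast
    have "\<bar>G j (T - (s + h)) y - G j (T - s) y - h * - G' j (T - s) y\<bar> \<le> M * h\<^sup>2" if "\<bar>h\<bar> \<le> 1" for h y
      \<comment> \<open>Reversal of time: the increment h in s is the increment -h in \<tau>, which
        produces the minus sign in front of \<open>G'\<close>.\<close>
      using taylor2_bound[where f = "\<lambda>\<tau>. G j \<tau> y" and f' = "\<lambda>\<tau>. G' j \<tau> y" and f'' = "\<lambda>\<tau>. G'' j \<tau> y"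
          and s = "T - s" and h = "- h" and M = M] t M that
      by (simp add: algebra_simps)
    then show "\<exists>C. \<forall>h y. \<bar>h\<bar> \<le> 1 \<longrightarrow>
        \<bar>G j (T - (s + h)) y - G j (T - s) y - h * - G' j (T - s) y\<bar> \<le> C * h\<^sup>2" by blast
  qed
qed

context
  fixes a c :: real
begin

lemma DERIV_wave_smooth:
  assumes "smooth \<phi>"
  shows "((\<lambda>t. wave_E a c t \<phi>) has_real_derivative wave_Et a c t \<phi>) (at t)"
    and "((\<lambda>t. wave_Et a c t \<phi>) has_real_derivative c\<^sup>2 * wave_E a c t (deriv (deriv \<phi>)) + 4 * a * wave_E a c t \<phi>) (at t)"
proof -
  show "((\<lambda>t. wave_E a c t \<phi>) has_real_derivative wave_Et a c t \<phi>) (at t)"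
    by (intro DERIV_wave_E[where \<phi>' = "deriv \<phi>"] smooth_has_deriv smooth_deriv smooth_continuous_on assms)
  show "((\<lambda>t. wave_Et a c t \<phi>) has_real_derivative c\<^sup>2 * wave_E a c t (deriv (deriv \<phi>)) + 4 * a * wave_E a c t \<phi>) (at t)"
    by (intro DERIV_wave_Et[where \<phi>' = "deriv \<phi>"] smooth_has_deriv smooth_deriv smooth_continuous_on assms)
qed

lemma wave_zero [simp]: "wave_E a c 0 \<phi> = 0" "wave_Et a c 0 \<phi> = \<phi> 0"
  by (simp_all add: wave_E_def wave_Et_def)

text \<open>The kernel of E is even in x, so pairing it with a translate is a convolution: in
  (\<tau>, y) this is the classical Klein-Gordon solution with value 0 and velocity the j-th
  derivative of \<psi> at \<tau> = 0. The index j makes the y-derivatives a ladder.\<close>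

definition trans_E :: "(real \<Rightarrow> real) \<Rightarrow> nat \<Rightarrow> real \<Rightarrow> real \<Rightarrow> real" where
  "trans_E \<psi> j \<tau> y = wave_E a c \<tau> (\<lambda>x. (deriv ^^ j) \<psi> (x + y))"

definition trans_E' :: "(real \<Rightarrow> real) \<Rightarrow> nat \<Rightarrow> real \<Rightarrow> real \<Rightarrow> real" where
  "trans_E' \<psi> j \<tau> y = wave_Et a c \<tau> (\<lambda>x. (deriv ^^ j) \<psi> (x + y))"

lemma DERIV_wave_integral_shift:
  assumes "smooth \<phi>"
  shows "((\<lambda>y. integral {-1..1} (\<lambda>s. bessel_J j (wave_arg a t s) * \<phi> (c * t * s + y))) has_real_derivative
    integral {-1..1} (\<lambda>s. bessel_J j (wave_arg a t s) * deriv \<phi> (c * t * s + y))) (at y)"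
proof -
  note cc = continuous_on_UNIV_compose[OF smooth_continuous_on[OF assms]]
    continuous_on_UNIV_compose[OF smooth_continuous_on[OF smooth_deriv[OF assms]]]
  have "((\<lambda>y. integral (cbox (-1) 1) (\<lambda>s. bessel_J j (wave_arg a t s) * \<phi> (c * t * s + y))) has_real_derivative
    integral (cbox (-1) 1) (\<lambda>s. bessel_J j (wave_arg a t s) * deriv \<phi> (c * t * s + y))) (at y within UNIV)"
  proof (rule leibniz_rule_field_derivative)
    show "((\<lambda>y. bessel_J j (wave_arg a t s) * \<phi> (c * t * s + y)) has_real_derivative
        bessel_J j (wave_arg a t s) * deriv \<phi> (c * t * s + y)) (at y within UNIV)" for y s
    proof -
      have "((\<lambda>y. \<phi> (c * t * s + y)) has_real_derivative deriv \<phi> (c * t * s + y) * 1) (at y)"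
        by (rule DERIV_chain2[OF smooth_has_deriv[OF assms]]) (auto intro!: derivative_eq_intros)
      then show ?thesis by (intro DERIV_cmult) simp
    qed
    show "(\<lambda>s. bessel_J j (wave_arg a t s) * \<phi> (c * t * s + y)) integrable_on cbox (-1) 1" for y
      by (intro integrable_continuous continuous_intros cc)
    show "continuous_on (UNIV \<times> cbox (-1) 1) (\<lambda>(y, s). bessel_J j (wave_arg a t s) * deriv \<phi> (c * t * s + y))"
      unfolding case_prod_beta by (intro continuous_intros cc)
  qed auto
  then show ?thesis by simp
qed

lemma DERIV_trans_y:
  assumes "smooth \<psi>"
  shows "(trans_E \<psi> j \<tau> has_real_derivative trans_E \<psi> (Suc j) \<tau> y) (at y)"
    and "(trans_E' \<psi> j \<tau> has_real_derivative trans_E' \<psi> (Suc j) \<tau> y) (at y)"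
proof -
  note s = smooth_deriv_iter[OF assms, of j]
  have sh: "((\<lambda>y. (deriv ^^ j) \<psi> (b + y)) has_real_derivative (deriv ^^ Suc j) \<psi> (b + y)) (at y)" for b y
  proof -
    have "((\<lambda>y. b + y) has_real_derivative 1) (at y)"
      by (auto intro!: derivative_eq_intros)
    from DERIV_chain2[OF smooth_has_deriv_iter[OF assms] this] show ?thesis by simp
  qed
  show "(trans_E \<psi> j \<tau> has_real_derivative trans_E \<psi> (Suc j) \<tau> y) (at y)"
    unfolding trans_E_def[abs_def] wave_E_def
    using DERIV_cmult[OF DERIV_wave_integral_shift[OF s, of 0 \<tau> y], of "\<tau> / 2"] by simp
  show "(trans_E' \<psi> j \<tau> has_real_derivative trans_E' \<psi> (Suc j) \<tau> y) (at y)"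
    unfolding trans_E'_def[abs_def] wave_Et_def
    using DERIV_cmult[OF DERIV_wave_integral_shift[OF s, of 1 \<tau> y], of "a * \<tau>\<^sup>2"]
      DERIV_cdivide[OF DERIV_add[OF sh[of "c * \<tau>" y] sh[of "- (c * \<tau>)" y]], of 2]
    by (auto intro!: DERIV_add)
qed

lemma DERIV_trans_t:
  assumes "smooth \<psi>"
  shows "((\<lambda>\<tau>. trans_E \<psi> j \<tau> y) has_real_derivative trans_E' \<psi> j \<tau> y) (at \<tau>)"
    and "((\<lambda>\<tau>. trans_E' \<psi> j \<tau> y) has_real_derivative
      c\<^sup>2 * trans_E \<psi> (j + 2) \<tau> y + 4 * a * trans_E \<psi> j \<tau> y) (at \<tau>)"
proof -
  note s = smooth_shift[OF smooth_deriv_iter[OF assms, of j], of y]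
  have "deriv (deriv (\<lambda>x. (deriv ^^ j) \<psi> (x + y))) = (\<lambda>x. (deriv ^^ (j + 2)) \<psi> (x + y))"
    using deriv_iter_shift[OF smooth_deriv_iter[OF assms, of j], of 2 y] by (simp add: numeral_2_eq_2)
  then show "((\<lambda>\<tau>. trans_E' \<psi> j \<tau> y) has_real_derivative
      c\<^sup>2 * trans_E \<psi> (j + 2) \<tau> y + 4 * a * trans_E \<psi> j \<tau> y) (at \<tau>)"
    using DERIV_wave_smooth(2)[OF s, of \<tau>] by (simp add: trans_E_def trans_E'_def)
  show "((\<lambda>\<tau>. trans_E \<psi> j \<tau> y) has_real_derivative trans_E' \<psi> j \<tau> y) (at \<tau>)"
    using DERIV_wave_smooth(1)[OF s, of \<tau>] by (simp add: trans_E_def trans_E'_def)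
qed

text \<open>Finite speed of propagation: every point c \<tau> s + y that is sampled still lies
  outside the support of \<psi>.\<close>

lemma trans_vanishes:
  assumes \<psi>: "\<psi> \<in> test_on R" and y: "R + \<bar>c\<bar> * \<bar>\<tau>\<bar> < \<bar>y\<bar>"
  shows "trans_E \<psi> j \<tau> y = 0" "trans_E' \<psi> j \<tau> y = 0"
proof -
  have z: "(deriv ^^ j) \<psi> (c * \<tau> * s + y) = 0" if "s \<in> {-1..1}" for s
  proof -
    have "\<bar>c * \<tau> * s\<bar> \<le> \<bar>c\<bar> * \<bar>\<tau>\<bar> * 1"
      unfolding abs_mult using that by (intro mult_left_mono) auto
    then have "R < \<bar>c * \<tau> * s + y\<bar>" using y by linarith
    then show ?thesis
      using test_on_deriv_iter[OF \<psi>, of j] by (simp add: test_on_def)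
  qed
  have "integral {-1..1} (\<lambda>s. bessel_J i (wave_arg a \<tau> s) * (deriv ^^ j) \<psi> (c * \<tau> * s + y)) = 0" for i
    using integral_cong[of "{-1..1}" "\<lambda>s. bessel_J i (wave_arg a \<tau> s) * (deriv ^^ j) \<psi> (c * \<tau> * s + y)" "\<lambda>_. 0"]
    by (simp add: z)
  then show "trans_E \<psi> j \<tau> y = 0" "trans_E' \<psi> j \<tau> y = 0"
    using z[of 1] z[of "-1"] by (simp_all add: trans_E_def trans_E'_def wave_E_def wave_Et_def)
qed

lemma trans_bound:
  assumes \<psi>: "\<psi> \<in> test_on R"
  shows "\<exists>M. \<forall>\<tau> y. \<bar>\<tau>\<bar> \<le> T \<longrightarrow> \<bar>trans_E \<psi> j \<tau> y\<bar> \<le> M \<and> \<bar>trans_E' \<psi> j \<tau> y\<bar> \<le> M"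
proof -
  obtain L where L: "\<And>x. \<bar>(deriv ^^ j) \<psi> x\<bar> \<le> L"
    using test_on_bounded[OF test_on_deriv_iter[OF \<psi>]] by metis
  obtain B where B: "\<And>t \<phi> M. \<bar>t\<bar> \<le> T \<Longrightarrow> continuous_on UNIV \<phi> \<Longrightarrow> (\<And>x. \<bar>\<phi> x\<bar> \<le> M) \<Longrightarrow>
      \<bar>wave_E a c t \<phi>\<bar> \<le> B * M \<and> \<bar>wave_Et a c t \<phi>\<bar> \<le> B * M"
    using wave_bound by metis
  have "continuous_on UNIV (\<lambda>x. (deriv ^^ j) \<psi> (x + y))" for y
    by (intro smooth_continuous_on smooth_shift smooth_deriv_iter test_on_smooth[OF \<psi>])
  then show ?thesis
    unfolding trans_E_def trans_E'_def using B L by meson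
qed

lemma test_derivative_trans:
  assumes \<psi>: "\<psi> \<in> test_on R" and S: "S = R + \<bar>c\<bar> * (\<bar>T - s\<bar> + 1)"
  shows "test_derivative S (\<lambda>s. trans_E \<psi> 0 (T - s)) (\<lambda>y. - trans_E' \<psi> 0 (T - s) y) s"
    and "test_derivative S (\<lambda>s. trans_E' \<psi> 0 (T - s))
      (\<lambda>y. - (c\<^sup>2 * trans_E \<psi> 2 (T - s) y + 4 * a * trans_E \<psi> 0 (T - s) y)) s"
proof -
  have sm: "smooth \<psi>" using \<psi> by (rule test_on_smooth)
  \<comment> \<open>One interval must contain the supports for all \<tau> within distance 1 of T -
    s; hence the extra 1 in S.\<close>
  have far: "R + \<bar>c\<bar> * \<bar>\<tau>\<bar> < \<bar>y\<bar>" if "\<bar>\<tau> - (T - s)\<bar> \<le> 1" "S < \<bar>y\<bar>" for \<tau> y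
  proof -
    have "\<bar>c\<bar> * \<bar>\<tau>\<bar> \<le> \<bar>c\<bar> * (\<bar>T - s\<bar> + 1)"
      using that(1) by (intro mult_left_mono) auto
    then show ?thesis using that(2) S by linarith
  qed
  obtain M where M: "\<And>j \<tau> y. \<bar>\<tau>\<bar> \<le> \<bar>T - s\<bar> + 1 \<Longrightarrow> \<bar>trans_E \<psi> j \<tau> y\<bar> \<le> M j \<and> \<bar>trans_E' \<psi> j \<tau> y\<bar> \<le> M j"
    using trans_bound[OF \<psi>] by metis
  have comb: "\<bar>c\<^sup>2 * x + 4 * a * y\<bar> \<le> c\<^sup>2 * p + 4 * \<bar>a\<bar> * q" if "\<bar>x\<bar> \<le> p" "\<bar>y\<bar> \<le> q" for x y p q
  proof -
    have "\<bar>c\<^sup>2 * x + 4 * a * y\<bar> \<le> c\<^sup>2 * \<bar>x\<bar> + 4 * \<bar>a\<bar> * \<bar>y\<bar>"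
      using abs_triangle_ineq[of "c\<^sup>2 * x" "4 * a * y"] by (simp add: abs_mult)
    also have "\<dots> \<le> c\<^sup>2 * p + 4 * \<bar>a\<bar> * q"
      using that by (intro add_mono mult_left_mono) auto
    finally show ?thesis .
  qed
  show "test_derivative S (\<lambda>s. trans_E \<psi> 0 (T - s)) (\<lambda>y. - trans_E' \<psi> 0 (T - s) y) s"
  proof (rule test_derivative_reflected[where
        G'' = "\<lambda>j \<tau> y. c\<^sup>2 * trans_E \<psi> (j + 2) \<tau> y + 4 * a * trans_E \<psi> j \<tau> y"])
    show "\<exists>M. \<forall>\<tau> y. \<bar>\<tau> - (T - s)\<bar> \<le> 1 \<longrightarrow> \<bar>c\<^sup>2 * trans_E \<psi> (j + 2) \<tau> y + 4 * a * trans_E \<psi> j \<tau> y\<bar> \<le> M" for j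
    proof (intro exI[of _ "c\<^sup>2 * M (j + 2) + 4 * \<bar>a\<bar> * M j"] allI impI comb)
      fix \<tau> y assume "\<bar>\<tau> - (T - s)\<bar> \<le> 1"
      then have "\<bar>\<tau>\<bar> \<le> \<bar>T - s\<bar> + 1" by linarith
      from M[OF this] show "\<bar>trans_E \<psi> (j + 2) \<tau> y\<bar> \<le> M (j + 2)" "\<bar>trans_E \<psi> j \<tau> y\<bar> \<le> M j"
        by blast+
    qed
    show "trans_E \<psi> 0 \<tau> y = 0 \<and> trans_E' \<psi> 0 \<tau> y = 0" if "\<bar>\<tau> - (T - s)\<bar> \<le> 1" "S < \<bar>y\<bar>" for \<tau> y
      using trans_vanishes[OF \<psi> far[OF that]] by blast
  qed (rule DERIV_trans_y[OF sm] DERIV_trans_t[OF sm])+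
  \<comment> \<open>One time derivative further along: \<open>trans_E'\<close> now takes the place
    of G, and the right-hand side of the Klein-Gordon equation that of \<open>G'\<close>. The
    redexes guide the unification with \<open>test_derivative_reflected\<close>.\<close>
  have "test_derivative S (\<lambda>s. (\<lambda>j. trans_E' \<psi> j) 0 (T - s))
      (\<lambda>y. - ((\<lambda>j \<tau> y. c\<^sup>2 * trans_E \<psi> (j + 2) \<tau> y + 4 * a * trans_E \<psi> j \<tau> y) 0 (T - s) y)) s"
  proof (rule test_derivative_reflected[where G'' = "\<lambda>j \<tau> y. c\<^sup>2 * trans_E' \<psi> (j + 2) \<tau> y + 4 * a * trans_E' \<psi> j \<tau> y"])
    show "((\<lambda>y. c\<^sup>2 * trans_E \<psi> (j + 2) \<tau> y + 4 * a * trans_E \<psi> j \<tau> y) has_real_derivative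
        c\<^sup>2 * trans_E \<psi> (Suc j + 2) \<tau> y + 4 * a * trans_E \<psi> (Suc j) \<tau> y) (at y)" for j \<tau> y
      using DERIV_trans_y(1)[OF sm, of "j + 2"] by (intro DERIV_add DERIV_cmult DERIV_trans_y[OF sm]) simp
    show "((\<lambda>\<tau>. c\<^sup>2 * trans_E \<psi> (j + 2) \<tau> y + 4 * a * trans_E \<psi> j \<tau> y) has_real_derivative
        c\<^sup>2 * trans_E' \<psi> (j + 2) \<tau> y + 4 * a * trans_E' \<psi> j \<tau> y) (at \<tau>)" for j \<tau> y
      by (intro DERIV_add DERIV_cmult DERIV_trans_t[OF sm])
    show "\<exists>M. \<forall>\<tau> y. \<bar>\<tau> - (T - s)\<bar> \<le> 1 \<longrightarrow> \<bar>c\<^sup>2 * trans_E' \<psi> (j + 2) \<tau> y + 4 * a * trans_E' \<psi> j \<tau> y\<bar> \<le> M" for j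
    proof (intro exI[of _ "c\<^sup>2 * M (j + 2) + 4 * \<bar>a\<bar> * M j"] allI impI comb)
      fix \<tau> y assume "\<bar>\<tau> - (T - s)\<bar> \<le> 1"
      then have "\<bar>\<tau>\<bar> \<le> \<bar>T - s\<bar> + 1" by linarith
      from M[OF this] show "\<bar>trans_E' \<psi> (j + 2) \<tau> y\<bar> \<le> M (j + 2)" "\<bar>trans_E' \<psi> j \<tau> y\<bar> \<le> M j"
        by blast+
    qed
    show "trans_E' \<psi> 0 \<tau> y = 0 \<and> c\<^sup>2 * trans_E \<psi> (0 + 2) \<tau> y + 4 * a * trans_E \<psi> 0 \<tau> y = 0"
      if "\<bar>\<tau> - (T - s)\<bar> \<le> 1" "S < \<bar>y\<bar>" for \<tau> y
      using trans_vanishes[OF \<psi> far[OF that]] by simp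
  qed (rule DERIV_trans_y[OF sm] DERIV_trans_t[OF sm])+
  then show "test_derivative S (\<lambda>s. trans_E' \<psi> 0 (T - s))
      (\<lambda>y. - (c\<^sup>2 * trans_E \<psi> 2 (T - s) y + 4 * a * trans_E \<psi> 0 (T - s) y)) s"
    by (simp add: numeral_2_eq_2)
qed

end

section \<open>Existence and uniqueness\<close>

context
  fixes k c :: real
begin

text \<open>With this value of a the mass 4 a is \<open>k\<^sup>2 / 4\<close>, the one left after
  the damping is factored out.\<close>

abbreviation "\<kappa> \<equiv> k\<^sup>2 / 16"

text \<open>\<open>tele_op t \<phi>\<close> is \<open>(\<partial>\<^sub>t - c \<partial>\<^sub>x + k / 2) E(t)\<close> tested against \<open>\<phi>\<close>, with \<open>\<partial>\<^sub>x\<close> moved to \<open>\<phi>\<close>.\<close>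

definition tele_op :: "real \<Rightarrow> (real \<Rightarrow> real) \<Rightarrow> real" where
  "tele_op t \<phi> = wave_Et \<kappa> c t \<phi> + c * wave_E \<kappa> c t (deriv \<phi>) + k / 2 * wave_E \<kappa> c t \<phi>"

text \<open>The time derivative of \<open>tele_op\<close>, with the second time derivative of E
  already replaced by means of the Klein-Gordon equation.\<close>

definition tele_op' :: "real \<Rightarrow> (real \<Rightarrow> real) \<Rightarrow> real" where
  "tele_op' t \<phi> = c\<^sup>2 * wave_E \<kappa> c t (deriv (deriv \<phi>)) + k\<^sup>2 / 4 * wave_E \<kappa> c t \<phi> +
     c * wave_Et \<kappa> c t (deriv \<phi>) + k / 2 * wave_Et \<kappa> c t \<phi>"

definition tele_sol :: "real \<Rightarrow> functional" where
  "tele_sol t = (\<lambda>\<phi>\<in>test_functions. exp (- (k / 2) * t) * tele_op t \<phi>)"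

definition tele_sol' :: "real \<Rightarrow> functional" where
  "tele_sol' t = (\<lambda>\<phi>\<in>test_functions. exp (- (k / 2) * t) * (tele_op' t \<phi> - k / 2 * tele_op t \<phi>))"

lemma DERIV_tele_op:
  assumes "smooth \<phi>"
  shows "((\<lambda>t. tele_op t \<phi>) has_real_derivative tele_op' t \<phi>) (at t)"
    and "((\<lambda>t. tele_op' t \<phi>) has_real_derivative c\<^sup>2 * tele_op t (deriv (deriv \<phi>)) + k\<^sup>2 / 4 * tele_op t \<phi>) (at t)"
proof -
  note s = assms smooth_deriv[OF assms] smooth_deriv[OF smooth_deriv[OF assms]]
  show "((\<lambda>t. tele_op t \<phi>) has_real_derivative tele_op' t \<phi>) (at t)"
    unfolding tele_op_def
    by (rule DERIV_cong[OF DERIV_add[OF DERIV_add[OF DERIV_wave_smooth(2)[OF s(1)]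
          DERIV_cmult[OF DERIV_wave_smooth(1)[OF s(2)]]] DERIV_cmult[OF DERIV_wave_smooth(1)[OF s(1)]]]])
       (simp add: tele_op'_def)
  show "((\<lambda>t. tele_op' t \<phi>) has_real_derivative c\<^sup>2 * tele_op t (deriv (deriv \<phi>)) + k\<^sup>2 / 4 * tele_op t \<phi>) (at t)"
    unfolding tele_op'_def
    by (rule DERIV_cong[OF DERIV_add[OF DERIV_add[OF DERIV_add[OF DERIV_cmult[OF DERIV_wave_smooth(1)[OF s(3)]]
          DERIV_cmult[OF DERIV_wave_smooth(1)[OF s(1)]]] DERIV_cmult[OF DERIV_wave_smooth(2)[OF s(2)]]]
          DERIV_cmult[OF DERIV_wave_smooth(2)[OF s(1)]]]])
       (simp add: tele_op_def algebra_simps)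
qed

lemma tele_op_lincomb:
  assumes "smooth \<phi>" "smooth \<psi>"
  shows "tele_op t (\<lambda>x. p * \<phi> x + q * \<psi> x) = p * tele_op t \<phi> + q * tele_op t \<psi>"
    and "tele_op' t (\<lambda>x. p * \<phi> x + q * \<psi> x) = p * tele_op' t \<phi> + q * tele_op' t \<psi>"
proof -
  note c = smooth_continuous_on[OF assms(1), of UNIV] smooth_continuous_on[OF assms(2), of UNIV]
  note s' = assms[THEN smooth_deriv]
  note c' = smooth_continuous_on[OF s'(1), of UNIV] smooth_continuous_on[OF s'(2), of UNIV]
  note s'' = s'[THEN smooth_deriv]
  note c'' = smooth_continuous_on[OF s''(1), of UNIV] smooth_continuous_on[OF s''(2), of UNIV]
  note L = wave_E_lincomb[OF c] wave_E_lincomb[OF c'] wave_E_lincomb[OF c'']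
  show "tele_op t (\<lambda>x. p * \<phi> x + q * \<psi> x) = p * tele_op t \<phi> + q * tele_op t \<psi>"
    "tele_op' t (\<lambda>x. p * \<phi> x + q * \<psi> x) = p * tele_op' t \<phi> + q * tele_op' t \<psi>"
    unfolding tele_op_def tele_op'_def deriv_lincomb[OF assms] deriv_lincomb[OF s'] L
    by (simp_all add: algebra_simps)
qed

lemma tele_op_bound:
  obtains C where "\<And>\<phi>. \<phi> \<in> test_functions \<Longrightarrow> \<bar>tele_op t \<phi>\<bar> \<le> C * seminorm 2 \<phi>"
    "\<And>\<phi>. \<phi> \<in> test_functions \<Longrightarrow> \<bar>tele_op' t \<phi>\<bar> \<le> C * seminorm 2 \<phi>"
proof -
  obtain B where B: "0 \<le> B" "\<And>\<phi> M. continuous_on UNIV \<phi> \<Longrightarrow> (\<And>x. \<bar>\<phi> x\<bar> \<le> M) \<Longrightarrow>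
      \<bar>wave_E \<kappa> c t \<phi>\<bar> \<le> B * M \<and> \<bar>wave_Et \<kappa> c t \<phi>\<bar> \<le> B * M"
    using wave_bound[of "\<bar>t\<bar>" \<kappa> c] by (metis order_refl)
  define C where "C = (1 + \<bar>c\<bar> + \<bar>k\<bar> + c\<^sup>2 + k\<^sup>2) * B"
  have est: "\<bar>wave_E \<kappa> c t ((deriv ^^ j) \<phi>)\<bar> \<le> B * seminorm 2 \<phi>" "\<bar>wave_Et \<kappa> c t ((deriv ^^ j) \<phi>)\<bar> \<le> B * seminorm 2 \<phi>"
    if \<phi>: "\<phi> \<in> test_functions" and "j \<le> 2" for \<phi> j
  proof -
    have "\<bar>(deriv ^^ j) \<phi> x\<bar> \<le> seminorm 2 \<phi>" for x
      using deriv_iter_le_sup_deriv[OF \<phi>] sup_deriv_le_seminorm[OF \<phi> \<open>j \<le> 2\<close>] order_trans by blast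
    then show "\<bar>wave_E \<kappa> c t ((deriv ^^ j) \<phi>)\<bar> \<le> B * seminorm 2 \<phi>" "\<bar>wave_Et \<kappa> c t ((deriv ^^ j) \<phi>)\<bar> \<le> B * seminorm 2 \<phi>"
      using B(2) smooth_continuous_on[OF smooth_deriv_iter[OF test_functions_smooth[OF \<phi>]]] by blast+
  qed
  have "\<bar>tele_op t \<phi>\<bar> \<le> C * seminorm 2 \<phi> \<and> \<bar>tele_op' t \<phi>\<bar> \<le> C * seminorm 2 \<phi>" if \<phi>: "\<phi> \<in> test_functions" for \<phi>
  proof -
    let ?N = "B * seminorm 2 \<phi>"
    have N: "0 \<le> ?N" using B(1) seminorm_nonneg[OF \<phi>] by simp
    have e: "\<bar>wave_E \<kappa> c t \<phi>\<bar> \<le> ?N" "\<bar>wave_Et \<kappa> c t \<phi>\<bar> \<le> ?N" "\<bar>wave_E \<kappa> c t (deriv \<phi>)\<bar> \<le> ?N"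
        "\<bar>wave_Et \<kappa> c t (deriv \<phi>)\<bar> \<le> ?N" "\<bar>wave_E \<kappa> c t (deriv (deriv \<phi>))\<bar> \<le> ?N"
      using est[OF \<phi>, of 0] est[OF \<phi>, of 1] est[OF \<phi>, of 2] by (simp_all add: numeral_2_eq_2)
    have m: "\<bar>x * y\<bar> \<le> \<bar>x\<bar> * ?N" if "\<bar>y\<bar> \<le> ?N" for x y
      unfolding abs_mult using that by (intro mult_left_mono) auto
    have tri: "\<bar>x + y + z\<bar> \<le> \<bar>x\<bar> + \<bar>y\<bar> + \<bar>z\<bar>" for x y z :: real
      by linarith
    have "\<bar>tele_op t \<phi>\<bar> \<le> ?N + \<bar>c\<bar> * ?N + \<bar>k / 2\<bar> * ?N"
      unfolding tele_op_def by (intro order_trans[OF tri] add_mono e m)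
    also have "\<dots> = (1 + \<bar>c\<bar> + \<bar>k\<bar> / 2) * ?N"
      by (simp add: distrib_right)
    also have "\<dots> \<le> (1 + \<bar>c\<bar> + \<bar>k\<bar> + c\<^sup>2 + k\<^sup>2) * ?N"
      using N by (intro mult_right_mono) (auto simp: add_increasing2)
    finally have 1: "\<bar>tele_op t \<phi>\<bar> \<le> C * seminorm 2 \<phi>"
      by (simp add: C_def mult.assoc)
    have "\<bar>tele_op' t \<phi>\<bar> \<le> \<bar>c\<^sup>2\<bar> * ?N + \<bar>k\<^sup>2 / 4\<bar> * ?N + \<bar>c\<bar> * ?N + \<bar>k / 2\<bar> * ?N"
      unfolding tele_op'_def
      by (intro order_trans[OF abs_triangle_ineq] add_mono order_trans[OF tri] e m)
    also have "\<dots> = (\<bar>c\<bar> + \<bar>k\<bar> / 2 + c\<^sup>2 + k\<^sup>2 / 4) * ?N"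
      by (simp add: distrib_right)
    also have "\<dots> \<le> (1 + \<bar>c\<bar> + \<bar>k\<bar> + c\<^sup>2 + k\<^sup>2) * ?N"
      using N by (intro mult_right_mono add_mono) auto
    finally have "\<bar>tele_op' t \<phi>\<bar> \<le> C * seminorm 2 \<phi>"
      by (simp add: C_def mult.assoc)
    with 1 show ?thesis ..
  qed
  then show ?thesis using that by blast
qed

lemma tele_sol_distributions: "tele_sol t \<in> distributions" "tele_sol' t \<in> distributions"
proof -
  obtain C where C: "\<And>\<phi>. \<phi> \<in> test_functions \<Longrightarrow> \<bar>tele_op t \<phi>\<bar> \<le> C * seminorm 2 \<phi>"
    "\<And>\<phi>. \<phi> \<in> test_functions \<Longrightarrow> \<bar>tele_op' t \<phi>\<bar> \<le> C * seminorm 2 \<phi>"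
    using tele_op_bound by blast
  let ?e = "exp (- (k / 2) * t)"
  show "tele_sol t \<in> distributions"
  proof (rule distributionsI[where C = "?e * C" and N = 2])
    show "\<bar>tele_sol t \<phi>\<bar> \<le> ?e * C * seminorm 2 \<phi>" if "\<phi> \<in> test_functions" for \<phi>
      using mult_left_mono[OF C(1)[OF that], of ?e] that by (simp add: tele_sol_def abs_mult mult.assoc)
  qed (auto simp: tele_sol_def test_functions_lincomb tele_op_lincomb test_functions_smooth algebra_simps)
  show "tele_sol' t \<in> distributions"
  proof (rule distributionsI[where C = "?e * (C + \<bar>k / 2\<bar> * C)" and N = 2])
    show "\<bar>tele_sol' t \<phi>\<bar> \<le> ?e * (C + \<bar>k / 2\<bar> * C) * seminorm 2 \<phi>" if \<phi>: "\<phi> \<in> test_functions" for \<phi>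
    proof -
      have "\<bar>tele_op' t \<phi> - k / 2 * tele_op t \<phi>\<bar> \<le> \<bar>tele_op' t \<phi>\<bar> + \<bar>k / 2\<bar> * \<bar>tele_op t \<phi>\<bar>"
        using abs_triangle_ineq4[of "tele_op' t \<phi>" "k / 2 * tele_op t \<phi>"] by (simp add: abs_mult)
      also have "\<dots> \<le> C * seminorm 2 \<phi> + \<bar>k / 2\<bar> * (C * seminorm 2 \<phi>)"
        by (intro add_mono mult_left_mono C \<phi>) auto
      finally have "?e * \<bar>tele_op' t \<phi> - k / 2 * tele_op t \<phi>\<bar> \<le> ?e * (C * seminorm 2 \<phi> + \<bar>k / 2\<bar> * (C * seminorm 2 \<phi>))"
        by (intro mult_left_mono) auto
      also have "\<dots> = ?e * (C + \<bar>k / 2\<bar> * C) * seminorm 2 \<phi>"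
        by (simp add: algebra_simps)
      finally show ?thesis using \<phi> by (simp add: tele_sol'_def abs_mult)
    qed
  qed (auto simp: tele_sol'_def test_functions_lincomb tele_op_lincomb test_functions_smooth algebra_simps)
qed

text \<open>Differentiating the exponential twice adds \<open>k\<^sup>2 / 4\<close> to the equal
  mass term, and the sum \<open>k\<^sup>2 / 2\<close> is exactly the zero-order part contained in -k
  \<open>tele_sol'\<close>.\<close>

lemma DERIV_tele_sol:
  assumes \<phi>: "\<phi> \<in> test_functions"
  shows "((\<lambda>t. tele_sol t \<phi>) has_real_derivative tele_sol' t \<phi>) (at t)"
    and "((\<lambda>t. tele_sol' t \<phi>) has_real_derivative c\<^sup>2 * tele_sol t (deriv (deriv \<phi>)) - k * tele_sol' t \<phi>) (at t)"
proof -
  note D = DERIV_tele_op[OF test_functions_smooth[OF \<phi>]]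
  have e: "((\<lambda>t. exp (- (k / 2) * t)) has_real_derivative - (k / 2) * exp (- (k / 2) * t)) (at t)"
    by (auto intro!: derivative_eq_intros)
  have "((\<lambda>t. exp (- (k / 2) * t) * tele_op t \<phi>) has_real_derivative
      exp (- (k / 2) * t) * (tele_op' t \<phi> - k / 2 * tele_op t \<phi>)) (at t)"
    by (rule DERIV_cong[OF DERIV_mult'[OF e D(1)]]) (simp add: algebra_simps)
  then show "((\<lambda>t. tele_sol t \<phi>) has_real_derivative tele_sol' t \<phi>) (at t)"
    using \<phi> by (simp add: tele_sol_def tele_sol'_def)
  have "((\<lambda>t. exp (- (k / 2) * t) * (tele_op' t \<phi> - k / 2 * tele_op t \<phi>)) has_real_derivative
      c\<^sup>2 * (exp (- (k / 2) * t) * tele_op t (deriv (deriv \<phi>)))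
      - k * (exp (- (k / 2) * t) * (tele_op' t \<phi> - k / 2 * tele_op t \<phi>))) (at t)"
    by (rule DERIV_cong[OF DERIV_mult'[OF e DERIV_diff[OF D(2) DERIV_cmult[OF D(1)]]]])
       (simp add: algebra_simps power2_eq_square)
  then show "((\<lambda>t. tele_sol' t \<phi>) has_real_derivative c\<^sup>2 * tele_sol t (deriv (deriv \<phi>)) - k * tele_sol' t \<phi>) (at t)"
    using \<phi> test_functions_deriv[OF test_functions_deriv[OF \<phi>]] by (simp add: tele_sol_def tele_sol'_def)
qed

lemma time_deriv_tele_sol: "time_deriv tele_sol t = tele_sol' t"
proof
  show "time_deriv tele_sol t \<phi> = tele_sol' t \<phi>" for \<phi>
    using DERIV_imp_deriv[OF DERIV_tele_sol(1), of \<phi> t]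
    by (cases "\<phi> \<in> test_functions") (auto simp: time_deriv_def tele_sol'_def)
qed

lemma C1_distr_tele_sol: "C1_distr tele_sol"
  unfolding C1_distr_def time_deriv_tele_sol
proof (intro conjI allI ballI)
  show "tele_sol t \<in> distributions" "tele_sol' t \<in> distributions" for t
    by (rule tele_sol_distributions)+
  show "(\<lambda>s. tele_sol s \<phi>) differentiable (at t)" if "\<phi> \<in> test_functions" for \<phi> t
    using DERIV_tele_sol(1)[OF that] real_differentiable_def by blast
  show "continuous_on UNIV (\<lambda>t. tele_sol' t \<phi>)" if "\<phi> \<in> test_functions" for \<phi>
    using DERIV_tele_sol(2)[OF that] by (meson DERIV_isCont continuous_at_imp_continuous_on)
qed

text \<open>At time 0 every \<open>wave_E\<close> term vanishes and \<open>wave_Et\<close> evaluates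
  at 0. The k / 2 in \<open>tele_op'\<close> cancels the derivative of the exponential, leaving c
  \<phi>'(0).\<close>

lemma tele_sol_initial:
  "tele_sol 0 = dirac 0" "tele_sol' 0 = distr_scale (- c) (distr_deriv (dirac 0))"
  by (auto simp: fun_eq_iff tele_sol_def tele_sol'_def tele_op_def tele_op'_def dirac_def
      distr_scale_def distr_deriv_def test_functions_deriv)

text \<open>The integrand has an explicit primitive H, obtained by integrating by parts in time. By
  the product rule for moving test functions the terms with the time derivative of the solution
  cancel, and H vanishes for large times.\<close>

lemma telegraph_weak_tele_sol: "telegraph_weak k c tele_sol"
  unfolding telegraph_weak_def
proof
  fix \<phi> :: "real \<times> real \<Rightarrow> real" assume \<phi>: "\<phi> \<in> test_functions"
  obtain R where R: "0 \<le> R" "vanishes_outside R \<phi>"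
    using test_functions_vanishes_outside[OF \<phi>] .
  have sm: "smooth \<phi>" using \<phi> by (simp add: test_functions_def)
  define good where "good f \<longleftrightarrow> smooth f \<and> vanishes_outside R f" for f :: "real \<times> real \<Rightarrow> real"
  have good: "good \<phi>" "good f \<Longrightarrow> good (partial_t f)" "good f \<Longrightarrow> good (partial_x f)" for f
    by (auto simp: good_def sm R smooth_partial vanishes_outside_partial)
  let ?s = "\<lambda>f t x. f (x, t)"
  have slice: "?s f t \<in> test_functions" if "good f" for f t
    using that slice_test_on test_on_test_functions by (simp add: good_def) blast
  have deriv_slice: "deriv (?s f t) = ?s (partial_x f) t" if "good f" for f t
    using DERIV_partial(1)[of f] that by (auto simp: good_def DERIV_imp_deriv)
  have P: "((\<lambda>t. tele_sol t (?s f t)) has_real_derivative tele_sol' t (?s f t) + tele_sol t (?s (partial_t f) t)) (at t)"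
    if "good f" for f t
    using distribution_product_rule[of tele_sol tele_sol', OF tele_sol_distributions(1) DERIV_tele_sol(1)
        test_derivative_slice[of f R t]] that by (simp add: good_def)
  have P': "((\<lambda>t. tele_sol' t (?s f t)) has_real_derivative
      (c\<^sup>2 * tele_sol t (?s (partial_x (partial_x f)) t) - k * tele_sol' t (?s f t)) + tele_sol' t (?s (partial_t f) t)) (at t)"
    if "good f" for f t
  proof -
    have "((\<lambda>t. tele_sol' t (?s f t)) has_real_derivative
      (c\<^sup>2 * tele_sol t (deriv (deriv (?s f t))) - k * tele_sol' t (?s f t)) + tele_sol' t (?s (partial_t f) t)) (at t)"
      using distribution_product_rule[of tele_sol' "\<lambda>s \<phi>. c\<^sup>2 * tele_sol s (deriv (deriv \<phi>)) - k * tele_sol' s \<phi>",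
          OF tele_sol_distributions(2) DERIV_tele_sol(2) test_derivative_slice[of f R t]] that
      by (simp add: good_def)
    then show ?thesis
      by (simp only: deriv_slice[OF that] deriv_slice[OF good(3)[OF that]])
  qed
  define w where "w t = tele_sol t (?s (partial_t (partial_t \<phi>)) t) - k * tele_sol t (?s (partial_t \<phi>) t)
      - c\<^sup>2 * tele_sol t (?s (partial_x (partial_x \<phi>)) t)" for t
  define H where "H t = tele_sol t (?s (partial_t \<phi>) t) - tele_sol' t (?s \<phi> t) - k * tele_sol t (?s \<phi> t)" for t
  have H: "(H has_real_derivative w t) (at t)" for t
    unfolding H_def w_def
    by (rule DERIV_cong[OF DERIV_diff[OF DERIV_diff[OF P P'] DERIV_cmult[OF P]]]) (simp_all add: good algebra_simps)
  have w: "isCont w t" for t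
    unfolding w_def[abs_def] by (intro continuous_intros DERIV_isCont[OF P]) (simp_all add: good)
  have integrand: "tele_sol t (\<lambda>x. (deriv ^^ 2) (\<lambda>s. \<phi> (x, s)) t - k * deriv (\<lambda>s. \<phi> (x, s)) t
      - c\<^sup>2 * (deriv ^^ 2) (\<lambda>y. \<phi> (y, t)) x) = w t" for t
  proof -
    note s1 = slice[OF good(2)[OF good(2)[OF good(1)]], of t] and s2 = slice[OF good(2)[OF good(1)], of t]
      and s3 = slice[OF good(3)[OF good(3)[OF good(1)]], of t]
    have d: "deriv (\<lambda>s. f (x, s)) = (\<lambda>s. partial_t f (x, s))" if "good f" for f x
      using DERIV_partial(2)[of f] that by (auto simp: good_def DERIV_imp_deriv)
    have A: "(\<lambda>x. (deriv ^^ 2) (\<lambda>s. \<phi> (x, s)) t - k * deriv (\<lambda>s. \<phi> (x, s)) t - c\<^sup>2 * (deriv ^^ 2) (\<lambda>y. \<phi> (y, t)) x) =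
        (\<lambda>x. 1 * (1 * partial_t (partial_t \<phi>) (x, t) + - k * partial_t \<phi> (x, t)) + - c\<^sup>2 * partial_x (partial_x \<phi>) (x, t))"
      by (simp add: numeral_2_eq_2 d good deriv_slice)
    have B: "tele_sol t (\<lambda>x. 1 * (1 * partial_t (partial_t \<phi>) (x, t) + - k * partial_t \<phi> (x, t)) + - c\<^sup>2 * partial_x (partial_x \<phi>) (x, t))
        = 1 * tele_sol t (\<lambda>x. 1 * partial_t (partial_t \<phi>) (x, t) + - k * partial_t \<phi> (x, t))
          + - c\<^sup>2 * tele_sol t (?s (partial_x (partial_x \<phi>)) t)"
      by (rule distributions_lincomb[OF tele_sol_distributions(1) test_functions_lincomb[OF s1 s2] s3])
    have C: "tele_sol t (\<lambda>x. 1 * partial_t (partial_t \<phi>) (x, t) + - k * partial_t \<phi> (x, t)) =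
        1 * tele_sol t (?s (partial_t (partial_t \<phi>)) t) + - k * tele_sol t (?s (partial_t \<phi>) t)"
      by (rule distributions_lincomb[OF tele_sol_distributions(1) s1 s2])
    show ?thesis
      unfolding A B C w_def by simp
  qed
  have zero: "tele_sol t (?s f t) = 0" "tele_sol' t (?s f t) = 0" if "good f" "R < \<bar>t\<bar>" for f t
  proof -
    have "?s f t x = 0 * ?s f t x + 0 * ?s f t x" for x
      using that by (simp add: good_def vanishes_outside_def)
    note z = test_functions_eqI_lincomb[OF slice[OF that(1)] slice[OF that(1)] _ this]
    show "tele_sol t (?s f t) = 0" "tele_sol' t (?s f t) = 0"
      using z[OF tele_sol_distributions(1)] z[OF tele_sol_distributions(2)] by simp_all
  qed
  have w0: "w t = 0" and H0: "H t = 0" if "R < \<bar>t\<bar>" for t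
    unfolding w_def H_def using zero[OF good(1) that] zero[OF good(2)[OF good(1)] that]
      zero[OF good(2)[OF good(2)[OF good(1)]] that] zero[OF good(3)[OF good(3)[OF good(1)]] that] by simp_all
  \<comment> \<open>Vanishing is known only for times strictly beyond R, so the interval is widened
    by 1.\<close>
  have "has_bochner_integral lborel (\<lambda>t. w t * indicator {- (R + 1)..R + 1} t) (H (R + 1) - H (- (R + 1)))"
    using R(1) H w by (intro has_bochner_integral_FTC_Icc_real) auto
  moreover have "(\<lambda>t. w t * indicator {- (R + 1)..R + 1} t) = w"
  proof
    show "w t * indicator {- (R + 1)..R + 1} t = w t" for t
      using w0[of t] by (cases "R < \<bar>t\<bar>") (auto simp: indicator_def)
  qed
  moreover have "H (R + 1) = 0" "H (- (R + 1)) = 0"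
    using H0[of "R + 1"] H0[of "- (R + 1)"] R(1) by simp_all
  ultimately have "has_bochner_integral lborel w 0" by simp
  then show "has_bochner_integral lborel (\<lambda>t. tele_sol t (\<lambda>x. (deriv ^^ 2) (\<lambda>s. \<phi> (x, s)) t - k * deriv (\<lambda>s. \<phi> (x, s)) t
      - c\<^sup>2 * (deriv ^^ 2) (\<lambda>y. \<phi> (y, t)) x)) 0"
    unfolding integrand .
qed

lemma telegraph_solution_tele_sol: "telegraph_solution k c tele_sol"
  unfolding telegraph_solution_def time_deriv_tele_sol
  by (intro conjI C1_distr_tele_sol telegraph_weak_tele_sol tele_sol_initial)

text \<open>Pairing a solution at time \<open>s\<close> with the backward classical solution that has velocity \<open>\<psi>\<close>
  at time \<open>T\<close> gives a quantity that does not depend on \<open>s\<close>.\<close>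

lemma telegraph_solution_unique:
  assumes "telegraph_solution k c u"
  shows "u T = tele_sol T"
proof
  fix \<psi> :: "real \<Rightarrow> real"
  have C1: "C1_distr u" and weak: "telegraph_weak k c u" and u0: "u 0 = dirac 0"
    and u0': "time_deriv u 0 = distr_scale (- c) (distr_deriv (dirac 0))"
    using assms by (auto simp: telegraph_solution_def)
  have dist: "u s \<in> distributions" "time_deriv u s \<in> distributions" for s
    using C1 by (auto simp: C1_distr_def)
  show "u T \<psi> = tele_sol T \<psi>"
  proof (cases "\<psi> \<in> test_functions")
    case False
    have "u T \<in> extensional test_functions" using dist by (simp add: distributions_def)
    then show ?thesis using False by (simp add: extensional_def tele_sol_def)
  next
    case True
    then obtain R where R: "\<psi> \<in> test_on R" using test_functions_test_on by blast
    have sm: "smooth \<psi>" using R by (rule test_on_smooth)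
    define F where "F = trans_E \<kappa> c \<psi> 0"
    define F' where "F' = trans_E' \<kappa> c \<psi> 0"
    define F'' where "F'' \<tau> y = c\<^sup>2 * trans_E \<kappa> c \<psi> 2 \<tau> y + k\<^sup>2 / 4 * F \<tau> y" for \<tau> y
    let ?S = "\<lambda>s. R + \<bar>c\<bar> * (\<bar>T - s\<bar> + 1)"
    have td: "test_derivative (?S s) (\<lambda>s. F (T - s)) (\<lambda>y. - F' (T - s) y) s"
      "test_derivative (?S s) (\<lambda>s. F' (T - s)) (\<lambda>y. - F'' (T - s) y) s" for s
      using test_derivative_trans[OF R refl, where T = T and s = s and a = \<kappa> and c = c] by (simp_all add: F_def F'_def F''_def)
    have F: "F \<tau> \<in> test_functions" "F' \<tau> \<in> test_functions" for \<tau>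
    proof -
      have "F (T - (T - \<tau>) - 0) \<in> test_on (?S (T - \<tau>))" "F' (T - (T - \<tau>) - 0) \<in> test_on (?S (T - \<tau>))"
        using td[of "T - \<tau>"] unfolding test_derivative_def by (auto dest: spec[of _ 0])
      then show "F \<tau> \<in> test_functions" "F' \<tau> \<in> test_functions"
        using test_on_test_functions by auto
    qed
    have F2: "deriv (deriv (F \<tau>)) = trans_E \<kappa> c \<psi> 2 \<tau>" and F1: "deriv (F \<tau>) 0 = wave_E \<kappa> c \<tau> (deriv \<psi>)" for \<tau>
    proof -
      have "deriv (trans_E \<kappa> c \<psi> j \<tau>) = trans_E \<kappa> c \<psi> (Suc j) \<tau>" for j
        using DERIV_trans_y(1)[OF sm] by (auto simp: DERIV_imp_deriv)
      then show "deriv (deriv (F \<tau>)) = trans_E \<kappa> c \<psi> 2 \<tau>" "deriv (F \<tau>) 0 = wave_E \<kappa> c \<tau> (deriv \<psi>)"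
        by (simp_all add: F_def numeral_2_eq_2) (simp add: trans_E_def)
    qed
    have uF'': "u s (\<lambda>y. - F'' \<tau> y) = - (c\<^sup>2 * u s (deriv (deriv (F \<tau>)))) - k\<^sup>2 / 4 * u s (F \<tau>)" for s \<tau>
      using test_functions_eqI_lincomb[OF test_functions_deriv[OF test_functions_deriv[OF F(1)[of \<tau>]]] F(1)[of \<tau>] dist(1)[of s],
          of "\<lambda>y. - F'' \<tau> y" "- c\<^sup>2" "- (k\<^sup>2 / 4)"]
      by (simp add: F''_def F2)
    have uF': "\<Lambda> (\<lambda>y. - F' \<tau> y) = - \<Lambda> (F' \<tau>)" if "\<Lambda> \<in> distributions" for \<Lambda> \<tau>
      using test_functions_eqI_lincomb[OF F(2)[of \<tau>] F(2)[of \<tau>] that, of "\<lambda>y. - F' \<tau> y" "- 1" 0] by simp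
    \<comment> \<open>In terms of v = exp (k s / 2) u this is the Wronskian-type pairing of v_s with
      F plus that of v with F', taken at \<tau> = T - s. Reversing time makes the two Klein-Gordon
      terms cancel in its derivative.\<close>
    define h where "h s = exp (k / 2 * s) *
      (time_deriv u s (F (T - s)) + k / 2 * u s (F (T - s)) + u s (F' (T - s)))" for s
    have "(h has_real_derivative 0) (at s)" for s
    proof -
      have D1: "((\<lambda>s. u s (F (T - s))) has_real_derivative time_deriv u s (F (T - s)) - u s (F' (T - s))) (at s)"
        using distribution_product_rule[OF dist(1) C1_distr_DERIV[OF C1] td(1)] by (simp add: uF' dist)
      have D2: "((\<lambda>s. u s (F' (T - s))) has_real_derivative time_deriv u s (F' (T - s))
          + (- (c\<^sup>2 * u s (deriv (deriv (F (T - s))))) - k\<^sup>2 / 4 * u s (F (T - s)))) (at s)"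
        using distribution_product_rule[OF dist(1) C1_distr_DERIV[OF C1] td(2)] by (simp only: uF'')
      have D3: "((\<lambda>s. time_deriv u s (F (T - s))) has_real_derivative
          (c\<^sup>2 * u s (deriv (deriv (F (T - s)))) - k * time_deriv u s (F (T - s))) - time_deriv u s (F' (T - s))) (at s)"
        using distribution_product_rule[of "time_deriv u" "\<lambda>s \<phi>. c\<^sup>2 * u s (deriv (deriv \<phi>)) - k * time_deriv u s \<phi>",
            OF dist(2) telegraph_strong[OF C1 weak] td(1)] by (simp add: uF' dist)
      have e: "((\<lambda>s. exp (k / 2 * s)) has_real_derivative k / 2 * exp (k / 2 * s)) (at s)"
        by (auto intro!: derivative_eq_intros)
      show ?thesis
        unfolding h_def
        by (rule DERIV_cong[OF DERIV_mult'[OF e DERIV_add[OF DERIV_add[OF D3 DERIV_cmult[OF D1]] D2]]])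
           (simp add: algebra_simps power2_eq_square)
    qed
    then have "h T = h 0" by (intro DERIV_isconst_all) auto
    moreover have "h T = exp (k / 2 * T) * u T \<psi>"
    proof -
      have "F 0 = (\<lambda>_. 0)" "F' 0 = \<psi>"
        by (auto simp: F_def F'_def trans_E_def trans_E'_def fun_eq_iff)
      moreover have "u T (\<lambda>_. 0) = 0" "time_deriv u T (\<lambda>_. 0) = 0"
        using distributions_lincomb[OF dist(1) True True, of T 0 0]
          distributions_lincomb[OF dist(2) True True, of T 0 0] by simp_all
      ultimately show ?thesis by (simp add: h_def)
    qed
    \<comment> \<open>The derivative of \<delta> in the data hits F(T) and gives the term with
      \<open>deriv \<psi>\<close>; the other two terms are F' and k / 2 F at y = 0, where
      translation is trivial.\<close>
    moreover have "h 0 = tele_op T \<psi>"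
      using F by (simp add: h_def u0 u0' dirac_def distr_scale_def distr_deriv_def test_functions_deriv F1)
        (simp add: F_def F'_def trans_E_def trans_E'_def tele_op_def)
    ultimately have "u T \<psi> = exp (- (k / 2 * T)) * tele_op T \<psi>"
      by (simp add: exp_minus field_simps)
    then show ?thesis using True by (simp add: tele_sol_def)
  qed
qed

end

section \<open>The explicit density\<close>

context
  fixes k c :: real
  assumes k: "k > 0" and c: "c > 0"
begin

text \<open>The bracket of the theorem through \<open>bessel_J\<close>: I0'(2 \<alpha> r) / r equals
  \<alpha> times \<open>bessel_J 1\<close> at the square of \<alpha> r. In this form it is
  continuous on the whole line, including the light cone, with no division by a root.\<close>

definition tele_density :: "real \<Rightarrow> real \<Rightarrow> real" where
  "tele_density t x = (let z = (k / (4 * c))\<^sup>2 * (c\<^sup>2 * t\<^sup>2 - x\<^sup>2) in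
     (k / (4 * c))\<^sup>2 * (x + c * t) * bessel_J 1 z + k / (4 * c) * bessel_J 0 z)"

text \<open>The mean of \<phi> at the two ends from \<open>wave_Et\<close> and the half difference
  from \<open>wave_E_deriv\<close> add up to \<phi>(c t); the end -c t drops out.\<close>

lemma tele_op_integral:
  assumes "smooth \<phi>"
  shows "tele_op k c t \<phi> = \<phi> (c * t) + integral {-1..1} (\<lambda>s. c * t * (tele_density t (c * t * s) * \<phi> (c * t * s)))"
proof -
  let ?a = "k\<^sup>2 / 16"
  let ?J = "\<lambda>j s. bessel_J j (wave_arg ?a t s)"
  note cc = continuous_on_UNIV_compose[OF smooth_continuous_on[OF assms]]
  define I0 where "I0 = integral {-1..1} (\<lambda>s. ?J 0 s * \<phi> (c * t * s))"
  define I1 where "I1 = integral {-1..1} (\<lambda>s. ?J 1 s * \<phi> (c * t * s))"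
  define I2 where "I2 = integral {-1..1} (\<lambda>s. ?J 1 s * s * \<phi> (c * t * s))"
  have arg: "(k / (4 * c))\<^sup>2 * (c\<^sup>2 * t\<^sup>2 - (c * t * s)\<^sup>2) = wave_arg ?a t s" for s
    using c by (simp add: wave_arg_def power_mult_distrib power_divide field_simps)
  have dens: "c * t * tele_density t (c * t * s) = ?a * t\<^sup>2 * ?J 1 s + ?a * t\<^sup>2 * (?J 1 s * s) + k * t / 4 * ?J 0 s" for s
  proof -
    define q where "q = k / (4 * c)"
    have "k = 4 * q * c" using c by (simp add: q_def)
    then have A: "?a * t\<^sup>2 = q\<^sup>2 * c\<^sup>2 * t\<^sup>2" "k * t / 4 = q * c * t"
      by (simp_all add: power_mult_distrib)
    have "c * t * (q\<^sup>2 * (c * t * s + c * t) * j1 + q * j0) =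
        q\<^sup>2 * c\<^sup>2 * t\<^sup>2 * j1 + q\<^sup>2 * c\<^sup>2 * t\<^sup>2 * (j1 * s) + q * c * t * j0" for j0 j1
      by (simp add: power2_eq_square algebra_simps)
    then show ?thesis
      unfolding tele_density_def Let_def A q_def[symmetric] arg[of s, folded q_def] .
  qed
  have "c * t * (tele_density t (c * t * s) * \<phi> (c * t * s)) =
      ?a * t\<^sup>2 * (?J 1 s * \<phi> (c * t * s)) + ?a * t\<^sup>2 * (?J 1 s * s * \<phi> (c * t * s)) + k * t / 4 * (?J 0 s * \<phi> (c * t * s))" for s
    unfolding mult.assoc[of "c * t", symmetric] dens by (simp only: distrib_right mult.assoc)
  then have "integral {-1..1} (\<lambda>s. c * t * (tele_density t (c * t * s) * \<phi> (c * t * s))) =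
      integral {-1..1} (\<lambda>s. ?a * t\<^sup>2 * (?J 1 s * \<phi> (c * t * s)) + ?a * t\<^sup>2 * (?J 1 s * s * \<phi> (c * t * s)) + k * t / 4 * (?J 0 s * \<phi> (c * t * s)))"
    by (simp only:)
  also have "\<dots> = ?a * t\<^sup>2 * I1 + ?a * t\<^sup>2 * I2 + k * t / 4 * I0"
    unfolding I0_def I1_def I2_def
    by (subst integral_add, (intro integrable_continuous_real continuous_intros cc)+,
        subst integral_add, (intro integrable_continuous_real continuous_intros cc)+, simp only: integral_cmult)
  finally have "integral {-1..1} (\<lambda>s. c * t * (tele_density t (c * t * s) * \<phi> (c * t * s))) =
      ?a * t\<^sup>2 * I1 + ?a * t\<^sup>2 * I2 + k * t / 4 * I0" .
  moreover have "c * wave_E ?a c t (deriv \<phi>) = (\<phi> (c * t) - \<phi> (- (c * t))) / 2 + ?a * t\<^sup>2 * I2"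
    unfolding I2_def by (intro wave_E_deriv smooth_has_deriv smooth_continuous_on smooth_deriv assms)
  ultimately show ?thesis
    unfolding tele_op_def wave_Et_def[of ?a] wave_E_def[of ?a c t \<phi>] I0_def[symmetric] I1_def[symmetric]
    by (simp add: field_simps)
qed

lemma tele_density_integral:
  assumes t: "0 \<le> t" and \<phi>: "smooth \<phi>"
  shows "integrable lborel (\<lambda>x. tele_density t x * indicator {- (c * t)<..<c * t} x * \<phi> x)"
    and "(\<integral>x. tele_density t x * indicator {- (c * t)<..<c * t} x * \<phi> x \<partial>lborel) = tele_op k c t \<phi> - \<phi> (c * t)"
proof -
  let ?f = "\<lambda>x. tele_density t x * \<phi> x" and ?I = "{- (c * t)<..<c * t}"
  have f: "continuous_on A ?f" for A
    unfolding tele_density_def Let_def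
    by (intro continuous_intros continuous_on_subset[OF smooth_continuous_on[OF \<phi>, of UNIV] subset_UNIV])
  have "set_integrable lborel {- (c * t)..c * t} ?f"
    unfolding set_integrable_def using borel_integrable_compact[OF compact_Icc f] by (simp add: real_scaleR_def)
  then have si: "set_integrable lborel ?I ?f"
    by (rule set_integrable_subset) auto
  have eq: "tele_density t x * indicator ?I x * \<phi> x = indicator ?I x *\<^sub>R ?f x" for x
    by simp
  show "integrable lborel (\<lambda>x. tele_density t x * indicator ?I x * \<phi> x)"
    using si unfolding set_integrable_def eq .
  have "(\<integral>x. tele_density t x * indicator ?I x * \<phi> x \<partial>lborel) = (LINT x:?I|lborel. ?f x)"
    unfolding set_lebesgue_integral_def eq ..
  also have "\<dots> = integral {- (c * t)..c * t} ?f"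
    using set_borel_integral_eq_integral(2)[OF si] integral_open_interval_real[of "- (c * t)" "c * t" ?f] by linarith
  \<comment> \<open>The substitution x = c t s undoes the rescaling of the light cone; c t is
    nonnegative, so the orientation is kept, and t = 0 is included.\<close>
  also have "\<dots> = integral {-1..1} (\<lambda>s. c * t * ?f (c * t * s))"
  proof -
    have "((\<lambda>s. (c * t) *\<^sub>R ?f (c * t * s)) has_integral integral {c * t * (-1)..c * t * 1} ?f) {-1..1}"
    proof (rule has_integral_substitution[where c = "- (c * t)" and d = "c * t"])
      have "0 \<le> c * t" using t c by simp
      then show "(\<lambda>s. c * t * s) ` {-1..1} \<subseteq> {- (c * t)..c * t}"
        using mult_left_mono[of "-1" _ "c * t"] by (fastforce simp: mult_left_le)
      show "c * t * (-1) \<le> c * t * 1" using \<open>0 \<le> c * t\<close> by simp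
      show "((\<lambda>s. c * t * s) has_real_derivative c * t) (at s within {-1..1})" for s
        by (auto intro!: derivative_eq_intros)
    qed (use f in auto)
    from integral_unique[OF this] show ?thesis by simp
  qed
  finally show "(\<integral>x. tele_density t x * indicator ?I x * \<phi> x \<partial>lborel) = tele_op k c t \<phi> - \<phi> (c * t)"
    using tele_op_integral[OF \<phi>] by simp
qed

text \<open>Conservation of mass. The constant 1 has no compact support, but \<open>tele_op\<close>
  is defined on all smooth functions. The spatial terms disappear and what remains of
  \<open>tele_op'\<close> is k / 2 times \<open>tele_op\<close>.\<close>

lemma tele_op_one: "tele_op k c t (\<lambda>_. 1) = exp (k / 2 * t)"
proof -
  have s: "smooth (\<lambda>_::real. 1::real)"
    using smooth_from_derivs(1)[of "\<lambda>j _. if j = 0 then 1 else 0" 0] by simp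
  have z: "wave_E a c t (\<lambda>_. 0) = 0" "wave_Et a c t (\<lambda>_. 0) = 0" for a t
    by (simp_all add: wave_E_def wave_Et_def)
  have D: "((\<lambda>t. tele_op k c t (\<lambda>_. 1)) has_real_derivative k / 2 * tele_op k c t (\<lambda>_. 1)) (at t)" for t
    by (rule DERIV_cong[OF DERIV_tele_op(1)[OF s]])
       (simp add: tele_op_def tele_op'_def z field_simps power2_eq_square)
  have "((\<lambda>t. exp (- (k / 2 * t)) * tele_op k c t (\<lambda>_. 1)) has_real_derivative 0) (at t)" for t
    using D by (auto intro!: derivative_eq_intros)
  then have "exp (- (k / 2 * t)) * tele_op k c t (\<lambda>_. 1) = exp (- (k / 2 * 0)) * tele_op k c 0 (\<lambda>_. 1)"
    by (intro DERIV_isconst_all) auto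
  then show ?thesis
    by (simp add: tele_op_def exp_minus field_simps)
qed

lemma tele_sol_eq:
  assumes "0 \<le> t"
  shows "tele_sol k c t = distr_add (distr_scale (exp (- (k / 2) * t)) (dirac (c * t)))
    (distr_of_fun (\<lambda>x. exp (- (k / 2) * t) * tele_density t x * indicator {- (c * t)<..<c * t} x))"
proof
  fix \<phi> :: "real \<Rightarrow> real"
  let ?e = "exp (- (k / 2) * t)"
  have "(\<integral>x. ?e * tele_density t x * indicator {- (c * t)<..<c * t} x * \<phi> x \<partial>lborel) = ?e * (tele_op k c t \<phi> - \<phi> (c * t))"
    if "\<phi> \<in> test_functions"
    using tele_density_integral(2)[OF assms test_functions_smooth[OF that]]
      integral_mult_right_zero[of lborel ?e "\<lambda>x. tele_density t x * indicator {- (c * t)<..<c * t} x * \<phi> x"]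
    by (simp add: mult.assoc)
  then show "tele_sol k c t \<phi> = distr_add (distr_scale ?e (dirac (c * t)))
      (distr_of_fun (\<lambda>x. ?e * tele_density t x * indicator {- (c * t)<..<c * t} x)) \<phi>"
    by (cases "\<phi> \<in> test_functions")
       (simp_all add: tele_sol_def distr_add_def distr_scale_def dirac_def distr_of_fun_def algebra_simps)
qed

lemma mixed_pdf_tele_sol:
  assumes t: "0 \<le> t"
  shows "mixed_pdf (tele_sol k c t)"
  unfolding tele_sol_eq[OF t]
proof (rule mixed_pdf_atom_plus_density)
  let ?e = "exp (- (k / 2) * t)" and ?I = "{- (c * t)<..<c * t}"
  let ?f = "\<lambda>x. ?e * tele_density t x * indicator ?I x"
  have s: "smooth (\<lambda>_::real. 1::real)"
    using smooth_from_derivs(1)[of "\<lambda>j _. if j = 0 then 1 else 0" 0] by simp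
  note int = tele_density_integral[OF t s]
  have eq: "?f = (\<lambda>x. ?e * (tele_density t x * indicator ?I x * 1))" by (simp add: mult.assoc)
  show "integrable lborel ?f"
    unfolding eq by (intro integrable_mult_right int)
  then show "?f \<in> borel_measurable borel"
    using borel_measurable_integrable by force
  \<comment> \<open>The total mass of \<open>tele_op\<close> minus its atom of weight 1, before
    damping; the damped atom restores the sum to 1.\<close>
  have "(\<integral>x. ?f x \<partial>lborel) = ?e * (exp (k / 2 * t) - 1)"
    unfolding eq integral_mult_right_zero int(2) tele_op_one ..
  also have "\<dots> = 1 - ?e"
    by (simp add: right_diff_distrib flip: exp_add)
  finally show "?e + (\<integral>x. ?f x \<partial>lborel) = 1" by simp
  show "0 \<le> ?f x" for x
  proof (cases "x \<in> ?I")
    case True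
    \<comment> \<open>Inside the cone the Bessel argument is nonnegative, so the power series has
      only nonnegative terms; the factor x + c t is nonnegative there too.\<close>
    then have "x\<^sup>2 \<le> (c * t)\<^sup>2"
      by (intro abs_le_square_iff[THEN iffD1]) auto
    then have "0 \<le> (k / (4 * c))\<^sup>2 * (c\<^sup>2 * t\<^sup>2 - x\<^sup>2)"
      by (simp add: power_mult_distrib)
    note J = bessel_J_nonneg[OF this]
    have "0 \<le> x + c * t" "0 \<le> k / (4 * c)" using True k c by auto
    then have "0 \<le> tele_density t x"
      unfolding tele_density_def Let_def
      by (intro add_nonneg_nonneg[OF mult_nonneg_nonneg[OF mult_nonneg_nonneg[OF zero_le_power2]]
            mult_nonneg_nonneg] J)
    then show ?thesis by simp
  qed simp
qed auto

lemma tele_density_bessel_I0: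
  assumes x: "x \<in> {- (c * t)<..<c * t}" and lam: "lam = c\<^sup>2 * t\<^sup>2 - x\<^sup>2" and \<alpha>: "\<alpha> = k / (4 * c)"
  shows "tele_density t x = \<alpha> * (x + c * t) * (deriv bessel_I0 (2 * \<alpha> * sqrt lam) / sqrt lam)
    + k / (4 * c) * bessel_I0 (2 * \<alpha> * sqrt lam)"
proof -
  have "\<bar>x\<bar>\<^sup>2 < (c * t)\<^sup>2"
    by (rule power_strict_mono) (use x in auto)
  \<comment> \<open>Strict positivity, from the open interval, allows the root in the Bessel
    derivative to cancel the one in the denominator.\<close>
  then have lam0: "0 < lam" by (simp add: lam power_mult_distrib)
  have z: "(2 * \<alpha> * sqrt lam)\<^sup>2 / 4 = \<alpha>\<^sup>2 * lam"
    using lam0 by (simp add: power_mult_distrib)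
  show ?thesis
    unfolding tele_density_def deriv_bessel_I0 bessel_I0_eq z Let_def lam[symmetric] \<alpha>[symmetric]
    using lam0 by (simp add: power2_eq_square)
qed

end

theorem theorem6p2:
  fixes k c \<alpha> :: real
  assumes "k > 0" and "c > 0" and "\<alpha> = k / (4 * c)"
  shows "(\<exists>!u. telegraph_solution k c u) \<and>
    (\<forall>u. telegraph_solution k c u \<longrightarrow> (\<forall>t\<ge>0.
       mixed_pdf (u t) \<and>
       u t = distr_add
         (distr_scale (exp (- (k / 2) * t)) (dirac (c * t)))
         (distr_of_fun (\<lambda>x. let lam0 = c\<^sup>2 * t\<^sup>2 - x\<^sup>2 in
            exp (- (k / 2) * t) *
            (\<alpha> * (x + c * t) * (deriv bessel_I0 (2 * \<alpha> * sqrt lam0) / sqrt lam0)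
              + k / (4 * c) * bessel_I0 (2 * \<alpha> * sqrt lam0)) *
            indicator {- (c * t)<..<c * t} x))))"
proof (intro conjI allI impI)
  have eq: "u = tele_sol k c" if "telegraph_solution k c u" for u
    using telegraph_solution_unique[OF that] by auto
  show "\<exists>!u. telegraph_solution k c u"
    using telegraph_solution_tele_sol eq by blast
  fix u t assume u: "telegraph_solution k c u" and t: "0 \<le> (t::real)"
  show "mixed_pdf (u t)"
    using mixed_pdf_tele_sol[OF assms(1,2) t] eq[OF u] by simp
  have "(\<lambda>x. let lam0 = c\<^sup>2 * t\<^sup>2 - x\<^sup>2 in
            exp (- (k / 2) * t) *
            (\<alpha> * (x + c * t) * (deriv bessel_I0 (2 * \<alpha> * sqrt lam0) / sqrt lam0)
              + k / (4 * c) * bessel_I0 (2 * \<alpha> * sqrt lam0)) *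
            indicator {- (c * t)<..<c * t} x) =
      (\<lambda>x. exp (- (k / 2) * t) * tele_density k c t x * indicator {- (c * t)<..<c * t} x)"
    \<comment> \<open>Off the open interval the indicator makes both sides 0; this includes
      \<open>lam0\<close> = 0, where the quotient by the root takes its default value 0.\<close>
    using tele_density_bessel_I0[OF assms(1,2) _ refl assms(3)]
    by (auto simp: fun_eq_iff Let_def indicator_def)
  then show "u t = distr_add
         (distr_scale (exp (- (k / 2) * t)) (dirac (c * t)))
         (distr_of_fun (\<lambda>x. let lam0 = c\<^sup>2 * t\<^sup>2 - x\<^sup>2 in
            exp (- (k / 2) * t) *
            (\<alpha> * (x + c * t) * (deriv bessel_I0 (2 * \<alpha> * sqrt lam0) / sqrt lam0)
              + k / (4 * c) * bessel_I0 (2 * \<alpha> * sqrt lam0)) *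
            indicator {- (c * t)<..<c * t} x))"
    using tele_sol_eq[OF assms(1,2) t] eq[OF u] by simp
qed

end
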